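(* Let $K$ be a field and let $f(x)\in K[x]$ be a polynomial of degree $d\ge2$ with $d$ coprime to $\operatorname{char}K$. Let $g_\infty\in\overline{\mathrm{Arb}}(f)$ be the image of an inertia generator over $\infty$, and let $\chi_{\mathrm{cyc}}$ be the cyclotomic character of $K$. Then for every $1\le\ell\le\infty$ we have $\widehat K_{f,\ell}\subseteq K(\zeta_{d^\infty})$, and an element $\tau\in\operatorname{Gal}(K^{\mathrm{sep}}/K)$ fixes $\widehat K_{f,\ell}$ (pointwise) if and only if $g_\infty\sim_\ell g_\infty^{\chi_{\mathrm{cyc}}(\tau)}$ in $\overline{\mathrm{Arb}}(f)$.
   Context: Let $t$ be transcendental over $K$, fix a separable closure $K(t)^{\mathrm{sep}}$, and let $K^{\mathrm{sep}}$ be the separable closure of $K$ in it. For $\ell\ge0$, $f^{-\ell}(t)$ is the set of the $d^\ell$ roots of $f^\ell(x)=t$ in $K(t)^{\mathrm{sep}}$ ($f^\ell$ the $\ell$-fold composition), and $K(f^{-\infty}(t))=\bigcup_\ell K(f^{-\ell}(t))$, similarly with $K^{\mathrm{sep}}$ in place of $K$. $\widehat K_{f,\ell}$ is the algebraic closure of $K$ in $K(f^{-\ell}(t))$, for $1\le\ell\le\infty$. $K(\zeta_{d^\infty})$ is obtained from $K$ by adjoining all roots of unity of order dividing a power of $d$. The sets $f^{-\ell}(t)$ form a regular rooted $d$-ary tree with root $t$, where $\alpha\in f^{-\ell}(t)$ ($\ell\geq 1$) is a child of $f(\alpha)$; $\overline{\mathrm{Arb}}(f)$ is the image of $\operatorname{Gal}(K(t)^{\mathrm{sep}}/K^{\mathrm{sep}}(t))$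 in the automorphism group of this tree, and is isomorphic to $\operatorname{Gal}(K^{\mathrm{sep}}(f^{-\infty}(t))/K^{\mathrm{sep}}(t))$. An inertia generator over $\infty$ is a topological generator of the (procyclic) inertia group in this Galois group of a place of $K^{\mathrm{sep}}(f^{-\infty}(t))$ above the place $t=\infty$ of $K^{\mathrm{sep}}(t)$; it topologically generates a group isomorphic to $\mathbb Z_d=\varprojlim_k\mathbb Z/d^k\mathbb Z$. $\rho_\ell$ denotes restriction of the action to the first $\ell$ levels of the tree ($\rho_\infty$ is the identity). For $g,h\in\overline{\mathrm{Arb}}(f)$, "$g\sim_\ell h$ in $\overline{\mathrm{Arb}}(f)$" means $\rho_\ell(g)$ and $\rho_\ell(h)$ are conjugate in $\rho_\ell(\overline{\mathrm{Arb}}(f))$. The cyclotomic character $\chi_{\mathrm{cyc}}:\operatorname{Gal}(K^{\mathrm{sep}}/K)\to\prod_{p\neq\operatorname{char}K}\mathbb Z_p^\times$ is defined by $\tau(\zeta)=\zeta^{\chi_{\mathrm{cyc}}(\tau)}$ for all roots of unity $\zeta\in K^{\mathrm{sep}}$; the power $g_\infty^{\chi_{\mathrm{cyc}}(\tau)}$ depends only on the image of $\chi_{\mathrm{cyc}}(\tau)$ in $\mathbb Z_d^\times$. *)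

theory Defs
  imports
    "HOL-Computational_Algebra.Computational_Algebra"
    "HOL-Library.Extended_Nat"
    "HOL-Algebra.Bij"
    "HOL-Algebra.Generated_Groups"
    "HOL-Analysis.Function_Topology"
begin

text \<open>The type \<open>'a\<close> plays the role of the separable closure \<open>K(t)\<^sup>s\<^sup>e\<^sup>p\<close>; the field \<open>K\<close> and all
  intermediate fields are subsets of it.\<close>

definition is_subfield :: "'a::field set \<Rightarrow> bool" where
  "is_subfield F \<longleftrightarrow> 0 \<in> F \<and> 1 \<in> F \<and>
     (\<forall>x\<in>F. \<forall>y\<in>F. x - y \<in> F \<and> x * y \<in> F) \<and> (\<forall>x\<in>F. inverse x \<in> F)"

definition field_adjoin :: "'a::field set \<Rightarrow> 'a set \<Rightarrow> 'a set" where
  "field_adjoin F S = is_subfield hull (F \<union> S)"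

definition algebraic_over :: "'a::field set \<Rightarrow> 'a \<Rightarrow> bool" where
  "algebraic_over F x \<longleftrightarrow> (\<exists>p. p \<noteq> 0 \<and> set (coeffs p) \<subseteq> F \<and> poly p x = 0)"

definition is_min_poly :: "'a::field set \<Rightarrow> 'a \<Rightarrow> 'a poly \<Rightarrow> bool" where
  "is_min_poly F x p \<longleftrightarrow>
     lead_coeff p = 1 \<and> set (coeffs p) \<subseteq> F \<and> poly p x = 0 \<and>
     (\<forall>q. q \<noteq> 0 \<and> set (coeffs q) \<subseteq> F \<and> poly q x = 0 \<longrightarrow> degree p \<le> degree q)"

definition separable_poly :: "'a::field poly \<Rightarrow> bool" where
  "separable_poly p \<longleftrightarrow> coprime p (pderiv p)"

definition separable_over :: "'a::field set \<Rightarrow> 'a \<Rightarrow> bool" where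
  "separable_over F x \<longleftrightarrow> (\<exists>p. is_min_poly F x p \<and> separable_poly p)"

definition UNIV_sep_closure_of :: "'a::field set \<Rightarrow> bool" where
  "UNIV_sep_closure_of F \<longleftrightarrow>
     (\<forall>x. separable_over F x) \<and>
     (\<forall>p :: 'a poly. degree p > 0 \<and> separable_poly p \<longrightarrow> (\<exists>x. poly p x = 0))"

definition sep_closure :: "'a::field set \<Rightarrow> 'a set" where
  "sep_closure F = {x. separable_over F x}"

definition Gal :: "'a::field set \<Rightarrow> 'a set \<Rightarrow> ('a \<Rightarrow> 'a) monoid" where
  "Gal M F = (BijGroup M)
     \<lparr>carrier := {\<sigma> \<in> Bij M. (\<forall>x\<in>M. \<forall>y\<in>M. \<sigma> (x + y) = \<sigma> x + \<sigma> y \<and> \<sigma> (x * y) = \<sigma> x * \<sigma> y) \<and>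
                             (\<forall>x\<in>F. \<sigma> x = x)}\<rparr>"

text \<open>The topology of pointwise convergence on self-maps of a discrete set. It induces the Krull
  topology on a Galois group and the profinite topology on the automorphism group of a rooted tree
  all of whose levels are finite.\<close>

definition pointwise_topology :: "'a set \<Rightarrow> ('a \<Rightarrow> 'a) topology" where
  "pointwise_topology X = product_topology (\<lambda>_. discrete_topology X) X"

definition level :: "'a::field poly \<Rightarrow> 'a \<Rightarrow> nat \<Rightarrow> 'a set" where
  "level f t n = {x. (poly f ^^ n) x = t}"

definition levels_upto :: "'a::field poly \<Rightarrow> 'a \<Rightarrow> enat \<Rightarrow> 'a set" where
  "levels_upto f t l = (\<Union>n\<in>{n. enat n \<le> l}. level f t n)"

abbreviation tree :: "'a::field poly \<Rightarrow> 'a \<Rightarrow> 'a set" where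
  "tree f t \<equiv> levels_upto f t \<infinity>"

text \<open>When \<open>t\<close> is transcendental over the field of coefficients of \<open>f\<close>, the levels are
  pairwise disjoint, so elements of the field can serve as vertices.\<close>

definition tree_aut_group :: "'a::field poly \<Rightarrow> 'a \<Rightarrow> ('a \<Rightarrow> 'a) monoid" where
  "tree_aut_group f t = (BijGroup (tree f t))
     \<lparr>carrier := {g \<in> Bij (tree f t). g t = t \<and>
                   (\<forall>n. \<forall>\<alpha>\<in>level f t (Suc n). g (poly f \<alpha>) = poly f (g \<alpha>))}\<rparr>"

text \<open>For \<open>l = \<infinity>\<close> the levels do not form a single finite set to adjoin; the field is the
  increasing union of the fields at finite level.\<close>

definition preimage_field :: "'a::field set \<Rightarrow> 'a poly \<Rightarrow> 'a \<Rightarrow> enat \<Rightarrow> 'a set" where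
  "preimage_field F f t l =
     (case l of enat n \<Rightarrow> field_adjoin F (level f t n)
              | \<infinity> \<Rightarrow> (\<Union>n. field_adjoin F (level f t n)))"

definition const_field :: "'a::field set \<Rightarrow> 'a poly \<Rightarrow> 'a \<Rightarrow> enat \<Rightarrow> 'a set" where
  "const_field K f t l = {x \<in> preimage_field K f t l. algebraic_over K x}"

definition Arb :: "'a::field set \<Rightarrow> 'a poly \<Rightarrow> 'a \<Rightarrow> ('a \<Rightarrow> 'a) monoid" where
  "Arb K f t = (tree_aut_group f t)
     \<lparr>carrier := (\<lambda>\<sigma>. restrict \<sigma> (tree f t)) ` carrier (Gal UNIV (field_adjoin (sep_closure K) {t}))\<rparr>"

definition rho :: "'a::field poly \<Rightarrow> 'a \<Rightarrow> enat \<Rightarrow> ('a \<Rightarrow> 'a) \<Rightarrow> ('a \<Rightarrow> 'a)" where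
  "rho f t l g = restrict g (levels_upto f t l)"

definition rho_Arb :: "'a::field set \<Rightarrow> 'a poly \<Rightarrow> 'a \<Rightarrow> enat \<Rightarrow> ('a \<Rightarrow> 'a) monoid" where
  "rho_Arb K f t l = (BijGroup (levels_upto f t l))\<lparr>carrier := rho f t l ` carrier (Arb K f t)\<rparr>"

definition conj_upto ::
  "'a::field set \<Rightarrow> 'a poly \<Rightarrow> 'a \<Rightarrow> enat \<Rightarrow> ('a \<Rightarrow> 'a) \<Rightarrow> ('a \<Rightarrow> 'a) \<Rightarrow> bool" where
  "conj_upto K f t l g h \<longleftrightarrow>
     (let G = rho_Arb K f t l in
      \<exists>k\<in>carrier G. rho f t l h = k \<otimes>\<^bsub>G\<^esub> rho f t l g \<otimes>\<^bsub>G\<^esub> inv\<^bsub>G\<^esub> k)"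

text \<open>A place of \<open>M\<close> is represented by its valuation ring.\<close>

definition valuation_ring_of :: "'a::field set \<Rightarrow> 'a set \<Rightarrow> bool" where
  "valuation_ring_of M V \<longleftrightarrow> V \<subseteq> M \<and> 1 \<in> V \<and>
     (\<forall>x\<in>V. \<forall>y\<in>V. x - y \<in> V \<and> x * y \<in> V) \<and> (\<forall>x\<in>M. x \<in> V \<or> inverse x \<in> V)"

definition valuation_ideal :: "'a::field set \<Rightarrow> 'a set" where
  "valuation_ideal V = {x \<in> V. x = 0 \<or> inverse x \<notin> V}"

text \<open>The valuation ring of the place \<open>t = \<infinity>\<close> of the rational function field \<open>k(t)\<close>.\<close>

definition infinity_ring :: "'a::field set \<Rightarrow> 'a \<Rightarrow> 'a set" where
  "infinity_ring k t = {poly p t / poly q t | p q.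
     set (coeffs p) \<subseteq> k \<and> set (coeffs q) \<subseteq> k \<and> q \<noteq> 0 \<and> degree p \<le> degree q}"

definition inertia_group :: "'a::field set \<Rightarrow> 'a set \<Rightarrow> 'a set \<Rightarrow> ('a \<Rightarrow> 'a) set" where
  "inertia_group M E V =
     {\<sigma> \<in> carrier (Gal M E). \<sigma> ` V = V \<and> (\<forall>x\<in>V. \<sigma> x - x \<in> valuation_ideal V)}"

definition inertia_generator :: "'a::field set \<Rightarrow> 'a poly \<Rightarrow> 'a \<Rightarrow> ('a \<Rightarrow> 'a) \<Rightarrow> bool" where
  "inertia_generator K f t \<sigma> \<longleftrightarrow>
     (let E = field_adjoin (sep_closure K) {t};
          M = preimage_field (sep_closure K) f t \<infinity>
      in \<exists>V. valuation_ring_of M V \<and> V \<inter> E = infinity_ring (sep_closure K) t \<and>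
             \<sigma> \<in> inertia_group M E V \<and>
             subtopology (pointwise_topology M) (carrier (Gal M E)) closure_of generate (Gal M E) {\<sigma>}
               = inertia_group M E V)"

text \<open>The unit group of \<open>\<Prod>\<^sub>\<ell> \<int>\<^sub>\<ell>\<close>, the product being over the primes \<open>\<ell> \<noteq> p\<close>, as the unit group of the
  inverse limit of the rings \<open>\<int>/n\<int>\<close> over the positive integers \<open>n\<close> not divisible by \<open>p\<close>, where
  residue classes are represented by \<open>0, \<dots>, n - 1\<close>. For \<open>p = 0\<close> all positive \<open>n\<close> are allowed,
  because \<open>0 dvd n\<close> means \<open>n = 0\<close>.\<close>

definition profinite_units :: "nat \<Rightarrow> (nat \<Rightarrow> nat) set" where
  "profinite_units p = {a \<in> extensional {n. \<not> p dvd n}.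
     (\<forall>n. \<not> p dvd n \<longrightarrow> a n < n \<and> coprime (a n) n) \<and>
     (\<forall>m n. \<not> p dvd n \<and> m dvd n \<longrightarrow> a n mod m = a m)}"

definition cyclotomic_character :: "'a::field set \<Rightarrow> ('a \<Rightarrow> 'a) \<Rightarrow> nat \<Rightarrow> nat" where
  "cyclotomic_character K \<tau> = (THE a. a \<in> profinite_units CHAR('a) \<and>
     (\<forall>n. \<not> CHAR('a) dvd n \<longrightarrow> (\<forall>\<zeta>\<in>sep_closure K. \<zeta> ^ n = 1 \<longrightarrow> \<tau> \<zeta> = \<zeta> ^ a n)))"

text \<open>For \<open>a\<close> in the inverse limit above, \<open>k \<mapsto> a (d ^ k)\<close> is its image in
  \<open>\<int>\<^sub>d = lim \<int>/d\<^sup>k\<int>\<close>; read as a sequence of integers it converges to that image. The power of \<open>g\<close>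
  with this exponent is accordingly the limit of the powers \<open>g\<^sup>n\<close> with \<open>n = a (d ^ k)\<close>.\<close>

definition Arb_profinite_pow ::
  "'a::field set \<Rightarrow> 'a poly \<Rightarrow> 'a \<Rightarrow> ('a \<Rightarrow> 'a) \<Rightarrow> (nat \<Rightarrow> nat) \<Rightarrow> ('a \<Rightarrow> 'a)" where
  "Arb_profinite_pow K f t g a = (THE h.
     limitin (pointwise_topology (tree f t))
       (\<lambda>k. g [^]\<^bsub>Arb K f t\<^esub> a (degree f ^ k)) h sequentially)"

definition cyclotomic_field :: "'a::field set \<Rightarrow> nat \<Rightarrow> 'a set" where
  "cyclotomic_field K d = field_adjoin K {\<zeta>. \<exists>n. \<zeta> ^ (d ^ n) = 1}"

end

theory Submission
  imports Defs "HOL-Analysis.Abstract_Topological_Spaces"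
begin

text \<open>Fix a place of \<open>M = K\<^sup>s\<^sup>e\<^sup>p(f\<^sup>-\<^sup>\<infinity>(t))\<close> over \<open>\<infinity>\<close> with valuation ring \<open>V\<close>. On level \<open>n\<close> the ratio of two vertices
  is a unit of \<open>V\<close> whose residue is a root of unity of order dividing \<open>d\<^sup>n\<close>, and since \<open>d\<close> is prime to the
  characteristic these residues separate the vertices. Newton iteration along a branch \<open>x\<close> of the tree
  shows that \<open>\<Union>\<^sub>n K\<^sup>s\<^sup>e\<^sup>p(x\<^sub>n)\<close> is dense in \<open>M\<close>. Hence, for any two branches \<open>x\<close>, \<open>x'\<close>, each \<open>\<tau>\<close> in \<open>Gal(K\<^sup>s\<^sup>e\<^sup>p/K)\<close> extends
  to an automorphism of \<open>M\<close> that preserves \<open>V\<close> and maps \<open>x\<close> to \<open>x'\<close>. For \<open>\<tau> = id\<close> this gives transitivity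
  of inertia on every level; for general \<open>\<tau>\<close> and \<open>x' = x\<close> it gives an extension \<open>h\<close> of \<open>\<tau>\<close>
  with \<open>h \<sigma> h\<^sup>-\<^sup>1 = \<sigma>\<^sup>\<chi>\<^sup>(\<^sup>\<tau>\<^sup>)\<close> on the tree.

  If \<open>\<tau>\<close> fixes the constants of the field of level \<open>l\<close>, then \<open>h\<close> on this field can be glued with the
  identity of \<open>K\<^sup>s\<^sup>e\<^sup>p\<close>, and the result conjugates \<open>\<sigma>\<close> to \<open>\<sigma>\<^sup>\<chi>\<^sup>(\<^sup>\<tau>\<^sup>)\<close>. Conversely, if \<open>\<gamma>\<close> over \<open>K\<^sup>s\<^sup>e\<^sup>p(t)\<close> does so, then
  \<open>\<gamma>\<^sup>-\<^sup>1 h\<close> centralizes the full cycle \<open>\<sigma>\<close> of level \<open>n\<close>, so it is a power of \<open>\<sigma>\<close>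
  there, and \<open>h\<close> fixes the constants because \<open>\<gamma>\<close> and \<open>\<sigma>\<close> do.\<close>

section \<open>Subfields and polynomials over them\<close>

text \<open>Classically \<open>M\<close> is embedded into fields of Laurent series over
  \<open>k\<close> in the \<open>d ^ n\<close>-th roots of \<open>1/t\<close>, and the Galois group
  of \<open>k\<close> acts on coefficients. No completion is built here: congruences in
  \<open>V\<close> modulo powers of \<open>1/t\<close> take the place of series. Branches serve
  because a vertex \<open>y\<close> is transcendental over \<open>k\<close> and \<open>t\<close> is
  a polynomial in \<open>y\<close>. Hence \<open>k(y)\<close> is a rational function field on which
  \<open>V\<close> induces the place at infinity, membership in \<open>V\<close> compares degrees,
  and \<tau> can act on coefficients without changing anything that \<open>V\<close> sees. The
  Newton iterates are rational expressions in vertices of one branch, so they can be transported as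
  well. Limits are unique because 0 is the only element divisible in \<open>V\<close> by all powers
  of \<open>1/t\<close>.

  The groups in the theorem consist of automorphisms of the whole ambient field, so every map built
  on \<open>M\<close> or on the field of some levels has to be prolonged to it. This is done over
  \<open>K(t)\<close>, where each element is a root of a polynomial that splits with simple roots.
  The generator property of \<sigma> enters through density: on a finite level the powers of
  \<sigma> realise all that inertia does.\<close>

lemma subfield_0: "is_subfield F \<Longrightarrow> 0 \<in> F"
  and subfield_1: "is_subfield F \<Longrightarrow> 1 \<in> F"
  and subfield_diff: "is_subfield F \<Longrightarrow> x \<in> F \<Longrightarrow> y \<in> F \<Longrightarrow> x - y \<in> F"
  and subfield_mult: "is_subfield F \<Longrightarrow> x \<in> F \<Longrightarrow> y \<in> F \<Longrightarrow> x * y \<in> F"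
  and subfield_inverse: "is_subfield F \<Longrightarrow> x \<in> F \<Longrightarrow> inverse x \<in> F"
  by (auto simp: is_subfield_def)

lemma subfield_uminus: "is_subfield F \<Longrightarrow> x \<in> F \<Longrightarrow> - x \<in> F"
  using subfield_diff[of F 0 x] subfield_0[of F] by simp

lemma subfield_add: "is_subfield F \<Longrightarrow> x \<in> F \<Longrightarrow> y \<in> F \<Longrightarrow> x + y \<in> F"
  using subfield_diff[of F x "- y"] subfield_uminus[of F y] by simp

lemma subfield_divide: "is_subfield F \<Longrightarrow> x \<in> F \<Longrightarrow> y \<in> F \<Longrightarrow> x / y \<in> F"
  by (simp add: divide_inverse subfield_mult subfield_inverse)

lemma subfield_power: "is_subfield F \<Longrightarrow> x \<in> F \<Longrightarrow> x ^ n \<in> F"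
  by (induction n) (auto intro: subfield_1 subfield_mult)

lemma subfield_sum: "is_subfield F \<Longrightarrow> (\<And>i. i \<in> I \<Longrightarrow> h i \<in> F) \<Longrightarrow> sum h I \<in> F"
  by (induction I rule: infinite_finite_induct) (auto intro: subfield_0 subfield_add)

lemma subfield_of_nat: "is_subfield F \<Longrightarrow> of_nat n \<in> F"
  by (induction n) (auto intro: subfield_0 subfield_1 subfield_add)

lemmas subfield_closed = subfield_0 subfield_1 subfield_diff subfield_mult subfield_inverse
  subfield_uminus subfield_add subfield_divide subfield_power subfield_sum subfield_of_nat

lemma subfield_Inter: "(\<And>F. F \<in> \<F> \<Longrightarrow> is_subfield F) \<Longrightarrow> is_subfield (\<Inter>\<F>)"
  by (auto simp: is_subfield_def)

lemma subfield_field_adjoin: "is_subfield (field_adjoin F S)"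
  unfolding field_adjoin_def by (rule hull_in) (auto intro: subfield_Inter)

lemma field_adjoin_base: "F \<subseteq> field_adjoin F S"
  unfolding field_adjoin_def using hull_subset[of "F \<union> S"] by auto

lemma field_adjoin_gen: "S \<subseteq> field_adjoin F S"
  unfolding field_adjoin_def using hull_subset[of "F \<union> S"] by auto

lemma field_adjoin_minimal: "is_subfield E \<Longrightarrow> F \<subseteq> E \<Longrightarrow> S \<subseteq> E \<Longrightarrow> field_adjoin F S \<subseteq> E"
  unfolding field_adjoin_def by (rule hull_minimal) auto

text \<open>Stated for all coefficients, the vanishing ones included, so that closure properties are
  checked coefficientwise. For sets containing 0 it is the condition on \<open>coeffs\<close> from
  the definitions.\<close>

definition poly_over :: "'a::zero set \<Rightarrow> 'a poly \<Rightarrow> bool" where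
  "poly_over F p \<longleftrightarrow> (\<forall>i. coeff p i \<in> F)"

lemma poly_over_iff_coeffs: "0 \<in> F \<Longrightarrow> set (coeffs p) \<subseteq> F \<longleftrightarrow> poly_over F p"
  using range_coeff[of p] unfolding poly_over_def by (metis image_subset_iff insert_subset UNIV_I)

lemma poly_overD: "poly_over F p \<Longrightarrow> coeff p i \<in> F"
  by (simp add: poly_over_def)

lemma poly_over_mono: "poly_over F p \<Longrightarrow> F \<subseteq> E \<Longrightarrow> poly_over E p"
  by (auto simp: poly_over_def)

lemma poly_over_0: "is_subfield F \<Longrightarrow> poly_over F 0"
  and poly_over_1: "is_subfield F \<Longrightarrow> poly_over F 1"
  and poly_over_pCons: "a \<in> F \<Longrightarrow> poly_over F p \<Longrightarrow> poly_over F (pCons a p)"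
  and poly_over_add: "is_subfield F \<Longrightarrow> poly_over F p \<Longrightarrow> poly_over F q \<Longrightarrow> poly_over F (p + q)"
  and poly_over_diff: "is_subfield F \<Longrightarrow> poly_over F p \<Longrightarrow> poly_over F q \<Longrightarrow> poly_over F (p - q)"
  and poly_over_uminus: "is_subfield F \<Longrightarrow> poly_over F p \<Longrightarrow> poly_over F (- p)"
  and poly_over_mult: "is_subfield F \<Longrightarrow> poly_over F p \<Longrightarrow> poly_over F q \<Longrightarrow> poly_over F (p * q)"
  and poly_over_smult: "is_subfield F \<Longrightarrow> a \<in> F \<Longrightarrow> poly_over F p \<Longrightarrow> poly_over F (smult a p)"
  and poly_over_monom: "is_subfield F \<Longrightarrow> a \<in> F \<Longrightarrow> poly_over F (monom a n)"
  by (auto simp: poly_over_def coeff_mult coeff_pCons intro!: subfield_closed split: nat.splits)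

lemma poly_over_const: "is_subfield F \<Longrightarrow> a \<in> F \<Longrightarrow> poly_over F [:a:]"
  by (intro poly_over_pCons poly_over_0)

lemma poly_over_power: "is_subfield F \<Longrightarrow> poly_over F p \<Longrightarrow> poly_over F (p ^ n)"
  by (induction n) (auto intro: poly_over_1 poly_over_mult)

lemma poly_over_pderiv: "is_subfield F \<Longrightarrow> poly_over F p \<Longrightarrow> poly_over F (pderiv p)"
  by (auto simp: poly_over_def coeff_pderiv simp del: of_nat_Suc intro!: subfield_closed)

lemma poly_over_sum: "is_subfield F \<Longrightarrow> (\<And>i. i \<in> I \<Longrightarrow> poly_over F (h i)) \<Longrightarrow> poly_over F (sum h I)"
  by (induction I rule: infinite_finite_induct) (auto intro: poly_over_0 poly_over_add)

lemma poly_over_prod: "is_subfield F \<Longrightarrow> (\<And>i. i \<in> I \<Longrightarrow> poly_over F (h i)) \<Longrightarrow> poly_over F (prod h I)"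
  by (induction I rule: infinite_finite_induct) (auto intro: poly_over_1 poly_over_mult)

lemma poly_over_pCons_iff: "poly_over F (pCons a p) \<longleftrightarrow> a \<in> F \<and> poly_over F p"
  unfolding poly_over_def by (metis coeff_pCons_0 coeff_pCons_Suc old.nat.exhaust)

lemma poly_over_pcompose:
  assumes "is_subfield F" "poly_over F p" "poly_over F q"
  shows "poly_over F (pcompose p q)"
  using assms(2)
  by (induction p) (auto simp: pcompose_pCons poly_over_pCons_iff
      intro!: poly_over_add poly_over_mult poly_over_0 assms)

lemma poly_over_eval:
  assumes "is_subfield F" "poly_over F p" "x \<in> F"
  shows "poly p x \<in> F"
  using assms(2)
  by (induction p) (auto simp: poly_over_pCons_iff intro!: subfield_closed assms)

lemmas poly_over_closed = poly_over_0 poly_over_1 poly_over_add poly_over_diff poly_over_uminus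
  poly_over_mult poly_over_smult poly_over_const poly_over_power poly_over_pderiv
  poly_over_sum poly_over_prod poly_over_pcompose poly_over_monom

text \<open>Horner's scheme: dividing \<open>p\<close> and cancelling one leading term divides
  \<open>pCons a p\<close>. Every step stays inside \<open>F\<close>, so a homomorphism defined only
  on \<open>F\<close> can act on quotient and remainder.\<close>

lemma poly_over_division:
  fixes p g :: "'a::field poly"
  assumes F: "is_subfield F" and "poly_over F p" and g: "poly_over F g" "g \<noteq> 0"
  obtains q r where "poly_over F q" "poly_over F r" "p = g * q + r" "r = 0 \<or> degree r < degree g"
proof -
  have "\<exists>q r. poly_over F q \<and> poly_over F r \<and> p = g * q + r \<and> (r = 0 \<or> degree r < degree g)"
    using assms(2)
  proof (induction p)
    case 0
    show ?case by (intro exI[of _ 0]) (simp add: poly_over_0 F)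
  next
    case (pCons a p)
    then obtain q r where qr: "poly_over F q" "poly_over F r" "p = g * q + r" "r = 0 \<or> degree r < degree g"
      by (auto simp: poly_over_pCons_iff)
    have a: "a \<in> F" using pCons.prems by (simp add: poly_over_pCons_iff)
    define r1 where "r1 = pCons a r"
    have r1: "poly_over F r1" unfolding r1_def by (intro poly_over_pCons a qr)
    have eq: "pCons a p = g * pCons 0 q + r1"
      by (simp add: r1_def qr(3))
    show ?case
    proof (cases "r1 = 0 \<or> degree r1 < degree g")
      case True
      then show ?thesis using eq r1 qr(1) poly_over_pCons[of 0 F q] subfield_0[OF F] by metis
    next
      case False
      have deg: "degree r1 = degree g"
        using False qr(4) by (cases "r = 0") (auto simp: r1_def)
      define c where "c = lead_coeff r1 / lead_coeff g"
      have c: "c \<in> F" unfolding c_def using r1 g by (intro subfield_closed F poly_overD)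
      define r2 where "r2 = r1 - smult c g"
      have "poly_over F r2" unfolding r2_def by (intro poly_over_closed F r1 c g)
      moreover have "pCons a p = g * (pCons 0 q + [:c:]) + r2"
        unfolding eq r2_def by (simp add: algebra_simps)
      moreover have "poly_over F (pCons 0 q + [:c:])"
        by (intro poly_over_closed poly_over_pCons F c qr subfield_0)
      moreover have "r2 = 0 \<or> degree r2 < degree g"
      proof -
        have "coeff r2 (degree g) = 0" unfolding r2_def using g by (simp add: c_def deg)
        moreover have "degree r2 \<le> degree g" unfolding r2_def
          by (rule degree_diff_le) (use deg in \<open>auto intro: degree_smult_le\<close>)
        ultimately show ?thesis by (metis leading_coeff_0_iff order_le_less)
      qed
      ultimately show ?thesis by blast
    qed
  qed
  with that show thesis by blast
qed

section \<open>Algebraic elements\<close>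

text \<open>Gaussian elimination: a nonzero entry \<open>A j0 p\<close> removes the unknown
  \<open>p\<close> together with the equation \<open>j0\<close>. The solution stays in
  \<open>F\<close> and supplies the coefficients of a polynomial over \<open>F\<close> in both
  applications.\<close>

lemma nontrivial_solution:
  fixes A :: "'j \<Rightarrow> 'i \<Rightarrow> 'a::field"
  assumes F: "is_subfield F" and "finite J" "finite I" "card J < card I"
    and "\<And>j i. j \<in> J \<Longrightarrow> i \<in> I \<Longrightarrow> A j i \<in> F"
  shows "\<exists>c. (\<forall>i. c i \<in> F) \<and> (\<exists>i\<in>I. c i \<noteq> 0) \<and> (\<forall>j\<in>J. (\<Sum>i\<in>I. A j i * c i) = 0)"
  using assms(2-)
proof (induction J arbitrary: A I)
  case empty
  then obtain i where "i \<in> I" by fastforce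
  then show ?case by (intro exI[of _ "\<lambda>_. 1"]) (auto simp: F subfield_1)
next
  case (insert j0 J)
  show ?case
  proof (cases "\<forall>i\<in>I. A j0 i = 0")
    case True
    have "\<exists>c. (\<forall>i. c i \<in> F) \<and> (\<exists>i\<in>I. c i \<noteq> 0) \<and> (\<forall>j\<in>J. (\<Sum>i\<in>I. A j i * c i) = 0)"
      by (rule insert.IH) (use insert in auto)
    with True show ?thesis by auto
  next
    case False
    then obtain p where p: "p \<in> I" "A j0 p \<noteq> 0" by auto
    define B where "B = (\<lambda>j i. A j i - A j p * A j0 i / A j0 p)"
    have "\<exists>c. (\<forall>i. c i \<in> F) \<and> (\<exists>i\<in>I-{p}. c i \<noteq> 0) \<and> (\<forall>j\<in>J. (\<Sum>i\<in>I-{p}. B j i * c i) = 0)"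
      by (rule insert.IH) (use insert p in \<open>auto simp: B_def intro!: subfield_closed F\<close>)
    then obtain c where c: "\<And>i. c i \<in> F" "\<exists>i\<in>I-{p}. c i \<noteq> 0"
      "\<And>j. j \<in> J \<Longrightarrow> (\<Sum>i\<in>I-{p}. B j i * c i) = 0" by blast
    define s where "s = (\<Sum>i\<in>I-{p}. A j0 i * c i)"
    define c' where "c' = c(p := - s / A j0 p)"
    have split: "(\<Sum>i\<in>I. A j i * c' i) = - A j p * s / A j0 p + (\<Sum>i\<in>I-{p}. A j i * c i)" for j
      using insert.prems(1) p by (subst sum.remove[of _ p]) (auto simp: c'_def intro!: sum.cong)
    have "s \<in> F" unfolding s_def using insert.prems c by (intro subfield_closed F) auto
    then have "\<forall>i. c' i \<in> F" using c(1) insert.prems p by (auto simp: c'_def intro!: subfield_closed F)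
    moreover have "\<exists>i\<in>I. c' i \<noteq> 0" using c(2) by (auto simp: c'_def)
    moreover have "(\<Sum>i\<in>I. A j0 i * c' i) = 0"
      unfolding split using p by (simp add: s_def)
    moreover have "(\<Sum>i\<in>I. A j i * c' i) = 0" if j: "j \<in> J" for j
    proof -
      have "0 = (\<Sum>i\<in>I-{p}. A j i * c i - A j p / A j0 p * (A j0 i * c i))"
        using c(3)[OF j] unfolding B_def by (simp add: algebra_simps)
      also have "\<dots> = (\<Sum>i\<in>I-{p}. A j i * c i) - A j p / A j0 p * s"
        by (simp add: s_def sum_subtractf sum_distrib_left)
      finally show ?thesis unfolding split by simp
    qed
    ultimately show ?thesis by blast
  qed
qed

section \<open>Finite-dimensional modules and algebraic elements\<close>

definition span_over :: "'a::field set \<Rightarrow> 'a set \<Rightarrow> 'a set" where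
  "span_over F B = {\<Sum>b\<in>B. c b * b | c. \<forall>b. c b \<in> F}"

lemma span_over_add:
  assumes "is_subfield F" "x \<in> span_over F B" "y \<in> span_over F B"
  shows "x + y \<in> span_over F B"
proof -
  from assms(2,3) obtain c c' where c: "x = (\<Sum>b\<in>B. c b * b)" "\<forall>b. c b \<in> F"
    "y = (\<Sum>b\<in>B. c' b * b)" "\<forall>b. c' b \<in> F"
    unfolding span_over_def by blast
  then have "x + y = (\<Sum>b\<in>B. (c b + c' b) * b)" by (simp add: sum.distrib distrib_right)
  then show ?thesis unfolding span_over_def using c assms(1)
    by (auto intro!: exI[of _ "\<lambda>b. c b + c' b"] subfield_add)
qed

lemma span_over_0: "is_subfield F \<Longrightarrow> 0 \<in> span_over F B"
  unfolding span_over_def by (auto intro!: exI[of _ "\<lambda>_. 0"] subfield_0)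

lemma span_over_sum:
  "is_subfield F \<Longrightarrow> (\<And>i. i \<in> I \<Longrightarrow> h i \<in> span_over F B) \<Longrightarrow> sum h I \<in> span_over F B"
  by (induction I rule: infinite_finite_induct) (auto intro: span_over_0 span_over_add)

lemma span_over_base:
  assumes "is_subfield F" "finite B" "b \<in> B" "a \<in> F"
  shows "a * b \<in> span_over F B"
proof -
  have "a * b = (\<Sum>x\<in>B. (if x = b then a else 0) * x)"
    using assms(2,3) by (simp add: if_distrib[of "\<lambda>u. u * _"] sum.delta cong: if_cong)
  then show ?thesis unfolding span_over_def
    using assms by (auto intro!: exI[of _ "\<lambda>x. if x = b then a else 0"] subfield_0)
qed

text \<open>\<open>S\<close> plays the role of the finite-dimensional algebra \<open>F[C]\<close>.
  Only an additive group inside a finite span is recorded, a form that is easy to maintain when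
  elements are adjoined to \<open>C\<close> one by one.\<close>

definition fd_stable :: "'a::field set \<Rightarrow> 'a set \<Rightarrow> 'a set \<Rightarrow> bool" where
  "fd_stable F C S \<longleftrightarrow> 1 \<in> S \<and> (\<forall>x\<in>S. \<forall>y\<in>S. x - y \<in> S) \<and> (\<forall>c\<in>C. \<forall>x\<in>S. c * x \<in> S) \<and>
     (\<exists>B. finite B \<and> S \<subseteq> span_over F B)"

lemma algebraic_over_def': "is_subfield F \<Longrightarrow>
    algebraic_over F x \<longleftrightarrow> (\<exists>p. p \<noteq> 0 \<and> poly_over F p \<and> poly p x = 0)"
  by (simp add: algebraic_over_def poly_over_iff_coeffs subfield_0)

text \<open>All powers of \<open>z\<close> lie in \<open>S\<close>, hence in the span of
  \<open>B\<close>. The \<open>card B + 1\<close> powers up to exponent \<open>card B\<close>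
  satisfy a linear relation, which is an annihilating polynomial.\<close>

lemma fd_stable_algebraic:
  assumes F: "is_subfield F" and S: "fd_stable F {z} S"
  shows "algebraic_over F z"
proof -
  obtain B where B: "finite B" "S \<subseteq> span_over F B" using S by (auto simp: fd_stable_def)
  have "z ^ i \<in> S" for i by (induction i) (use S in \<open>auto simp: fd_stable_def\<close>)
  then have "\<forall>i. \<exists>c. z ^ i = (\<Sum>b\<in>B. c b * b) \<and> (\<forall>b. c b \<in> F)"
    using B(2) unfolding span_over_def by blast
  then obtain c where c: "\<And>i. z ^ i = (\<Sum>b\<in>B. c i b * b)" "\<And>i b. c i b \<in> F" by metis
  obtain e where e: "\<And>i. e i \<in> F" "\<exists>i\<in>{..card B}. e i \<noteq> 0"
      "\<And>b. b \<in> B \<Longrightarrow> (\<Sum>i\<le>card B. c i b * e i) = 0"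
    using nontrivial_solution[OF F B(1), of "{..card B}" "\<lambda>b i. c i b"] c(2)
    by (simp del: atMost_iff) blast
  define p where "p = (\<Sum>i\<le>card B. monom (e i) i)"
  have cp: "coeff p i = (if i \<le> card B then e i else 0)" for i
    unfolding p_def by (simp add: coeff_sum)
  have "p \<noteq> 0" using e(2) cp by (metis atMost_iff coeff_0)
  moreover have "poly_over F p" unfolding poly_over_def cp using e(1) F by (auto simp: subfield_0)
  moreover have "poly p z = 0"
  proof -
    have "poly p z = (\<Sum>i\<le>card B. e i * z ^ i)" by (simp add: p_def poly_sum poly_monom)
    also have "\<dots> = (\<Sum>i\<le>card B. \<Sum>b\<in>B. b * (c i b * e i))"
      by (simp add: c(1) sum_distrib_left mult_ac)
    also have "\<dots> = (\<Sum>b\<in>B. b * (\<Sum>i\<le>card B. c i b * e i))"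
      by (subst sum.swap) (simp add: sum_distrib_left)
    also have "\<dots> = 0" using e(3) by simp
    finally show ?thesis .
  qed
  ultimately show ?thesis using algebraic_over_def'[OF F] by blast
qed

text \<open>\<open>S'\<close> consists of the polynomials in \<open>z\<close> of degree below
  \<open>degree p\<close> with coefficients in \<open>S\<close>. The monic relation rewrites
  \<open>z ^ n\<close> with coefficients from \<open>C\<close>, and \<open>S\<close> is stable under
  these.\<close>

lemma fd_stable_insert:
  assumes F: "is_subfield F" and S: "fd_stable F C S"
    and p: "lead_coeff p = 1" "poly p z = 0" "\<And>i. i < degree p \<Longrightarrow> coeff p i \<in> C"
  shows "\<exists>S'. fd_stable F (insert z C) S'"
proof -
  define n where "n = degree p"
  define S' where "S' = {\<Sum>i<n. s i * z ^ i | s. \<forall>i. s i \<in> S}"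
  have n: "n > 0" using p(1,2) unfolding n_def
    by (metis degree_eq_zeroE gr0I lead_coeff_pCons(2) pCons_0_0 poly_const_conv zero_neq_one coeff_pCons_0)
  obtain B where B: "finite B" "S \<subseteq> span_over F B" using S by (auto simp: fd_stable_def)
  have S1: "1 \<in> S" and Sd: "\<And>x y. x \<in> S \<Longrightarrow> y \<in> S \<Longrightarrow> x - y \<in> S"
    and Sc: "\<And>c x. c \<in> C \<Longrightarrow> x \<in> S \<Longrightarrow> c * x \<in> S" using S by (auto simp: fd_stable_def)
  have S0: "0 \<in> S" using Sd[OF S1 S1] by simp
  have zn: "z ^ n = - (\<Sum>i<n. coeff p i * z ^ i)"
  proof -
    have "0 = (\<Sum>i\<le>n. coeff p i * z ^ i)" using p(2) by (simp add: poly_altdef n_def)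
    also have "\<dots> = (\<Sum>i<n. coeff p i * z ^ i) + z ^ n"
      using p(1) by (simp add: n_def flip: lessThan_Suc_atMost)
    finally show ?thesis by (simp add: eq_neg_iff_add_eq_0 add.commute)
  qed
  have "1 \<in> S'"
  proof -
    have "1 = (\<Sum>i<n. (if i = 0 then 1 else 0) * z ^ i)"
      using n by (subst sum.remove[of _ 0]) auto
    then show ?thesis unfolding S'_def using S0 S1
      by (intro CollectI exI[of _ "\<lambda>i. if i = 0 then 1 else 0"]) auto
  qed
  moreover have "x - y \<in> S'" if "x \<in> S'" "y \<in> S'" for x y
  proof -
    from that obtain s s' where s: "x = (\<Sum>i<n. s i * z ^ i)" "\<forall>i. s i \<in> S"
       "y = (\<Sum>i<n. s' i * z ^ i)" "\<forall>i. s' i \<in> S" unfolding S'_def by blast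
    then have "x - y = (\<Sum>i<n. (s i - s' i) * z ^ i)" by (simp add: sum_subtractf left_diff_distrib)
    then show ?thesis unfolding S'_def using s Sd by (intro CollectI exI[of _ "\<lambda>i. s i - s' i"]) auto
  qed
  moreover have "c * x \<in> S'" if "c \<in> C" "x \<in> S'" for c x
  proof -
    from that obtain s where s: "x = (\<Sum>i<n. s i * z ^ i)" "\<forall>i. s i \<in> S" unfolding S'_def by blast
    then have "c * x = (\<Sum>i<n. (c * s i) * z ^ i)" by (simp add: sum_distrib_left mult_ac)
    then show ?thesis unfolding S'_def using s Sc that by (intro CollectI exI[of _ "\<lambda>i. c * s i"]) auto
  qed
  moreover have "z * x \<in> S'" if "x \<in> S'" for x
  proof -
    from that obtain s where s: "x = (\<Sum>i<n. s i * z ^ i)" "\<forall>i. s i \<in> S" unfolding S'_def by blast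
    \<comment> \<open>Multiplication by \<open>z\<close> shifts the coefficients by one; the
      overflow \<open>s (n - 1) * z ^ n\<close> is folded back by the relation for
      \<open>z ^ n\<close>.\<close>
    define s' where "s' = (\<lambda>i. (if i = 0 then 0 else s (i - 1)) - (if i < n then coeff p i else 0) * s (n - 1))"
    have s': "s' i \<in> S" for i
      unfolding s'_def using s(2) S0 Sd Sc p(3) by (cases "i < n") (auto simp: n_def)
    have "z * x = (\<Sum>i<n. s i * z ^ Suc i)" by (simp add: s sum_distrib_left mult_ac)
    also have "\<dots> = (\<Sum>i<n - 1. s i * z ^ Suc i) + s (n - 1) * z ^ n"
      using n by (cases n) auto
    also have "(\<Sum>i<n - 1. s i * z ^ Suc i) = (\<Sum>i<n. (if i = 0 then 0 else s (i - 1)) * z ^ i)"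
      using n by (cases n) (auto simp: sum.lessThan_Suc_shift simp del: sum.lessThan_Suc power_Suc)
    also have "s (n - 1) * z ^ n = - (\<Sum>i<n. (if i < n then coeff p i else 0) * s (n - 1) * z ^ i)"
      by (simp add: zn sum_distrib_left mult_ac)
    finally have "z * x = (\<Sum>i<n. s' i * z ^ i)"
      by (simp add: s'_def sum_subtractf left_diff_distrib)
    then show ?thesis unfolding S'_def using s' by blast
  qed
  moreover have "S' \<subseteq> span_over F ((\<lambda>(b,i). b * z ^ i) ` (B \<times> {..<n}))"
  proof
    fix x assume "x \<in> S'"
    then obtain s where s: "x = (\<Sum>i<n. s i * z ^ i)" "\<forall>i. s i \<in> S" unfolding S'_def by blast
    have "s i * z ^ i \<in> span_over F ((\<lambda>(b,i). b * z ^ i) ` (B \<times> {..<n}))" if i: "i < n" for i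
    proof -
      obtain c where c: "s i = (\<Sum>b\<in>B. c b * b)" "\<forall>b. c b \<in> F"
        using s(2) B(2) unfolding span_over_def by blast
      have "s i * z ^ i = (\<Sum>b\<in>B. c b * (b * z ^ i))" by (simp add: c sum_distrib_right mult.assoc)
      also have "\<dots> \<in> span_over F ((\<lambda>(b,i). b * z ^ i) ` (B \<times> {..<n}))"
        using c(2) i B by (intro span_over_sum span_over_base F) auto
      finally show ?thesis .
    qed
    then show "x \<in> span_over F ((\<lambda>(b,i). b * z ^ i) ` (B \<times> {..<n}))"
      unfolding s using F by (intro span_over_sum) auto
  qed
  then have "\<exists>B'. finite B' \<and> S' \<subseteq> span_over F B'"
    using B(1) by (metis finite_SigmaI finite_imageI finite_lessThan)
  ultimately have "fd_stable F (insert z C) S'" unfolding fd_stable_def by auto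
  then show ?thesis ..
qed

lemma algebraic_over_monic:
  assumes F: "is_subfield F" and "algebraic_over F x"
  obtains p where "lead_coeff p = 1" "poly_over F p" "poly p x = 0"
proof -
  obtain q where q: "q \<noteq> 0" "poly_over F q" "poly q x = 0"
    using assms algebraic_over_def'[OF F] by blast
  show thesis
    by (rule that[of "smult (inverse (lead_coeff q)) q"])
       (use q in \<open>auto intro!: poly_over_closed subfield_closed F poly_overD\<close>)
qed

lemma fd_stable_finite:
  assumes F: "is_subfield F" and "finite C" "\<And>c. c \<in> C \<Longrightarrow> algebraic_over F c"
  shows "\<exists>S. fd_stable F (C \<union> F) S"
  using assms(2-)
proof (induction C)
  case empty
  have "F \<subseteq> span_over F {1}" using span_over_base[OF F, of "{1}" 1] by auto
  then have "fd_stable F F F" unfolding fd_stable_def using F by (auto intro: subfield_closed)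
  then show ?case by auto
next
  case (insert z C)
  then obtain S where S: "fd_stable F (C \<union> F) S" by auto
  obtain p where p: "lead_coeff p = 1" "poly_over F p" "poly p z = 0"
    using algebraic_over_monic[OF F, of z] insert.prems by auto
  have "\<exists>S'. fd_stable F (insert z (C \<union> F)) S'"
    by (rule fd_stable_insert[OF F S p(1,3)]) (use p(2) in \<open>auto dest: poly_overD\<close>)
  then show ?case by simp
qed

lemma fd_stable_subset: "fd_stable F C S \<Longrightarrow> C' \<subseteq> C \<Longrightarrow> fd_stable F C' S"
  unfolding fd_stable_def by blast

lemma algebraic_over_base:
  assumes F: "is_subfield F" and "x \<in> F" shows "algebraic_over F x"
  unfolding algebraic_over_def'[OF F]
  by (intro exI[of _ "[:- x, 1:]"])
     (use assms in \<open>auto intro!: poly_over_pCons poly_over_closed subfield_closed\<close>)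

lemma subfield_algebraic:
  assumes F: "is_subfield F"
  shows "is_subfield {x. algebraic_over F x}"
proof -
  have "algebraic_over F (x - y)" "algebraic_over F (x * y)"
    if xy: "algebraic_over F x" "algebraic_over F y" for x y
  proof -
    obtain S where S: "fd_stable F ({x, y} \<union> F) S" using fd_stable_finite[OF F, of "{x,y}"] xy by auto
    then have "fd_stable F {x - y} S" "fd_stable F {x * y} S"
      by (auto simp: fd_stable_def left_diff_distrib mult.assoc)
    then show "algebraic_over F (x - y)" "algebraic_over F (x * y)"
      using fd_stable_algebraic[OF F] by auto
  qed
  moreover have "algebraic_over F (inverse x)" if x: "algebraic_over F x" for x
  proof (cases "x = 0")
    case False
    obtain p where p: "p \<noteq> 0" "poly_over F p" "poly p x = 0"
      using x algebraic_over_def'[OF F] by blast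
    have "poly (reflect_poly p) (inverse x) = 0"
      using p False by (simp add: poly_reflect_poly_nz)
    moreover have "poly_over F (reflect_poly p)"
      using p(2) subfield_0[OF F] by (auto simp: poly_over_def coeff_reflect_poly)
    ultimately show ?thesis using p(1) algebraic_over_def'[OF F] by (metis reflect_poly_eq_0_iff)
  qed (use x in simp)
  ultimately show ?thesis unfolding is_subfield_def[of "{x. algebraic_over F x}"]
    using algebraic_over_base[OF F] subfield_0[OF F] subfield_1[OF F] by simp
qed

lemma algebraic_over_trans:
  assumes F: "is_subfield F" and z: "algebraic_over {x. algebraic_over F x} z"
  shows "algebraic_over F z"
proof -
  obtain p where p: "lead_coeff p = 1" "poly_over {x. algebraic_over F x} p" "poly p z = 0"
    using algebraic_over_monic[OF subfield_algebraic[OF F] z] .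
  obtain S where S: "fd_stable F (coeff p ` {..degree p} \<union> F) S"
    using fd_stable_finite[OF F, of "coeff p ` {..degree p}"] poly_overD[OF p(2)] by auto
  then obtain S' where "fd_stable F (insert z (coeff p ` {..degree p} \<union> F)) S'"
    using fd_stable_insert[OF F S p(1,3)] by auto
  then have "fd_stable F {z} S'" by (rule fd_stable_subset) auto
  then show ?thesis using fd_stable_algebraic[OF F] by auto
qed

lemma algebraic_over_mono: "algebraic_over F x \<Longrightarrow> F \<subseteq> E \<Longrightarrow> algebraic_over E x"
  unfolding algebraic_over_def by blast

text \<open>Least degree and division with remainder. The quotient is also asserted to lie over
  \<open>F\<close>, because the divisibility will be transported along homomorphisms defined on
  \<open>F\<close>.\<close>

lemma annihilator_generator:
  assumes F: "is_subfield F" and "algebraic_over F x"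
  obtains p where "p \<noteq> 0" "poly_over F p" "poly p x = 0"
    "\<And>r. poly_over F r \<Longrightarrow> poly r x = 0 \<Longrightarrow> \<exists>s. poly_over F s \<and> r = p * s"
proof -
  define Q where "Q = (\<lambda>p. p \<noteq> 0 \<and> poly_over F p \<and> poly p x = 0)"
  obtain p0 where "Q p0" using assms algebraic_over_def'[OF F] Q_def by blast
  then obtain p where p: "Q p" "\<And>q. Q q \<Longrightarrow> degree p \<le> degree q"
    using ex_has_least_nat[of Q p0 degree] by blast
  show thesis
  proof (rule that[of p])
    fix r assume r: "poly_over F r" "poly r x = 0"
    obtain q s where qs: "poly_over F q" "poly_over F s" "r = p * q + s" "s = 0 \<or> degree s < degree p"
      using poly_over_division[OF F r(1), of p] p(1) unfolding Q_def by blast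
    have "poly s x = 0" using qs(3) r(2) p(1) by (simp add: Q_def)
    then have "s = 0" using p(2)[of s] qs(2,4) unfolding Q_def by fastforce
    then show "\<exists>s. poly_over F s \<and> r = p * s" using qs by auto
  qed (use p(1) Q_def in auto)
qed

text \<open>For nonzero \<open>u\<close> the constant coefficient of a generator of the annihilator
  cannot vanish, so the relation can be solved for the inverse. Hence \<open>F[u]\<close> is already
  a field.\<close>

lemma inverse_poly:
  assumes F: "is_subfield F" and "algebraic_over F u"
  shows "\<exists>q. poly_over F q \<and> inverse u = poly q u"
proof (cases "u = 0")
  case True
  then show ?thesis using F by (intro exI[of _ 0]) (simp add: poly_over_0)
next
  case False
  obtain p where p: "p \<noteq> 0" "poly_over F p" "poly p u = 0"
    "\<And>r. poly_over F r \<Longrightarrow> poly r u = 0 \<Longrightarrow> \<exists>s. poly_over F s \<and> r = p * s"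
    using annihilator_generator[OF assms] by blast
  obtain a q where aq: "p = pCons a q" by (cases p)
  have q: "a \<in> F" "poly_over F q" using p(2) aq by (auto simp: poly_over_pCons_iff)
  have eq: "a + u * poly q u = 0" using p(3) aq by simp
  have "a \<noteq> 0"
  proof
    assume a: "a = 0"
    then have "poly q u = 0" using eq False by simp
    then obtain s where s: "q = p * s" using p(4)[OF q(2)] by auto
    then have "s \<noteq> 0" "q \<noteq> 0" using p(1) aq a by auto
    then have "degree p \<le> degree q" using s p(1) by (simp add: degree_mult_eq)
    then show False using aq \<open>q \<noteq> 0\<close> by simp
  qed
  then have "inverse u = poly (smult (- inverse a) q) u"
    using eq False by (simp add: field_simps) (simp add: add_eq_0_iff)
  then show ?thesis using q
    by (intro exI[of _ "smult (- inverse a) q"] conjI poly_over_closed subfield_closed F)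
qed

section \<open>Split polynomials\<close>

text \<open>For finite \<open>S\<close> all roots are simple, as the product runs over a set. Being
  a \<open>root_poly\<close> therefore records splitting and separability at once.\<close>

definition root_poly :: "'a::field set \<Rightarrow> 'a poly" where
  "root_poly S = (\<Prod>r\<in>S. [:- r, 1:])"

lemma root_poly_insert: "finite S \<Longrightarrow> r \<notin> S \<Longrightarrow> root_poly (insert r S) = [:- r, 1:] * root_poly S"
  by (simp add: root_poly_def)

lemma poly_root_poly: "poly (root_poly S) x = (\<Prod>r\<in>S. x - r)"
  by (simp add: root_poly_def poly_prod)

lemma root_poly_eq_0_iff: "finite S \<Longrightarrow> poly (root_poly S) x = 0 \<longleftrightarrow> x \<in> S"
  by (auto simp: poly_root_poly)

lemma root_poly_nonzero: "root_poly S \<noteq> 0"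
  by (cases "finite S") (auto simp: root_poly_def)

lemma degree_root_poly: "degree (root_poly S) = card S"
proof (cases "finite S")
  case True
  then show ?thesis
    by (induction S) (auto simp: root_poly_insert degree_mult_eq root_poly_nonzero simp del: mult_pCons_left, simp add: root_poly_def)
qed (simp add: root_poly_def)

lemma lead_coeff_root_poly: "lead_coeff (root_poly S) = 1"
  unfolding root_poly_def by (simp add: lead_coeff_prod)

lemma poly_over_root_poly: "is_subfield F \<Longrightarrow> S \<subseteq> F \<Longrightarrow> poly_over F (root_poly S)"
  unfolding root_poly_def
  by (intro poly_over_closed poly_over_pCons subfield_closed) auto

lemma pderiv_root_poly:
  assumes "finite S" "y \<in> S"
  shows "poly (pderiv (root_poly S)) y = (\<Prod>r\<in>S-{y}. y - r)"
proof -
  have "root_poly S = [:- y, 1:] * root_poly (S - {y})"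
    using root_poly_insert[of "S - {y}" y] assms by (simp add: insert_absorb)
  then have "poly (pderiv (root_poly S)) y = poly (root_poly (S - {y})) y"
    by (simp only: pderiv_mult) (simp add: pderiv_pCons)
  then show ?thesis by (simp add: poly_root_poly)
qed

lemma dvd_root_poly:
  assumes "finite S" "p * q = root_poly S"
  shows "\<exists>S'\<subseteq>S. p = smult (lead_coeff p) (root_poly S')"
  using assms
proof (induction S arbitrary: p q)
  case empty
  then have "p * q = 1" by (simp add: root_poly_def)
  then have "p dvd 1" by (metis dvd_triv_left)
  then obtain c where "p = [:c:]" by (auto simp: is_unit_poly_iff)
  then show ?case by (intro exI[of _ "{}"]) (simp add: root_poly_def)
next
  case (insert r S)
  have eq: "p * q = [:- r, 1:] * root_poly S" using insert by (simp add: root_poly_insert)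
  have "poly (p * q) r = 0" unfolding eq by simp
  then consider "poly p r = 0" | "poly q r = 0" by auto
  then show ?case
  proof cases
    case 1
    then obtain p1 where p1: "p = [:- r, 1:] * p1" by (meson dvdE poly_eq_0_iff_dvd)
    then have "[:- r, 1:] * (p1 * q) = [:- r, 1:] * root_poly S" using eq by (simp only: mult.assoc)
    then have "p1 * q = root_poly S" by (simp only: mult_cancel_left) auto
    then obtain S' where S': "S' \<subseteq> S" "p1 = smult (lead_coeff p1) (root_poly S')" using insert.IH by blast
    have "lead_coeff p = lead_coeff p1" unfolding p1 lead_coeff_mult by simp
    moreover have "p = smult (lead_coeff p1) ([:- r, 1:] * root_poly S')"
      using S'(2) p1 by (metis mult_smult_right)
    moreover have "root_poly (insert r S') = [:- r, 1:] * root_poly S'"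
      using S' insert.hyps by (intro root_poly_insert) (auto intro: finite_subset)
    ultimately show ?thesis using S'(1) by (intro exI[of _ "insert r S'"]) auto
  next
    case 2
    then obtain q1 where q1: "q = [:- r, 1:] * q1" by (meson dvdE poly_eq_0_iff_dvd)
    then have "[:- r, 1:] * (p * q1) = [:- r, 1:] * root_poly S" using eq by (simp only: mult.left_commute)
    then have "p * q1 = root_poly S" by (simp only: mult_cancel_left) auto
    then show ?thesis using insert.IH[of p q1] by blast
  qed
qed

text \<open>The closure hypothesis gives one root at a time. Removing its linear factor leaves a
  separable quotient, and the removed root does not recur there, since it would be a double root of
  \<open>q\<close>.\<close>

lemma separable_poly_split:
  assumes cl: "\<And>p :: 'a::field poly. degree p > 0 \<Longrightarrow> separable_poly p \<Longrightarrow> \<exists>x. poly p x = 0"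
    and "separable_poly (q :: 'a poly)"
  shows "\<exists>S. finite S \<and> q = smult (lead_coeff q) (root_poly S)"
  using assms(2)
proof (induction "degree q" arbitrary: q)
  case 0
  then obtain c where "q = [:c:]" by (metis degree_eq_zeroE)
  then show ?case by (intro exI[of _ "{}"]) (simp add: root_poly_def)
next
  case (Suc n)
  obtain x where x: "poly q x = 0" using cl[of q] Suc by auto
  then obtain q1 where q1: "q = [:- x, 1:] * q1" by (meson dvdE poly_eq_0_iff_dvd)
  have d: "pderiv q = [:- x, 1:] * pderiv q1 + q1" unfolding q1 pderiv_mult by (simp add: pderiv_pCons)
  have sep: "coprime q (pderiv q)" using Suc.prems by (simp add: separable_poly_def)
  have "q1 \<noteq> 0" using Suc.hyps(2) q1 by auto
  then have "n = degree q1" using Suc.hyps(2) unfolding q1 by (subst (asm) degree_mult_eq) auto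
  moreover have "separable_poly q1"
    unfolding separable_poly_def
  proof (rule coprimeI)
    fix h assume "h dvd q1" "h dvd pderiv q1"
    then have "h dvd q" "h dvd pderiv q" unfolding d by (auto simp: q1 simp del: mult_pCons_left)
    then show "is_unit h" using sep by (meson not_coprimeI)
  qed
  ultimately obtain S where S: "finite S" "q1 = smult (lead_coeff q1) (root_poly S)" using Suc.hyps(1) by blast
  have "x \<notin> S"
  proof
    assume "x \<in> S"
    then have "poly q1 x = 0" using S by (metis poly_smult root_poly_eq_0_iff mult_zero_right)
    then have "[:- x, 1:] dvd q1" by (simp add: poly_eq_0_iff_dvd)
    then have "[:- x, 1:] dvd q" "[:- x, 1:] dvd pderiv q" unfolding d by (auto simp: q1 simp del: mult_pCons_left)
    then have "is_unit [:- x, 1:]" using sep by (meson not_coprimeI)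
    then show False by (simp add: is_unit_poly_iff)
  qed
  moreover have "lead_coeff q = lead_coeff q1" unfolding q1 lead_coeff_mult by simp
  ultimately have "q = smult (lead_coeff q) (root_poly (insert x S))"
    using S q1 by (metis root_poly_insert mult_smult_right)
  then show ?case using S(1) by blast
qed

text \<open>Normality and separability in one condition: \<open>x\<close> is separable over
  \<open>F\<close>, and \<open>S\<close> contains all its conjugates.\<close>

definition splits_over :: "'a::field set \<Rightarrow> 'a \<Rightarrow> bool" where
  "splits_over F x \<longleftrightarrow> (\<exists>S. finite S \<and> x \<in> S \<and> poly_over F (root_poly S))"

lemma splits_over_separable:
  assumes F: "is_subfield F"
    and cl: "\<And>p :: 'a::field poly. degree p > 0 \<Longrightarrow> separable_poly p \<Longrightarrow> \<exists>x. poly p x = 0"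
    and q: "separable_poly (q :: 'a poly)" "poly_over F q" "poly q x = 0"
  shows "splits_over F x"
proof -
  obtain S where S: "finite S" "q = smult (lead_coeff q) (root_poly S)"
    using separable_poly_split[OF cl q(1)] by blast
  have "q \<noteq> 0" using q(1) by (auto simp: separable_poly_def)
  then have lq: "lead_coeff q \<noteq> 0" by simp
  then have "root_poly S = smult (inverse (lead_coeff q)) q" using S(2)
    by (metis left_inverse smult_1_left smult_smult)
  then have "poly_over F (root_poly S)" using q(2)
    by (auto intro!: poly_over_closed subfield_closed F poly_overD)
  moreover have "x \<in> S" using S q(3) lq by (metis mult_eq_0_iff poly_smult root_poly_eq_0_iff)
  ultimately show ?thesis using S(1) splits_over_def by blast
qed

lemma splits_over_algebraic:
  assumes F: "is_subfield F" and "splits_over F x"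
  shows "algebraic_over F x"
  using assms(2) root_poly_eq_0_iff root_poly_nonzero
  unfolding splits_over_def algebraic_over_def'[OF F] by blast

text \<open>Newton interpolation, one node at a time: the quotient of
  \<open>r - [:poly r s:]\<close> by the linear factor at \<open>s\<close> has values in
  \<open>k\<close> at the remaining nodes. The gluing argument uses it to recognise polynomials with
  constant coefficients.\<close>

lemma poly_over_interpolation:
  assumes k: "is_subfield k" and "finite S" "S \<subseteq> k" "r = 0 \<or> degree r < card S"
    "\<And>s. s \<in> S \<Longrightarrow> poly r s \<in> k"
  shows "poly_over k r"
  using assms(2-)
proof (induction S arbitrary: r)
  case empty
  then show ?case by (simp add: poly_over_0 k)
next
  case (insert s S)
  have "poly (r - [:poly r s:]) s = 0" by simp
  then obtain q where q: "r - [:poly r s:] = [:- s, 1:] * q" by (meson dvdE poly_eq_0_iff_dvd)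
  have r: "r = [:poly r s:] + [:- s, 1:] * q" using q by (metis add.commute diff_add_cancel)
  have "q = 0 \<or> degree q < card S"
  proof (rule disjCI)
    assume "\<not> degree q < card S"
    then have "card S \<le> degree q" by simp
    show "q = 0"
    proof (rule ccontr)
      assume "q \<noteq> 0"
      then have "degree ([:- s, 1:] * q) = Suc (degree q)" by (subst degree_mult_eq) auto
      then have "degree (r - [:poly r s:]) = Suc (degree q)" using q by simp
      moreover have "degree (r - [:poly r s:]) \<le> max (degree r) (degree [:poly r s:])"
        by (rule degree_diff_le_max)
      ultimately have "Suc (degree q) \<le> degree r" by simp
      then show False using insert \<open>card S \<le> degree q\<close> by (auto simp: card_insert_if)
    qed
  qed
  moreover have "poly q x \<in> k" if "x \<in> S" for x
  proof -
    have "poly r x = poly r s + (x - s) * poly q x" by (subst r) (simp add: left_diff_distrib)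
    moreover have "x \<noteq> s" using that insert by auto
    ultimately have "poly q x = (poly r x - poly r s) / (x - s)" by simp
    then show ?thesis using insert.prems that by (auto intro!: subfield_closed k)
  qed
  ultimately have "poly_over k q" using insert by auto
  moreover have "s \<in> k" "poly r s \<in> k" using insert.prems by auto
  ultimately show ?case
    by (subst r) (intro poly_over_closed poly_over_pCons subfield_closed k)
qed

section \<open>Graphs of field homomorphisms\<close>

text \<open>A homomorphism from a subfield is represented by its graph, so that it can be extended by
  Zorn's lemma for inclusion.\<close>

definition hom_graph :: "('a::field \<times> 'a) set \<Rightarrow> bool" where
  "hom_graph G \<longleftrightarrow> (1, 1) \<in> G \<and>
     (\<forall>(x, x')\<in>G. \<forall>(y, y')\<in>G. (x - y, x' - y') \<in> G \<and> (x * y, x' * y') \<in> G) \<and>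
     (\<forall>(x, x')\<in>G. (inverse x, inverse x') \<in> G) \<and> (\<forall>y. (0, y) \<in> G \<longrightarrow> y = 0)"

lemma hom_graph_1: "hom_graph G \<Longrightarrow> (1, 1) \<in> G"
  and hom_graph_diff: "hom_graph G \<Longrightarrow> (x, x') \<in> G \<Longrightarrow> (y, y') \<in> G \<Longrightarrow> (x - y, x' - y') \<in> G"
  and hom_graph_mult: "hom_graph G \<Longrightarrow> (x, x') \<in> G \<Longrightarrow> (y, y') \<in> G \<Longrightarrow> (x * y, x' * y') \<in> G"
  and hom_graph_inverse: "hom_graph G \<Longrightarrow> (x, x') \<in> G \<Longrightarrow> (inverse x, inverse x') \<in> G"
  and hom_graph_zeroD: "hom_graph G \<Longrightarrow> (0, y) \<in> G \<Longrightarrow> y = 0"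
  by (auto simp: hom_graph_def)

lemma hom_graphI:
  assumes "(1, 1) \<in> G"
    and "\<And>x x' y y'. (x, x') \<in> G \<Longrightarrow> (y, y') \<in> G \<Longrightarrow> (x - y, x' - y') \<in> G"
    and "\<And>x x' y y'. (x, x') \<in> G \<Longrightarrow> (y, y') \<in> G \<Longrightarrow> (x * y, x' * y') \<in> G"
    and "\<And>x x'. (x, x') \<in> G \<Longrightarrow> (inverse x, inverse x') \<in> G"
    and "\<And>y. (0, y) \<in> G \<Longrightarrow> y = 0"
  shows "hom_graph G"
  using assms by (auto simp: hom_graph_def)

lemma hom_graph_Int: "hom_graph G \<Longrightarrow> hom_graph H \<Longrightarrow> hom_graph (G \<inter> H)"
  by (rule hom_graphI)
    (auto intro: hom_graph_1 hom_graph_diff hom_graph_mult hom_graph_inverse dest: hom_graph_zeroD)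

lemma hom_graph_Id: "hom_graph Id"
  by (rule hom_graphI) auto

lemma hom_graph_0: "hom_graph G \<Longrightarrow> (0, 0) \<in> G"
  using hom_graph_diff[OF _ hom_graph_1 hom_graph_1] by simp

lemma hom_graph_uminus: "hom_graph G \<Longrightarrow> (x, x') \<in> G \<Longrightarrow> (- x, - x') \<in> G"
  using hom_graph_diff[OF _ hom_graph_0, of G x x'] by simp

lemma hom_graph_add: "hom_graph G \<Longrightarrow> (x, x') \<in> G \<Longrightarrow> (y, y') \<in> G \<Longrightarrow> (x + y, x' + y') \<in> G"
  using hom_graph_diff[of G x x' "- y" "- y'"] hom_graph_uminus[of G y y'] by simp

lemma hom_graph_sum:
  "hom_graph G \<Longrightarrow> (\<And>i. i \<in> I \<Longrightarrow> (h i, h' i) \<in> G) \<Longrightarrow> (sum h I, sum h' I) \<in> G"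
  by (induction I rule: infinite_finite_induct) (auto intro: hom_graph_0 hom_graph_add)

lemma hom_graph_unique: "hom_graph G \<Longrightarrow> (x, y) \<in> G \<Longrightarrow> (x, y') \<in> G \<Longrightarrow> y = y'"
  using hom_graph_diff[of G x y x y'] hom_graph_zeroD[of G "y - y'"] by simp

lemma hom_graph_zeroD':
  assumes "hom_graph G" "(x, 0) \<in> G" shows "x = 0"
proof (rule ccontr)
  assume "x \<noteq> 0"
  then have "(1, 0) \<in> G" using hom_graph_mult[OF assms(1) assms(2) hom_graph_inverse[OF assms]] by simp
  then show False using hom_graph_unique[OF assms(1) _ hom_graph_1] assms(1) by fastforce
qed

lemma hom_graph_inj: "hom_graph G \<Longrightarrow> (x, y) \<in> G \<Longrightarrow> (x', y) \<in> G \<Longrightarrow> x = x'"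
  using hom_graph_diff[of G x y x' y] hom_graph_zeroD'[of G "x - x'"] by simp

lemma subfield_Domain: "hom_graph G \<Longrightarrow> is_subfield (Domain G)"
  unfolding is_subfield_def
  by (auto simp: Domain_iff intro: hom_graph_0 hom_graph_1 hom_graph_diff hom_graph_mult hom_graph_inverse)

lemma hom_graph_Id_on: "is_subfield F \<Longrightarrow> hom_graph (Id_on F)"
  by (auto simp: hom_graph_def is_subfield_def)

section \<open>Transport of polynomials and adjunction of one element\<close>

definition poly_graph :: "('a::zero \<times> 'a) set \<Rightarrow> 'a poly \<Rightarrow> 'a poly \<Rightarrow> bool" where
  "poly_graph G p p' \<longleftrightarrow> (\<forall>i. (coeff p i, coeff p' i) \<in> G)"

lemma poly_graph_diff: "hom_graph G \<Longrightarrow> poly_graph G p p' \<Longrightarrow> poly_graph G q q' \<Longrightarrow> poly_graph G (p - q) (p' - q')"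
  and poly_graph_add: "hom_graph G \<Longrightarrow> poly_graph G p p' \<Longrightarrow> poly_graph G q q' \<Longrightarrow> poly_graph G (p + q) (p' + q')"
  and poly_graph_mult: "hom_graph G \<Longrightarrow> poly_graph G p p' \<Longrightarrow> poly_graph G q q' \<Longrightarrow> poly_graph G (p * q) (p' * q')"
  and poly_graph_0: "hom_graph G \<Longrightarrow> poly_graph G 0 0"
  and poly_graph_pCons: "(a, a') \<in> G \<Longrightarrow> poly_graph G p p' \<Longrightarrow> poly_graph G (pCons a p) (pCons a' p')"
  by (auto simp: poly_graph_def coeff_mult coeff_pCons hom_graph_0 split: nat.splits
      intro!: hom_graph_diff hom_graph_add hom_graph_sum hom_graph_mult)

lemma poly_graph_pCons_iff:
  "poly_graph G (pCons a p) (pCons a' p') \<longleftrightarrow> (a, a') \<in> G \<and> poly_graph G p p'"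
  unfolding poly_graph_def by (metis coeff_pCons_0 coeff_pCons_Suc old.nat.exhaust)

lemma poly_graph_exists:
  assumes G: "hom_graph G" and "poly_over (Domain G) p"
  shows "\<exists>p'. poly_graph G p p'"
  using assms(2)
proof (induction p)
  case 0 then show ?case using poly_graph_0[OF G] by auto
next
  case (pCons a p)
  then show ?case by (auto simp: poly_over_pCons_iff intro: poly_graph_pCons)
qed

lemma poly_graph_unique: "hom_graph G \<Longrightarrow> poly_graph G p p' \<Longrightarrow> poly_graph G p p'' \<Longrightarrow> p' = p''"
  unfolding poly_graph_def by (intro poly_eqI) (metis hom_graph_unique)

lemma poly_graph_over: "poly_graph G p p' \<Longrightarrow> poly_over (Domain G) p"
  unfolding poly_graph_def poly_over_def by blast

lemma poly_graph_same: "poly_over B p \<Longrightarrow> Id_on B \<subseteq> G \<Longrightarrow> poly_graph G p p"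
  unfolding poly_graph_def poly_over_def by blast

lemma poly_graph_degree: "hom_graph G \<Longrightarrow> poly_graph G p p' \<Longrightarrow> degree p' = degree p"
  unfolding poly_graph_def degree_def by (metis hom_graph_zeroD hom_graph_zeroD')

lemma hom_graph_poly:
  assumes G: "hom_graph G" and "poly_graph G p p'" and x: "(x, x') \<in> G"
  shows "(poly p x, poly p' x') \<in> G"
  using assms(2)
proof (induction p arbitrary: p')
  case 0
  then have "p' = 0" using poly_graph_unique[OF G] poly_graph_0[OF G] by blast
  then show ?case by (simp add: hom_graph_0 G)
next
  case (pCons a p)
  obtain a' q' where p': "p' = pCons a' q'" by (cases p')
  show ?case using pCons unfolding p' poly_graph_pCons_iff
    by (auto intro!: hom_graph_add hom_graph_mult G x)
qed

lemma poly_graph_pcompose: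
  assumes G: "hom_graph G" and "poly_graph G p p'" and q: "poly_graph G q q'"
  shows "poly_graph G (pcompose p q) (pcompose p' q')"
  using assms(2)
proof (induction p arbitrary: p')
  case 0
  then have "p' = 0" using poly_graph_unique[OF G] poly_graph_0[OF G] by blast
  then show ?case by (simp add: poly_graph_0 G)
next
  case (pCons a p)
  obtain a' r' where p': "p' = pCons a' r'" by (cases p')
  show ?case using pCons unfolding p' poly_graph_pCons_iff pcompose_pCons
    by (intro poly_graph_add poly_graph_mult G q poly_graph_pCons poly_graph_0) auto
qed

definition adjoin_graph :: "('a::field \<times> 'a) set \<Rightarrow> 'a \<Rightarrow> 'a \<Rightarrow> ('a \<times> 'a) set" where
  "adjoin_graph G x x' = {(poly r x, poly r' x') | r r'. poly_graph G r r'}"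

lemma adjoin_graph_extends:
  assumes G: "hom_graph G"
  shows "G \<subseteq> adjoin_graph G x x'" "(x, x') \<in> adjoin_graph G x x'"
proof -
  have "(a, a') \<in> adjoin_graph G x x'" if "(a, a') \<in> G" for a a'
  proof -
    have "poly_graph G [:a:] [:a':]" using that G by (intro poly_graph_pCons poly_graph_0)
    then show ?thesis unfolding adjoin_graph_def
      by (intro CollectI exI[of _ "[:a:]"] exI[of _ "[:a':]"]) simp
  qed
  then show "G \<subseteq> adjoin_graph G x x'" by auto
  show "(x, x') \<in> adjoin_graph G x x'"
  proof -
    have "poly_graph G [:0, 1:] [:0, 1:]" using G
      by (intro poly_graph_pCons poly_graph_0 hom_graph_0 hom_graph_1)
    then show ?thesis unfolding adjoin_graph_def
      by (intro CollectI exI[of _ "[:0, 1:]"]) simp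
  qed
qed

text \<open>Well-definedness is the point: \<open>r(x) = 0\<close> makes \<open>r\<close> a multiple
  of \<open>p\<close>, so the transported polynomial is a multiple of \<open>p'\<close>, which
  vanishes at \<open>x'\<close>.\<close>

lemma hom_graph_adjoin:
  assumes G: "hom_graph G" and alg: "algebraic_over (Domain G) x"
    and p: "\<And>r. poly_over (Domain G) r \<Longrightarrow> poly r x = 0 \<Longrightarrow> \<exists>s. poly_over (Domain G) s \<and> r = p * s"
    and p': "poly_graph G p p'" "poly p' x' = 0"
  shows "hom_graph (adjoin_graph G x x')"
proof -
  note F = subfield_Domain[OF G]
  let ?G = "adjoin_graph G x x'"
  have diff: "(a - b, a' - b') \<in> ?G" and mult: "(a * b, a' * b') \<in> ?G"
    if "(a, a') \<in> ?G" "(b, b') \<in> ?G" for a a' b b'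
  proof -
    from that obtain r r' s s' where "a = poly r x" "a' = poly r' x'" "poly_graph G r r'"
      "b = poly s x" "b' = poly s' x'" "poly_graph G s s'" unfolding adjoin_graph_def by blast
    then show "(a - b, a' - b') \<in> ?G" "(a * b, a' * b') \<in> ?G"
      using poly_graph_diff[OF G, of r r' s s'] poly_graph_mult[OF G, of r r' s s']
      unfolding adjoin_graph_def mem_Collect_eq by (metis poly_diff, metis poly_mult)
  qed
  have zero: "y = 0" if "(0, y) \<in> ?G" for y
  proof -
    from that obtain r r' where r: "0 = poly r x" "y = poly r' x'" "poly_graph G r r'"
      unfolding adjoin_graph_def by blast
    obtain s where s: "poly_over (Domain G) s" "r = p * s" using p[of r] r poly_graph_over by metis
    obtain s' where s': "poly_graph G s s'" using poly_graph_exists[OF G s(1)] by blast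
    have "r' = p' * s'" using poly_graph_unique[OF G r(3)] poly_graph_mult[OF G p'(1) s'] s(2) by blast
    then show "y = 0" using r(2) p'(2) by simp
  qed
  have one: "(1, 1) \<in> ?G" using adjoin_graph_extends(1)[OF G] hom_graph_1[OF G] by blast
  have evalG: "(poly q a, poly q' a') \<in> ?G" if q: "poly_graph G q q'" and a: "(a, a') \<in> ?G" for q q' a a'
    using q
  proof (induction q arbitrary: q')
    case 0
    then have "q' = 0" using poly_graph_unique[OF G] poly_graph_0[OF G] by blast
    then show ?case using diff[OF one one] by simp
  next
    case (pCons c q)
    obtain c' r' where q': "q' = pCons c' r'" by (cases q')
    have c: "(c, c') \<in> ?G" "(poly q a, poly r' a') \<in> ?G"
      using pCons adjoin_graph_extends(1)[OF G] unfolding q' poly_graph_pCons_iff by auto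
    have "(0 - a * poly q a, 0 - a' * poly r' a') \<in> ?G"
      using diff[OF _ mult[OF a c(2)], of 0 0] diff[OF one one] by simp
    from diff[OF c(1) this] show ?case by (simp add: q')
  qed
  have inv: "(inverse a, inverse a') \<in> ?G" if a: "(a, a') \<in> ?G" for a a'
  proof (cases "a = 0")
    case True
    then have "a' = 0" using zero a by auto
    then show ?thesis using True a by simp
  next
    case False
    obtain r r' where r: "a = poly r x" "poly_graph G r r'" using a unfolding adjoin_graph_def by blast
    let ?A = "{x. algebraic_over (Domain G) x}"
    have "poly r x \<in> ?A"
      by (rule poly_over_eval[OF subfield_algebraic[OF F]])
         (use poly_graph_over[OF r(2)] alg algebraic_over_base[OF F] in \<open>auto simp: poly_over_def\<close>)
    then have "algebraic_over (Domain G) a" using r(1) by simp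
    then obtain q where q: "poly_over (Domain G) q" "inverse a = poly q a" using inverse_poly[OF F] by blast
    obtain q' where q': "poly_graph G q q'" using poly_graph_exists[OF G q(1)] by blast
    have qa: "(poly q a, poly q' a') \<in> ?G" by (rule evalG[OF q' a])
    have "(a * poly q a - 1, a' * poly q' a' - 1) \<in> ?G" by (intro diff mult a qa one)
    moreover have "a * poly q a - 1 = 0" using False by (simp flip: q(2))
    ultimately have "a' * poly q' a' = 1" using zero by fastforce
    then have "inverse a' = poly q' a'" by (rule inverse_unique)
    then show ?thesis using qa q(2) by simp
  qed
  show ?thesis unfolding hom_graph_def using one diff mult inv zero by auto
qed

lemma hom_graph_Union:
  assumes ch: "\<C> \<noteq> {}" "\<And>G H. G \<in> \<C> \<Longrightarrow> H \<in> \<C> \<Longrightarrow> G \<subseteq> H \<or> H \<subseteq> G"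
    and G: "\<And>G. G \<in> \<C> \<Longrightarrow> hom_graph G"
  shows "hom_graph (\<Union>\<C>)"
proof -
  have two: "\<exists>G\<in>\<C>. u \<in> G \<and> v \<in> G" if "u \<in> \<Union>\<C>" "v \<in> \<Union>\<C>" for u v
    using that ch(2) by blast
  have "(x - y, x' - y') \<in> \<Union>\<C> \<and> (x * y, x' * y') \<in> \<Union>\<C>"
    if "(x, x') \<in> \<Union>\<C>" "(y, y') \<in> \<Union>\<C>" for x x' y y'
    using two[OF that] G hom_graph_diff hom_graph_mult by blast
  moreover have "(inverse x, inverse x') \<in> \<Union>\<C>" if "(x, x') \<in> \<Union>\<C>" for x x'
    using that G hom_graph_inverse by blast
  moreover have "(1, 1) \<in> \<Union>\<C>" using ch(1) G hom_graph_1 by blast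
  moreover have "\<forall>y. (0, y) \<in> \<Union>\<C> \<longrightarrow> y = 0" using G hom_graph_zeroD by blast
  ultimately show ?thesis unfolding hom_graph_def by blast
qed

text \<open>\<open>Q\<close> is a parameter because Zorn's lemma is applied twice: to arbitrary
  prolongations, and to those that are the identity on elements algebraic over
  \<open>K\<close>.\<close>

lemma graph_extension_Zorn:
  assumes G0: "Q G0"
    and ch: "\<And>\<C>. \<C> \<noteq> {} \<Longrightarrow> (\<And>G H. G \<in> \<C> \<Longrightarrow> H \<in> \<C> \<Longrightarrow> G \<subseteq> H \<or> H \<subseteq> G) \<Longrightarrow>
       (\<And>G. G \<in> \<C> \<Longrightarrow> Q G \<and> G0 \<subseteq> G) \<Longrightarrow> Q (\<Union>\<C>)"
    and step: "\<And>G x. Q G \<Longrightarrow> G0 \<subseteq> G \<Longrightarrow> x \<in> A \<Longrightarrow> \<exists>G'. G \<subseteq> G' \<and> Q G' \<and> x \<in> Domain G'"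
  shows "\<exists>G. G0 \<subseteq> G \<and> Q G \<and> A \<subseteq> Domain G"
proof -
  have "\<exists>M\<in>{G. Q G \<and> G0 \<subseteq> G}. \<forall>X\<in>{G. Q G \<and> G0 \<subseteq> G}. M \<subseteq> X \<longrightarrow> X = M"
  proof (rule subset_Zorn_nonempty)
    show "{G. Q G \<and> G0 \<subseteq> G} \<noteq> {}" using G0 by auto
    fix \<C> assume C: "\<C> \<noteq> {}" "subset.chain {G. Q G \<and> G0 \<subseteq> G} \<C>"
    then have C': "\<And>G. G \<in> \<C> \<Longrightarrow> Q G \<and> G0 \<subseteq> G"
      "\<And>G H. G \<in> \<C> \<Longrightarrow> H \<in> \<C> \<Longrightarrow> G \<subseteq> H \<or> H \<subseteq> G" by (auto simp: subset_chain_def)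
    then have "Q (\<Union>\<C>)" using C(1) by (intro ch)
    then show "\<Union>\<C> \<in> {G. Q G \<and> G0 \<subseteq> G}" using C(1) C'(1) by blast
  qed
  then obtain G where "G \<in> {G. Q G \<and> G0 \<subseteq> G}"
    and max: "\<forall>X\<in>{G. Q G \<and> G0 \<subseteq> G}. G \<subseteq> X \<longrightarrow> X = G" by (rule bexE)
  then have G: "Q G" "G0 \<subseteq> G" by simp_all
  have "x \<in> Domain G" if "x \<in> A" for x
  proof -
    obtain G' where "G \<subseteq> G'" "Q G'" "x \<in> Domain G'" using step[OF G \<open>x \<in> A\<close>] by blast
    moreover from this have "G' = G" using max G(2) by simp
    ultimately show ?thesis by simp
  qed
  then show ?thesis using G by blast
qed

text \<open>\<open>G\<close> fixes the coefficients of \<open>root_poly S\<close>, so the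
  transported annihilator \<open>p'\<close> still divides it. If no element of \<open>S\<close> were
  a root of \<open>p'\<close>, all would be roots of the cofactor \<open>s'\<close>, whose degree is
  below \<open>card S\<close>. So there is a root to which \<open>x\<close> can be sent.\<close>

lemma hom_graph_extend_step:
  assumes G: "hom_graph G" and B: "is_subfield B" "Id_on B \<subseteq> G" and x: "splits_over B x"
  shows "\<exists>G'. G \<subseteq> G' \<and> hom_graph G' \<and> x \<in> Domain G'"
proof -
  note F = subfield_Domain[OF G]
  have BF: "B \<subseteq> Domain G" using B(2) by auto
  obtain S where S: "finite S" "x \<in> S" "poly_over B (root_poly S)" using x by (auto simp: splits_over_def)
  have alg: "algebraic_over (Domain G) x"
    using algebraic_over_mono[OF splits_over_algebraic[OF B(1) x] BF] .
  obtain p where p: "p \<noteq> 0" "poly_over (Domain G) p" "poly p x = 0"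
    "\<And>r. poly_over (Domain G) r \<Longrightarrow> poly r x = 0 \<Longrightarrow> \<exists>s. poly_over (Domain G) s \<and> r = p * s"
    using annihilator_generator[OF F alg] by blast
  have "poly (root_poly S) x = 0" using root_poly_eq_0_iff S by blast
  then obtain s where s: "poly_over (Domain G) s" "root_poly S = p * s"
    using p(4) poly_over_mono[OF S(3) BF] by blast
  obtain p' s' where p': "poly_graph G p p'" "poly_graph G s s'"
    using poly_graph_exists[OF G] p(2) s(1) by blast
  have eq: "root_poly S = p' * s'"
    using poly_graph_unique[OF G poly_graph_same[OF S(3) B(2)]] poly_graph_mult[OF G p'] s(2) by metis
  have "p' \<noteq> 0" "s' \<noteq> 0" using eq root_poly_nonzero[of S] by auto
  have "degree p > 0" using p(1,3) by (metis degree_eq_zeroE gr0I poly_const_conv pCons_0_0)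
  then have "degree p' > 0" using poly_graph_degree[OF G p'(1)] by simp
  then have ds: "degree s' < card S"
    using eq degree_root_poly[of S] \<open>p' \<noteq> 0\<close> \<open>s' \<noteq> 0\<close> by (simp add: degree_mult_eq)
  have "\<exists>x'. poly p' x' = 0"
  proof (rule ccontr)
    assume "\<nexists>x'. poly p' x' = 0"
    then have "poly s' r = 0" if "r \<in> S" for r
      using that eq root_poly_eq_0_iff[OF S(1), of r] by auto
    then have "card S \<le> card {r. poly s' r = 0}"
      using poly_roots_finite[OF \<open>s' \<noteq> 0\<close>] by (intro card_mono) auto
    also have "\<dots> \<le> degree s'" using \<open>s' \<noteq> 0\<close> by (rule card_poly_roots_bound)
    finally show False using ds by simp
  qed
  then obtain x' where "poly p' x' = 0" ..
  then have "hom_graph (adjoin_graph G x x')" using hom_graph_adjoin[OF G alg p(4) p'(1)] by blast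
  then show ?thesis using adjoin_graph_extends[OF G, of x x']
    by (intro exI[of _ "adjoin_graph G x x'"]) auto
qed

lemma hom_graph_extend:
  assumes G: "hom_graph G0" and B: "is_subfield B" "Id_on B \<subseteq> G0"
    and A: "\<And>x. x \<in> A \<Longrightarrow> splits_over B x"
  shows "\<exists>G. G0 \<subseteq> G \<and> hom_graph G \<and> A \<subseteq> Domain G"
proof (rule graph_extension_Zorn[of hom_graph])
  show "\<exists>G'. G \<subseteq> G' \<and> hom_graph G' \<and> x \<in> Domain G'" if "hom_graph G" "G0 \<subseteq> G" "x \<in> A" for G x
    using hom_graph_extend_step[OF that(1) B(1) _ A[OF that(3)]] B(2) that(2) by blast
  show "hom_graph (\<Union>\<C>)" if "\<C> \<noteq> {}" "\<And>G H. G \<in> \<C> \<Longrightarrow> H \<in> \<C> \<Longrightarrow> G \<subseteq> H \<or> H \<subseteq> G"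
     "\<And>G. G \<in> \<C> \<Longrightarrow> hom_graph G \<and> G0 \<subseteq> G" for \<C>
    using hom_graph_Union[OF that(1,2)] that(3) by blast
qed (rule G)

lemma hom_graph_root:
  assumes G: "hom_graph G" and B: "Id_on B \<subseteq> G"
    and S: "finite S" "poly_over B (root_poly S)" and x: "(x, x') \<in> G" "x \<in> S"
  shows "x' \<in> S"
proof -
  have "(poly (root_poly S) x, poly (root_poly S) x') \<in> G"
    by (rule hom_graph_poly[OF G poly_graph_same[OF S(2) B] x(1)])
  moreover have "poly (root_poly S) x = 0" using root_poly_eq_0_iff S x by blast
  ultimately show ?thesis using hom_graph_zeroD[OF G] root_poly_eq_0_iff[OF S(1)] by metis
qed

text \<open>\<open>G\<close> restricts to an injective self-map of the finite set \<open>S\<close>.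
  This is why prolonged homomorphisms are automorphisms.\<close>

lemma hom_graph_surj:
  assumes G: "hom_graph G" and B: "Id_on B \<subseteq> G"
    and S: "finite S" "poly_over B (root_poly S)" "S \<subseteq> Domain G" and y: "y \<in> S"
  shows "\<exists>x\<in>S. (x, y) \<in> G"
proof -
  have "\<forall>x\<in>S. \<exists>y. (x, y) \<in> G" using S(3) by auto
  then obtain h where h: "\<And>x. x \<in> S \<Longrightarrow> (x, h x) \<in> G" by (meson bchoice)
  have "inj_on h S" using h hom_graph_inj[OF G] by (metis inj_onI)
  moreover have "h ` S \<subseteq> S" using hom_graph_root[OF G B S(1,2)] h by auto
  ultimately have "h ` S = S" using S(1) by (simp add: endo_inj_surj)
  then show ?thesis using h y by (metis imageE)
qed

text \<open>Used with \<open>B = K(t)\<close>, over which every element of the ambient field splits: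
  a partial homomorphism over \<open>K(t)\<close> is the restriction of an automorphism of the
  ambient field.\<close>

theorem automorphism_extension:
  assumes G: "hom_graph G" and B: "is_subfield B" "Id_on B \<subseteq> G" and A: "\<And>x. splits_over B x"
  obtains \<gamma> where "bij \<gamma>" "\<And>x y. \<gamma> (x + y) = \<gamma> x + \<gamma> y" "\<And>x y. \<gamma> (x * y) = \<gamma> x * \<gamma> y"
    "\<And>x y. (x, y) \<in> G \<Longrightarrow> \<gamma> x = y"
proof -
  obtain H where H: "G \<subseteq> H" "hom_graph H" "UNIV \<subseteq> Domain H"
    using hom_graph_extend[OF G B, of UNIV] A by blast
  have BH: "Id_on B \<subseteq> H" using B H by auto
  have "\<forall>x. \<exists>y. (x, y) \<in> H" using H(3) by auto
  then obtain \<gamma> where g: "\<And>x. (x, \<gamma> x) \<in> H" by metis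
  have gI: "\<gamma> x = y" if "(x, y) \<in> H" for x y using that g hom_graph_unique[OF H(2)] by blast
  show thesis
  proof
    have "inj \<gamma>" using g hom_graph_inj[OF H(2)] by (metis injI)
    moreover have "surj \<gamma>"
      unfolding surj_def
    proof
      fix y
      obtain S where S: "finite S" "y \<in> S" "poly_over B (root_poly S)" using A[of y] by (auto simp: splits_over_def)
      obtain x where "(x, y) \<in> H" using hom_graph_surj[OF H(2) BH S(1,3) _ S(2)] H(3) by blast
      then show "\<exists>x. y = \<gamma> x" using gI by metis
    qed
    ultimately show "bij \<gamma>" by (rule bijI)
    show "\<gamma> (x + y) = \<gamma> x + \<gamma> y" for x y by (intro gI hom_graph_add H(2) g)
    show "\<gamma> (x * y) = \<gamma> x * \<gamma> y" for x y by (intro gI hom_graph_mult H(2) g)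
    show "\<gamma> x = y" if "(x, y) \<in> G" for x y using that H(1) gI by blast
  qed
qed

text \<open>Gluing with the identity of a relatively algebraically closed subfield \<open>k\<close>: this works because an
  element of \<open>k\<close> keeps its minimal polynomial over any field \<open>F\<close> with prescribed intersection with \<open>k\<close>.\<close>

lemma hom_graph_glue_step:
  assumes G: "hom_graph G" and K: "is_subfield K" "Id_on K \<subseteq> G"
    and id: "\<And>z y. (z, y) \<in> G \<Longrightarrow> algebraic_over K z \<Longrightarrow> y = z"
    and x: "splits_over K x"
  shows "\<exists>G'. G \<subseteq> G' \<and> (hom_graph G' \<and> (\<forall>z y. (z, y) \<in> G' \<longrightarrow> algebraic_over K z \<longrightarrow> y = z)) \<and> x \<in> Domain G'"
proof -
  note F = subfield_Domain[OF G]
  define k where "k = {x. algebraic_over K x}"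
  have k: "is_subfield k" unfolding k_def by (rule subfield_algebraic[OF K(1)])
  have BF: "K \<subseteq> Domain G" using K(2) by auto
  obtain S where S: "finite S" "x \<in> S" "poly_over K (root_poly S)" using x by (auto simp: splits_over_def)
  have Sk: "S \<subseteq> k" unfolding k_def using S splits_over_algebraic[OF K(1)] by (auto simp: splits_over_def)
  have alg: "algebraic_over (Domain G) x"
    using algebraic_over_mono[OF splits_over_algebraic[OF K(1) x] BF] .
  obtain p where p: "p \<noteq> 0" "poly_over (Domain G) p" "poly p x = 0"
    "\<And>r. poly_over (Domain G) r \<Longrightarrow> poly r x = 0 \<Longrightarrow> \<exists>s. poly_over (Domain G) s \<and> r = p * s"
    using annihilator_generator[OF F alg] by blast
  have "poly (root_poly S) x = 0" using root_poly_eq_0_iff S by blast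
  then obtain s where s: "poly_over (Domain G) s" "root_poly S = p * s"
    using p(4) poly_over_mono[OF S(3) BF] by blast
  obtain S' where S': "S' \<subseteq> S" "p = smult (lead_coeff p) (root_poly S')"
    using dvd_root_poly[OF S(1)] s(2) by metis
  \<comment> \<open>The normalised annihilator of \<open>x\<close> over \<open>Domain G\<close> is a
    product over conjugates of \<open>x\<close>, so its coefficients lie in \<open>k\<close>, where
    \<open>G\<close> is the identity. Hence \<open>x\<close> may be sent to itself.\<close>
  define q where "q = root_poly S'"
  have lp: "lead_coeff p \<noteq> 0" using p(1) by simp
  have q: "q = smult (inverse (lead_coeff p)) p" unfolding q_def using S'(2) lp
    by (metis left_inverse smult_1_left smult_smult)
  have qF: "poly_over (Domain G) q" unfolding q using p(2)
    by (auto intro!: poly_over_closed subfield_closed F poly_overD)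
  have qk: "poly_over k q" unfolding q_def by (rule poly_over_root_poly[OF k]) (use S' Sk in auto)
  have fixk: "poly_graph G r r" if "poly_over (Domain G) r" "poly_over k r" for r
    using that id unfolding poly_graph_def poly_over_def k_def by blast
  have qgen: "\<exists>s. poly_over (Domain G) s \<and> r = q * s" if r: "poly_over (Domain G) r" "poly r x = 0" for r
  proof -
    obtain s where s: "poly_over (Domain G) s" "r = p * s" using p(4)[OF r] by blast
    have "r = q * smult (lead_coeff p) s" unfolding s q using lp by simp
    moreover have "poly_over (Domain G) (smult (lead_coeff p) s)"
      using s p(2) by (intro poly_over_closed F poly_overD)
    ultimately show ?thesis by blast
  qed
  have qx: "poly q x = 0" unfolding q using p(3) by simp
  let ?G = "adjoin_graph G x x"
  have H: "hom_graph ?G" by (rule hom_graph_adjoin[OF G alg qgen fixk[OF qF qk] qx])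
  have "y = z" if zy: "(z, y) \<in> ?G" "algebraic_over K z" for z y
  proof -
    obtain r r' where r: "z = poly r x" "y = poly r' x" "poly_graph G r r'"
      using zy(1) unfolding adjoin_graph_def by auto
    have "q \<noteq> 0" by (simp add: q_def root_poly_nonzero)
    then obtain e r0 where e: "poly_over (Domain G) e" "poly_over (Domain G) r0" "r = q * e + r0"
      "r0 = 0 \<or> degree r0 < degree q"
      using poly_over_division[OF F poly_graph_over[OF r(3)] qF] by blast
    have z0: "z = poly r0 x" using r(1) e(3) qx by simp
    obtain m where m: "m \<noteq> 0" "poly_over K m" "poly m z = 0"
      using zy(2) algebraic_over_def'[OF K(1)] by blast
    have "poly (pcompose m r0) x = 0" using m(3) z0 by (simp add: poly_pcompose)
    moreover have "poly_over (Domain G) (pcompose m r0)"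
      by (intro poly_over_closed F e poly_over_mono[OF m(2) BF])
    ultimately obtain w where w: "pcompose m r0 = q * w" using qgen by blast
    \<comment> \<open>\<open>q\<close> divides \<open>pcompose m r0\<close>, so \<open>r0\<close>
      maps each root of \<open>q\<close> to a root of \<open>m\<close>, that is, into
      \<open>k\<close>. Its degree is below the number of these roots, so interpolation puts its
      coefficients into \<open>k\<close>, where they are fixed.\<close>
    have "poly r0 u \<in> k" if "u \<in> S'" for u
    proof -
      have "poly q u = 0" unfolding q_def using that S' S(1) by (meson finite_subset root_poly_eq_0_iff)
      then have "poly m (poly r0 u) = 0" using arg_cong[OF w, of "\<lambda>p. poly p u"] by (simp add: poly_pcompose)
      then show ?thesis unfolding k_def using m algebraic_over_def'[OF K(1)] by blast
    qed
    then have "poly_over k r0"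
      using e(4) S' S(1) Sk by (intro poly_over_interpolation[OF k, of S']) (auto simp: q_def degree_root_poly intro: finite_subset)
    then have "poly_graph G r0 r0" using fixk e(2) by blast
    then have "(z, z) \<in> ?G" unfolding adjoin_graph_def z0 by blast
    then show "y = z" using that(1) hom_graph_unique[OF H] by blast
  qed
  then show ?thesis using H adjoin_graph_extends[OF G, of x x]
    by (intro exI[of _ ?G]) auto
qed

lemma hom_graph_glue:
  assumes G: "hom_graph G0" and K: "is_subfield K" "Id_on K \<subseteq> G0"
    and id: "\<And>z y. (z, y) \<in> G0 \<Longrightarrow> algebraic_over K z \<Longrightarrow> y = z"
    and A: "\<And>x. x \<in> A \<Longrightarrow> splits_over K x"
  shows "\<exists>G. G0 \<subseteq> G \<and> hom_graph G \<and> Id_on A \<subseteq> G"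
proof -
  let ?Q = "\<lambda>G. hom_graph G \<and> (\<forall>z y. (z, y) \<in> G \<longrightarrow> algebraic_over K z \<longrightarrow> y = z)"
  have "\<exists>G. G0 \<subseteq> G \<and> ?Q G \<and> A \<subseteq> Domain G"
  proof (rule graph_extension_Zorn[of ?Q])
    show "?Q G0" using G id by blast
    show "\<exists>G'. G \<subseteq> G' \<and> ?Q G' \<and> x \<in> Domain G'" if "?Q G" "G0 \<subseteq> G" "x \<in> A" for G x
      by (rule hom_graph_glue_step[OF _ K(1)]) (use that K A in auto)
    show "?Q (\<Union>\<C>)" if "\<C> \<noteq> {}" "\<And>G H. G \<in> \<C> \<Longrightarrow> H \<in> \<C> \<Longrightarrow> G \<subseteq> H \<or> H \<subseteq> G"
       "\<And>G. G \<in> \<C> \<Longrightarrow> ?Q G \<and> G0 \<subseteq> G" for \<C>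
      using hom_graph_Union[OF that(1,2)] that(3) by blast
  qed
  then obtain G where G: "G0 \<subseteq> G" "?Q G" "A \<subseteq> Domain G" by blast
  have "(x, x) \<in> G" if "x \<in> A" for x
    using G(2,3) that splits_over_algebraic[OF K(1) A[OF that]] by (metis DomainE subsetD)
  then show ?thesis using G by blast
qed

section \<open>Galois groups\<close>

lemma Gal_carrier: "\<sigma> \<in> carrier (Gal M F) \<longleftrightarrow> \<sigma> \<in> Bij M \<and>
    (\<forall>x\<in>M. \<forall>y\<in>M. \<sigma> (x + y) = \<sigma> x + \<sigma> y \<and> \<sigma> (x * y) = \<sigma> x * \<sigma> y) \<and> (\<forall>x\<in>F. \<sigma> x = x)"
  by (simp add: Gal_def)

lemma Bij_bij_betw: "\<sigma> \<in> Bij M \<Longrightarrow> bij_betw \<sigma> M M"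
  by (simp add: Bij_def)

lemma Bij_mem: "\<sigma> \<in> Bij M \<Longrightarrow> x \<in> M \<Longrightarrow> \<sigma> x \<in> M"
  using Bij_bij_betw bij_betwE by blast

lemma subgroup_Gal:
  assumes M: "is_subfield M" and "F \<subseteq> M"
  shows "subgroup (carrier (Gal M F)) (BijGroup M)"
proof
  show "carrier (Gal M F) \<subseteq> carrier (BijGroup M)" by (auto simp: Gal_carrier BijGroup_def)
  show "\<sigma> \<otimes>\<^bsub>BijGroup M\<^esub> \<tau> \<in> carrier (Gal M F)" if "\<sigma> \<in> carrier (Gal M F)" "\<tau> \<in> carrier (Gal M F)" for \<sigma> \<tau>
    using that assms compose_Bij[of \<sigma> M \<tau>]
    by (auto simp: Gal_carrier BijGroup_def compose_def Bij_mem subfield_closed subset_iff)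
  show "\<one>\<^bsub>BijGroup M\<^esub> \<in> carrier (Gal M F)"
    using assms id_Bij[of M] by (auto simp: Gal_carrier BijGroup_def subfield_closed subset_iff)
  show "inv\<^bsub>BijGroup M\<^esub> \<sigma> \<in> carrier (Gal M F)" if s: "\<sigma> \<in> carrier (Gal M F)" for \<sigma>
  proof -
    have B: "\<sigma> \<in> Bij M" using s by (simp add: Gal_carrier)
    define \<rho> where "\<rho> = (\<lambda>x\<in>M. inv_into M \<sigma> x)"
    have \<rho>: "\<rho> \<in> Bij M" unfolding \<rho>_def by (rule restrict_inv_into_Bij[OF B])
    have inj: "inj_on \<sigma> M" using Bij_bij_betw[OF B] bij_betw_def by blast
    have s1: "\<sigma> (\<rho> x) = x" if "x \<in> M" for x
      using that Bij_bij_betw[OF B] by (simp add: \<rho>_def bij_betw_inv_into_right)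
    have s2: "\<rho> x = y" if "x = \<sigma> y" "y \<in> M" for x y
      using that inj Bij_mem[OF B] by (simp add: \<rho>_def)
    have "\<rho> \<in> carrier (Gal M F)"
      unfolding Gal_carrier
    proof (intro conjI ballI \<rho>)
      fix x y assume xy: "x \<in> M" "y \<in> M"
      then have m: "\<rho> x \<in> M" "\<rho> y \<in> M" using Bij_mem[OF \<rho>] by auto
      show "\<rho> (x + y) = \<rho> x + \<rho> y"
        by (rule s2) (use s s1 xy m M in \<open>auto simp: Gal_carrier subfield_add\<close>)
      show "\<rho> (x * y) = \<rho> x * \<rho> y"
        by (rule s2) (use s s1 xy m M in \<open>auto simp: Gal_carrier subfield_mult\<close>)
    next
      fix x assume "x \<in> F" then show "\<rho> x = x"
        using s assms(2) by (intro s2) (auto simp: Gal_carrier)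
    qed
    then show ?thesis by (simp add: inv_BijGroup[OF B] \<rho>_def)
  qed
qed

lemma group_Gal: "is_subfield M \<Longrightarrow> F \<subseteq> M \<Longrightarrow> group (Gal M F)"
  using subgroup.subgroup_is_group[OF subgroup_Gal group_BijGroup, of M F]
  by (simp add: Gal_def)

definition graph_on :: "'a set \<Rightarrow> ('a \<Rightarrow> 'a) \<Rightarrow> ('a \<times> 'a) set" where
  "graph_on M \<sigma> = (\<lambda>x. (x, \<sigma> x)) ` M"

lemma graph_on_iff: "(x, y) \<in> graph_on M \<sigma> \<longleftrightarrow> x \<in> M \<and> y = \<sigma> x"
  by (auto simp: graph_on_def)

lemma hom_graph_on:
  assumes M: "is_subfield M" and inj: "inj_on \<sigma> M"
    and hom: "\<And>x y. x \<in> M \<Longrightarrow> y \<in> M \<Longrightarrow> \<sigma> (x + y) = \<sigma> x + \<sigma> y"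
      "\<And>x y. x \<in> M \<Longrightarrow> y \<in> M \<Longrightarrow> \<sigma> (x * y) = \<sigma> x * \<sigma> y"
  shows "hom_graph (graph_on M \<sigma>)"
proof -
  have "\<sigma> 0 + \<sigma> 0 = \<sigma> 0 + 0" using hom(1)[of 0 0] subfield_0[OF M] by simp
  then have 0: "\<sigma> 0 = 0" by (simp only: add_left_cancel)
  have ne: "\<sigma> x \<noteq> 0" if "x \<in> M" "x \<noteq> 0" for x
    using inj that 0 subfield_0[OF M] by (metis inj_on_eq_iff)
  have 1: "\<sigma> 1 = 1" using hom(2)[of 1 1] ne[of 1] subfield_1[OF M] by simp
  have um: "\<sigma> (- x) = - \<sigma> x" if "x \<in> M" for x
    using hom(1)[of x "- x"] that M 0 by (simp add: subfield_uminus eq_neg_iff_add_eq_0 add.commute)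
  have "\<sigma> (x - y) = \<sigma> x - \<sigma> y" if "x \<in> M" "y \<in> M" for x y
    using hom(1)[of x "- y"] um that M by (simp add: subfield_uminus)
  moreover have "\<sigma> (inverse x) = inverse (\<sigma> x)" if "x \<in> M" for x
  proof (cases "x = 0")
    case False
    then have "\<sigma> x * \<sigma> (inverse x) = 1" using hom(2)[of x "inverse x"] that M 1 by (simp add: subfield_inverse)
    then show ?thesis by (simp add: inverse_unique)
  qed (simp add: 0)
  ultimately show ?thesis using M 0 1 hom
    by (auto simp: hom_graph_def graph_on_iff subfield_closed)
qed

lemma hom_graph_Gal: "is_subfield M \<Longrightarrow> \<sigma> \<in> carrier (Gal M F) \<Longrightarrow> hom_graph (graph_on M \<sigma>)"
  by (rule hom_graph_on) (auto simp: Gal_carrier Bij_def bij_betw_def)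

text \<open>The intersection of the two graphs is again a \<open>hom_graph\<close>, and its domain
  is the set of agreement. Equality of homomorphisms then has to be checked on generators
  only.\<close>

lemma subfield_equalizer:
  assumes "hom_graph (graph_on M \<sigma>)" "hom_graph (graph_on M \<tau>)"
  shows "is_subfield {x \<in> M. \<sigma> x = \<tau> x}"
proof -
  from subfield_Domain[OF hom_graph_Int[OF assms]] show ?thesis
    by (rule back_subst[of is_subfield]) (auto simp: graph_on_iff)
qed

lemma graph_on_poly:
  assumes G: "hom_graph (graph_on M \<sigma>)" and F: "F \<subseteq> M" "\<And>x. x \<in> F \<Longrightarrow> \<sigma> x = x"
    and p: "poly_over F p" and x: "x \<in> M"
  shows "\<sigma> (poly p x) = poly p (\<sigma> x)"
proof -
  have "Id_on F \<subseteq> graph_on M \<sigma>" using F by (auto simp: graph_on_iff)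
  from hom_graph_poly[OF G poly_graph_same[OF p this], of x "\<sigma> x"] x show ?thesis
    by (simp add: graph_on_iff)
qed

text \<open>The annihilator of \<open>x\<close> over \<open>L\<close> divides a
  \<open>root_poly\<close>, so it has simple roots; with \<open>x\<close> as only root it would be
  linear and put \<open>x\<close> into \<open>L\<close>. Hence there is a second root
  \<open>x'\<close>, and the map fixing \<open>L\<close> and sending \<open>x\<close> to
  \<open>x'\<close> is prolonged and cut down to the algebraic elements.\<close>

lemma Galois_moves:
  assumes B: "is_subfield B" and L: "is_subfield L" "B \<subseteq> L"
    and spl: "\<And>x. algebraic_over B x \<Longrightarrow> splits_over B x"
    and x: "algebraic_over B x" "x \<notin> L"
  shows "\<exists>\<tau>\<in>carrier (Gal {x. algebraic_over B x} B).
     (\<forall>z\<in>L. algebraic_over B z \<longrightarrow> \<tau> z = z) \<and> \<tau> x \<noteq> x"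
proof -
  define A where "A = {x. algebraic_over B x}"
  have A: "is_subfield A" unfolding A_def by (rule subfield_algebraic[OF B])
  have G: "hom_graph (Id_on L)" and D: "Domain (Id_on L) = L" using L by (auto simp: hom_graph_Id_on)
  obtain S where S: "finite S" "x \<in> S" "poly_over B (root_poly S)" using spl[OF x(1)] by (auto simp: splits_over_def)
  have algL: "algebraic_over L x" using algebraic_over_mono[OF x(1) L(2)] .
  obtain p where p: "p \<noteq> 0" "poly_over L p" "poly p x = 0"
    "\<And>r. poly_over L r \<Longrightarrow> poly r x = 0 \<Longrightarrow> \<exists>s. poly_over L s \<and> r = p * s"
    using annihilator_generator[OF L(1) algL] by blast
  have "poly (root_poly S) x = 0" using root_poly_eq_0_iff S by blast
  then obtain s where s: "root_poly S = p * s" using p(4) poly_over_mono[OF S(3) L(2)] by blast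
  obtain S' where S': "S' \<subseteq> S" "p = smult (lead_coeff p) (root_poly S')"
    using dvd_root_poly[OF S(1)] s by metis
  have finS': "finite S'" using S' S(1) finite_subset by blast
  have lp: "lead_coeff p \<noteq> 0" using p(1) by simp
  have root: "poly p u = 0 \<longleftrightarrow> u \<in> S'" for u
    using S'(2) lp root_poly_eq_0_iff[OF finS', of u] by (metis mult_eq_0_iff poly_smult)
  have "S' \<noteq> {x}"
  proof
    assume "S' = {x}"
    then have "p = [: - lead_coeff p * x, lead_coeff p :]" using S'(2) by (simp add: root_poly_def)
    then have "coeff p 0 = - lead_coeff p * x" by (metis coeff_pCons_0)
    then have "x = - coeff p 0 / lead_coeff p" using lp by simp
    then show False using x(2) p(2) L(1) by (metis poly_overD subfield_divide subfield_uminus)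
  qed
  then obtain x' where x': "poly p x' = 0" "x' \<noteq> x" using root p(3) by blast
  define G1 where "G1 = adjoin_graph (Id_on L) x x'"
  have G1: "hom_graph G1" unfolding G1_def
    by (rule hom_graph_adjoin[OF G _ _ poly_graph_same[OF p(2)]]) (use p x' algL in \<open>auto simp: D\<close>)
  have G1L: "Id_on L \<subseteq> G1" "(x, x') \<in> G1" unfolding G1_def using adjoin_graph_extends[OF G] by auto
  have BG: "Id_on B \<subseteq> G1" using G1L L(2) by auto
  obtain G2 where G2: "G1 \<subseteq> G2" "hom_graph G2" "A \<subseteq> Domain G2"
    using hom_graph_extend[OF G1 B BG, of A] spl unfolding A_def by blast
  have BG2: "Id_on B \<subseteq> G2" using BG G2 by auto
  have "\<forall>x\<in>A. \<exists>y. (x, y) \<in> G2" using G2(3) by auto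
  then obtain h where h: "\<And>x. x \<in> A \<Longrightarrow> (x, h x) \<in> G2" by (meson bchoice)
  have hI: "h z = y" if "(z, y) \<in> G2" "z \<in> A" for z y using that h hom_graph_unique[OF G2(2)] by blast
  have SA: "T \<subseteq> A" if "finite T" "poly_over B (root_poly T)" for T
    unfolding A_def using that splits_over_algebraic[OF B] by (auto simp: splits_over_def)
  have bij: "bij_betw h A A"
  proof (rule bij_betw_imageI)
    show "inj_on h A" using h hom_graph_inj[OF G2(2)] by (metis inj_onI)
    show "h ` A = A"
    proof (rule equalityI; rule subsetI)
    fix y assume "y \<in> h ` A"
    then obtain z where z: "z \<in> A" "y = h z" by blast
    obtain T where T: "finite T" "z \<in> T" "poly_over B (root_poly T)" using spl z A_def by (auto simp: splits_over_def)
    then show "y \<in> A" using hom_graph_root[OF G2(2) BG2 T(1,3) h T(2)] z SA[OF T(1,3)] by auto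
  next
    fix y assume "y \<in> A"
    then obtain T where T: "finite T" "y \<in> T" "poly_over B (root_poly T)" using spl A_def by (auto simp: splits_over_def)
    then obtain z where "z \<in> T" "(z, y) \<in> G2"
      using hom_graph_surj[OF G2(2) BG2 T(1,3) _ T(2)] SA[OF T(1,3)] G2(3) by blast
    then show "y \<in> h ` A" using hI SA[OF T(1,3)] by force
    qed
  qed
  define \<tau> where "\<tau> = restrict h A"
  have "\<tau> \<in> carrier (Gal A B)"
    unfolding Gal_carrier
  proof (intro conjI ballI)
    show "\<tau> \<in> Bij A" using bij unfolding Bij_def \<tau>_def by (simp cong: bij_betw_cong)
    show "\<tau> (u + v) = \<tau> u + \<tau> v" "\<tau> (u * v) = \<tau> u * \<tau> v" if "u \<in> A" "v \<in> A" for u v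
      using that A unfolding \<tau>_def
      by (auto simp: subfield_add subfield_mult intro!: hI hom_graph_add[OF G2(2)] hom_graph_mult[OF G2(2)] h)
    fix u assume u: "u \<in> B"
    then have "u \<in> A" unfolding A_def using algebraic_over_base[OF B] by auto
    then show "\<tau> u = u" unfolding \<tau>_def using hI[of u u] BG2 u by auto
  qed
  moreover have "\<tau> z = z" if "z \<in> L" "algebraic_over B z" for z
    using that hI[of z z] G1L G2(1) unfolding \<tau>_def A_def by auto
  moreover have "\<tau> x \<noteq> x" using hI[of x x'] G1L G2(1) x x'(2) unfolding \<tau>_def A_def by auto
  ultimately show ?thesis unfolding A_def by blast
qed

section \<open>Separability\<close>

lemma separable_poly_dvd:
  assumes "separable_poly q" "p dvd q" shows "separable_poly p"
proof -
  from assms obtain s where s: "q = p * s" by blast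
  show ?thesis unfolding separable_poly_def
  proof (rule coprimeI)
    fix h assume "h dvd p" "h dvd pderiv p"
    then have "h dvd q" "h dvd pderiv q" by (auto simp: s pderiv_mult)
    then show "is_unit h" using assms(1) unfolding separable_poly_def by (meson not_coprimeI)
  qed
qed

lemma separable_poly_smult: "c \<noteq> 0 \<Longrightarrow> separable_poly p \<Longrightarrow> separable_poly (smult c p)"
  by (erule separable_poly_dvd) (simp add: smult_dvd_iff)

text \<open>A common factor of \<open>F - \<alpha>\<close> and \<open>F'\<close> would divide \<open>R(\<alpha>)\<close>, where \<open>R(F)\<close> is a multiple of \<open>F'\<close>
  with \<open>R\<close> defined over the base field.\<close>

lemma separable_poly_transcendental:
  assumes K: "is_subfield K" and p: "poly_over K p" "of_nat (degree p) \<noteq> (0::'a::field)"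
    and \<alpha>: "\<not> algebraic_over K (\<alpha>::'a)"
  shows "separable_poly (p - [:\<alpha>:])"
proof -
  define g where "g = pderiv p"
  have "p \<noteq> 0" using p(2) by auto
  then have "coeff g (degree p - 1) \<noteq> 0"
    using p(2) leading_coeff_0_iff[of p] unfolding g_def coeff_pderiv by (cases "degree p") (auto simp del: of_nat_Suc)
  then have g: "g \<noteq> 0" by auto
  have gK: "poly_over K g" unfolding g_def by (intro poly_over_closed K p)
  \<comment> \<open>Remainders modulo \<open>g\<close> form a space of dimension
    \<open>degree g\<close>, so the powers of \<open>p\<close> with exponents \<open>0\<close> to
    \<open>degree g\<close> are dependent modulo \<open>g\<close>. The coefficients of this relation
    form \<open>R\<close>.\<close>
  have "\<forall>i. \<exists>q r. poly_over K r \<and> p ^ i = g * q + r \<and> (r = 0 \<or> degree r < degree g)"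
    using poly_over_division[OF K poly_over_power[OF K p(1)] gK g] by metis
  then obtain q r where qr: "\<And>i. poly_over K (r i)" "\<And>i. p ^ i = g * q i + r i"
    "\<And>i. r i = 0 \<or> degree (r i) < degree g" by metis
  obtain c where c: "\<And>i. c i \<in> K" "\<exists>i\<in>{..degree g}. c i \<noteq> 0"
    "\<And>j. j \<in> {..<degree g} \<Longrightarrow> (\<Sum>i\<le>degree g. coeff (r i) j * c i) = 0"
    using nontrivial_solution[OF K, of "{..<degree g}" "{..degree g}" "\<lambda>j i. coeff (r i) j"]
      poly_overD[OF qr(1)] by (simp del: atMost_iff lessThan_iff) blast
  define R where "R = (\<Sum>i\<le>degree g. monom (c i) i)"
  have cR: "coeff R i = (if i \<le> degree g then c i else 0)" for i
    unfolding R_def by (simp add: coeff_sum)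
  have R0: "R \<noteq> 0"
  proof
    assume "R = 0"
    then have "c i = 0" if "i \<le> degree g" for i using cR[of i] that by simp
    then show False using c(2) by auto
  qed
  have RK: "poly_over K R" unfolding poly_over_def cR using c(1) K by (auto simp: subfield_0)
  have zero: "(\<Sum>i\<le>degree g. smult (c i) (r i)) = 0"
  proof (rule poly_eqI)
    fix j
    show "coeff (\<Sum>i\<le>degree g. smult (c i) (r i)) j = coeff 0 j"
    proof (cases "j < degree g")
      case True
      then show ?thesis using c(3)[of j] by (simp add: coeff_sum mult.commute)
    next
      case False
      then have "coeff (r i) j = 0" for i using qr(3)[of i] by (auto intro: coeff_eq_0)
      then show ?thesis by (simp add: coeff_sum)
    qed
  qed
  have "pcompose R p = (\<Sum>i\<le>degree g. smult (c i) (p ^ i))"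
  proof -
    have "pcompose (monom b i) p = smult b (p ^ i)" for b i
      by (induction i) (simp_all add: monom_0 monom_Suc pcompose_pCons pcompose_const)
    then show ?thesis unfolding R_def by (simp add: pcompose_sum)
  qed
  also have "\<dots> = g * (\<Sum>i\<le>degree g. smult (c i) (q i)) + (\<Sum>i\<le>degree g. smult (c i) (r i))"
    unfolding sum_distrib_left sum.distrib[symmetric]
    by (intro sum.cong refl, subst qr(2)) (simp add: smult_add_right)
  finally have gR: "g dvd pcompose R p" using zero by simp
  \<comment> \<open>Substituting \<open>p\<close> for the variable turns this divisibility into one
    by \<open>p - [:\<alpha>:]\<close>. A common divisor of \<open>g\<close> and
    \<open>p - [:\<alpha>:]\<close> then divides the constant \<open>poly R \<alpha>\<close>, which
    is nonzero as \<alpha> is transcendental.\<close>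
  have "[:- \<alpha>, 1:] dvd R - [:poly R \<alpha>:]" by (simp add: poly_eq_0_iff_dvd[symmetric])
  then obtain w where w: "R - [:poly R \<alpha>:] = [:- \<alpha>, 1:] * w" by blast
  have "pcompose (R - [:poly R \<alpha>:]) p = (p - [:\<alpha>:]) * pcompose w p"
    unfolding w pcompose_mult by (simp add: pcompose_pCons)
  then have pR: "p - [:\<alpha>:] dvd pcompose R p - [:poly R \<alpha>:]"
    by (simp add: pcompose_diff pcompose_const)
  have Ra: "poly R \<alpha> \<noteq> 0" using \<alpha> R0 RK algebraic_over_def'[OF K] by blast
  show ?thesis unfolding separable_poly_def
  proof (rule coprimeI)
    fix h assume h: "h dvd p - [:\<alpha>:]" "h dvd pderiv (p - [:\<alpha>:])"
    then have "h dvd g" by (simp add: g_def pderiv_diff pderiv_pCons)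
    then have "h dvd pcompose R p - (pcompose R p - [:poly R \<alpha>:])"
      using h gR pR by (metis dvd_diff dvd_trans)
    then have "h dvd [:poly R \<alpha>:]" by simp
    then show "is_unit h" using Ra by (metis dvd_trans is_unit_const_poly_iff dvd_field_iff)
  qed
qed

section \<open>Roots of unity\<close>

lemma separable_poly_root_of_unity:
  assumes n: "of_nat n \<noteq> (0::'a::field)"
  shows "separable_poly (monom (1::'a) n - 1)"
  unfolding separable_poly_def
proof (rule coprimeI)
  have n0: "n > 0" using n by (cases n) auto
  fix h :: "'a poly" assume h: "h dvd monom 1 n - 1" "h dvd pderiv (monom 1 n - 1)"
  then have "h dvd monom (of_nat n) (n - 1)" by (simp add: pderiv_diff pderiv_monom)
  \<comment> \<open>Up to the unit \<open>n\<close>, the variable times the derivative is the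
    monomial of degree \<open>n\<close>, which differs from the polynomial itself by 1.\<close>
  then have "h dvd monom (of_nat n) (n - 1) * monom (inverse (of_nat n)) 1" by (rule dvd_mult2)
  then have "h dvd monom 1 n" using n n0 by (simp add: mult_monom)
  then have "h dvd monom 1 n - (monom 1 n - 1)" using h(1) by (rule dvd_diff)
  then show "is_unit h" by simp
qed

lemma power_gcd_eq_1:
  fixes x :: "'a::field"
  assumes "x ^ a = 1" "x ^ b = 1"
  shows "x ^ gcd a b = 1"
proof (cases "a = 0")
  case False
  then obtain u v where "a * u = b * v + gcd a b" using bezout_nat by blast
  then have "x ^ (a * u) = x ^ (b * v) * x ^ gcd a b" by (simp add: power_add)
  then show ?thesis using assms by (simp add: power_mult)
qed (use assms in simp)

text \<open>Induction on \<open>n\<close>, splitting off the full power \<open>q ^ e\<close> of a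
  prime. An element of exact order \<open>q ^ e\<close> exists because the roots of unity for
  exponent \<open>q ^ e\<close> outnumber those for \<open>q ^ (e - 1)\<close>. Its product with a
  primitive root for the coprime cofactor is primitive for \<open>n\<close>.\<close>

lemma exists_primitive_root:
  assumes card: "\<And>n. of_nat n \<noteq> (0::'a::field) \<Longrightarrow> card {x::'a. x ^ n = 1} = n"
    and "of_nat n \<noteq> (0::'a)"
  shows "\<exists>x::'a. x ^ n = 1 \<and> (\<forall>j. x ^ j = 1 \<longrightarrow> n dvd j)"
  using assms(2)
proof (induction n rule: less_induct)
  case (less n)
  have n0: "n \<noteq> 0" using less.prems by (auto intro!: Nat.gr0I)
  show ?case
  proof (cases "n = 1")
    case False
    then obtain q where q: "prime q" "q dvd n" using prime_factor_nat by blast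
    define e where "e = multiplicity q n"
    define m where "m = n div q ^ e"
    have nm: "n = q ^ e * m" unfolding m_def e_def by (simp add: multiplicity_dvd)
    have qm: "\<not> q dvd m" unfolding m_def e_def using multiplicity_decompose[of n q] n0 q(1)
      by (metis not_prime_unit)
    then have cop: "coprime (q ^ e) m" using q by (simp add: prime_imp_coprime)
    have e: "e > 0" unfolding e_def using q n0 by (simp add: prime_multiplicity_gt_zero_iff)
    have q1: "q > 1" using prime_gt_1_nat[OF q(1)] .
    have nz: "of_nat (q ^ e) \<noteq> (0::'a)" "of_nat m \<noteq> (0::'a)" "of_nat (q ^ (e - 1)) \<noteq> (0::'a)"
      using less.prems e unfolding nm by (auto simp: power_eq_if)
    have "1 < q ^ e" using q1 e by (rule one_less_power)
    then have "m < n" using nm n0 by simp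
    then obtain z :: 'a where z: "z ^ m = 1" "\<And>j. z ^ j = 1 \<Longrightarrow> m dvd j" using less.IH[of m] nz(2) by auto
    have "q ^ (e - 1) < q ^ e" using q1 e by simp
    then have lt: "card {x::'a. x ^ (q ^ (e - 1)) = 1} < card {x::'a. x ^ (q ^ e) = 1}"
      using card[OF nz(1)] card[OF nz(3)] by simp
    have "finite {x::'a. x ^ (q ^ (e - 1)) = 1}" using card[OF nz(3)] q1
      by (metis card.infinite less_nat_zero_code not_gr0 power_eq_0_iff)
    then have "\<not> {x::'a. x ^ (q ^ e) = 1} \<subseteq> {x. x ^ (q ^ (e - 1)) = 1}"
      using lt card_mono by (metis leD)
    then obtain x :: 'a where x: "x ^ (q ^ e) = 1" "x ^ (q ^ (e - 1)) \<noteq> 1" by blast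
    have xd: "q ^ e dvd j" if "x ^ j = 1" for j
    proof -
      obtain i where i: "gcd j (q ^ e) = q ^ i" "i \<le> e"
        using divides_primepow_nat[OF q(1)] by (metis gcd_dvd2)
      have "x ^ (q ^ i) = 1" using power_gcd_eq_1[OF that x(1)] i by simp
      then have "\<not> i \<le> e - 1" using x(2) by (metis le_imp_power_dvd dvdE power_mult power_one)
      then have "gcd j (q ^ e) = q ^ e" using i by (metis Suc_diff_1 e le_antisym not_less_eq_eq)
      then show ?thesis by (metis gcd_dvd1)
    qed
    have "n dvd j" if j: "(x * z) ^ j = 1" for j
    proof -
      have "x ^ (j * m) = (x * z) ^ (j * m)" by (simp add: power_mult_distrib mult.commute[of j m] power_mult[of z] z)
      then have "q ^ e dvd j * m" using j by (intro xd) (simp add: power_mult)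
      then have a: "q ^ e dvd j" using cop by (simp add: coprime_dvd_mult_left_iff)
      have "z ^ (j * q ^ e) = (x * z) ^ (j * q ^ e)" by (simp add: power_mult_distrib mult.commute[of j "q ^ e"] power_mult[of x] x)
      then have "m dvd j * q ^ e" using j by (intro z(2)) (simp add: power_mult)
      then have "m dvd j" using cop by (simp add: coprime_dvd_mult_left_iff coprime_commute)
      with a show ?thesis unfolding nm using cop by (simp add: divides_mult)
    qed
    moreover have "(x * z) ^ n = 1" unfolding nm
      by (simp add: power_mult_distrib power_mult[of x] x mult.commute[of _ m] power_mult[of z] z)
        (metis power_mult mult.commute x(1) power_one)
    ultimately show ?thesis by blast
  qed (intro exI[of _ 1], simp)
qed

lemma primitive_root_power_eqD:
  fixes z :: "'a::field"
  assumes z: "z \<noteq> 0" "\<And>j. z ^ j = 1 \<Longrightarrow> n dvd j" and "z ^ i = z ^ j"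
  shows "i mod n = j mod n"
proof -
  have *: "i mod n = j mod n" if "i \<le> j" "z ^ i = z ^ j" for i j
  proof -
    have "z ^ j = z ^ i * z ^ (j - i)" using that(1) by (simp flip: power_add)
    then have "z ^ i * z ^ (j - i) = z ^ i * 1" using that(2) by simp
    then have "z ^ (j - i) = 1" using z(1) by simp
    then have "n dvd j - i" by (rule z(2))
    then show ?thesis using that(1) by (metis mod_eq_dvd_iff_nat)
  qed
  show ?thesis using *[of i j] *[of j i] assms(3) by (metis nat_le_linear)
qed

section \<open>Separable closures of rational function fields\<close>

lemma field_adjoin_rational:
  assumes K: "is_subfield K" and "x \<in> field_adjoin K {t}"
  shows "\<exists>p q. poly_over K p \<and> poly_over K q \<and> poly q t \<noteq> 0 \<and> x = poly p t / poly q t"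
proof -
  let ?R = "{poly p t / poly q t | p q. poly_over K p \<and> poly_over K q \<and> poly q t \<noteq> 0}"
  have elem: "poly p t / poly q t \<in> ?R" if "poly_over K p" "poly_over K q" "poly q t \<noteq> 0" for p q
    using that by blast
  have zero: "0 \<in> ?R" using elem[of 0 1] by (simp add: poly_over_closed K)
  have "is_subfield ?R"
    unfolding is_subfield_def
  proof (intro conjI ballI)
    show "0 \<in> ?R" by (rule zero)
    show "1 \<in> ?R" using elem[of 1 1] by (simp add: poly_over_closed K)
  next
    fix x y assume "x \<in> ?R" "y \<in> ?R"
    then obtain p q p' q' where *: "x = poly p t / poly q t" "poly_over K p" "poly_over K q" "poly q t \<noteq> 0"
      "y = poly p' t / poly q' t" "poly_over K p'" "poly_over K q'" "poly q' t \<noteq> 0" by blast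
    show "x - y \<in> ?R"
      by (rule CollectI, rule exI[of _ "p * q' - p' * q"], rule exI[of _ "q * q'"])
        (use * in \<open>auto simp: diff_frac_eq intro!: poly_over_closed K\<close>)
    show "x * y \<in> ?R"
      by (rule CollectI, rule exI[of _ "p * p'"], rule exI[of _ "q * q'"])
        (use * in \<open>auto intro!: poly_over_closed K\<close>)
  next
    fix x assume "x \<in> ?R"
    then obtain p q where *: "x = poly p t / poly q t" "poly_over K p" "poly_over K q" "poly q t \<noteq> 0" by blast
    show "inverse x \<in> ?R"
    proof (cases "poly p t = 0")
      case True
      then show ?thesis using * zero by simp
    next
      case False
      have "inverse x = poly q t / poly p t" using * by simp
      then show ?thesis using * False by blast
    qed
  qed
  moreover have "K \<subseteq> ?R"
  proof
    fix a assume "a \<in> K" then show "a \<in> ?R"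
      using elem[of "[:a:]" 1] by (simp add: poly_over_closed K)
  qed
  moreover have "{t} \<subseteq> ?R"
  proof -
    have "poly_over K [:0, 1:]" by (intro poly_over_closed poly_over_pCons subfield_closed K)
    then show ?thesis using elem[of "[:0, 1:]" 1] by (simp add: poly_over_closed K)
  qed
  ultimately have "field_adjoin K {t} \<subseteq> ?R" by (rule field_adjoin_minimal)
  with assms(2) show ?thesis by blast
qed

locale rational_sep_closure =
  fixes K :: "'a::field set" and t :: 'a
  assumes K: "is_subfield K"
    and transc: "\<not> algebraic_over K t"
    and closure: "UNIV_sep_closure_of (field_adjoin K {t})"
begin

text \<open>Algebraic elements are easier to handle than separable ones. By
  \<open>sep_closure_eq\<close> the notions agree here, so \<open>k\<close> is the separable closure
  of \<open>K\<close>.\<close>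

abbreviation k where "k \<equiv> {x. algebraic_over K x}"

lemma k: "is_subfield k" by (rule subfield_algebraic[OF K])

lemma K_sub_k: "K \<subseteq> k" using algebraic_over_base[OF K] by auto

lemma transc_k: "\<not> algebraic_over k t" using algebraic_over_trans[OF K] transc by blast

lemma root_exists: "degree (p :: 'a poly) > 0 \<Longrightarrow> separable_poly p \<Longrightarrow> \<exists>x. poly p x = 0"
  using closure unfolding UNIV_sep_closure_of_def by blast

lemma splits_over_Kt: "splits_over (field_adjoin K {t}) x"
proof -
  obtain p where p: "is_min_poly (field_adjoin K {t}) x p" "separable_poly p"
    using closure unfolding UNIV_sep_closure_of_def separable_over_def by blast
  show ?thesis
    by (rule splits_over_separable[OF subfield_field_adjoin root_exists p(2)])
       (use p(1) in \<open>auto simp: is_min_poly_def poly_over_iff_coeffs subfield_0 subfield_field_adjoin\<close>)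
qed

text \<open>Regrouping a relation for \<open>x\<close> over \<open>K(t)\<close> by powers of \<open>t\<close> shows that the minimal polynomial of \<open>x\<close>
  over \<open>K\<close> divides the separable one over \<open>K(t)\<close>.\<close>

lemma algebraic_min_poly_separable:
  assumes x: "algebraic_over K x"
  obtains p where "p \<noteq> 0" "poly_over K p" "poly p x = 0" "separable_poly p"
    "\<And>r. poly_over K r \<Longrightarrow> poly r x = 0 \<Longrightarrow> \<exists>s. poly_over K s \<and> r = p * s"
proof -
  let ?E = "field_adjoin K {t}"
  obtain P where P: "poly_over ?E P" "poly P x = 0" "separable_poly P"
    using closure unfolding UNIV_sep_closure_of_def separable_over_def is_min_poly_def
    by (metis poly_over_iff_coeffs subfield_0 subfield_field_adjoin)
  obtain p where p: "p \<noteq> 0" "poly_over K p" "poly p x = 0"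
    "\<And>r. poly_over K r \<Longrightarrow> poly r x = 0 \<Longrightarrow> \<exists>s. poly_over K s \<and> r = p * s"
    using annihilator_generator[OF K x] by blast
  have "\<forall>i. \<exists>a b. poly_over K a \<and> poly_over K b \<and> poly b t \<noteq> 0 \<and> coeff P i = poly a t / poly b t"
    using field_adjoin_rational[OF K] poly_overD[OF P(1)] by blast
  then obtain a b where ab: "\<And>i. poly_over K (a i)" "\<And>i. poly_over K (b i)"
    "\<And>i. poly (b i) t \<noteq> 0" "\<And>i. coeff P i = poly (a i) t / poly (b i) t" by metis
  define n where "n = degree P"
  define c where "c = (\<Prod>i\<le>n. poly (b i) t)"
  define R where "R = (\<lambda>i. a i * (\<Prod>j\<in>{..n}-{i}. b j))"
  have c: "c \<noteq> 0" unfolding c_def using ab(3) by simp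
  have RK: "poly_over K (R i)" for i unfolding R_def by (intro poly_over_closed K ab)
  have cR: "c * coeff P i = poly (R i) t" if "i \<le> n" for i
    using that ab(3)[of i] unfolding c_def R_def
    by (subst prod.remove[of _ i]) (auto simp: ab(4) poly_prod)
  define N where "N = Max (degree ` R ` {..n})"
  have N: "degree (R i) \<le> N" if "i \<le> n" for i unfolding N_def using that by (intro Max_ge) auto
  \<comment> \<open>\<open>Q j\<close> collects the coefficients at \<open>t ^ j\<close> after
    clearing denominators. As \<open>t\<close> is transcendental even over \<open>k\<close>, which
    contains the values \<open>poly (Q j) x\<close>, each of these values vanishes for
    \<open>j \<le> N\<close>.\<close>
  define Q where "Q = (\<lambda>j. \<Sum>i\<le>n. monom (coeff (R i) j) i)"
  have QK: "poly_over K (Q j)" for j unfolding Q_def by (intro poly_over_closed K poly_overD RK)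
  have cP: "smult c P = (\<Sum>j\<le>N. smult (t ^ j) (Q j))"
  proof (rule poly_eqI)
    fix i
    show "coeff (smult c P) i = coeff (\<Sum>j\<le>N. smult (t ^ j) (Q j)) i"
    proof (cases "i \<le> n")
      case True
      have "coeff (\<Sum>j\<le>N. smult (t ^ j) (Q j)) i = (\<Sum>j\<le>N. coeff (R i) j * t ^ j)"
        using True by (simp add: coeff_sum Q_def mult.commute)
      also have "\<dots> = (\<Sum>j\<le>degree (R i). coeff (R i) j * t ^ j)"
        using N[OF True] by (intro sum.mono_neutral_right) (auto simp: coeff_eq_0)
      also have "\<dots> = poly (R i) t" by (simp add: poly_altdef)
      finally show ?thesis using cR[OF True] by simp
    next
      case False
      then show ?thesis by (simp add: coeff_sum Q_def n_def coeff_eq_0)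
    qed
  qed
  have "0 = poly (smult c P) x" using P(2) by simp
  also have "\<dots> = poly (\<Sum>j\<le>N. monom (poly (Q j) x) j) t"
    unfolding cP by (simp add: poly_sum poly_monom mult.commute)
  finally have "poly (\<Sum>j\<le>N. monom (poly (Q j) x) j) t = 0" by simp
  moreover have "poly_over k (\<Sum>j\<le>N. monom (poly (Q j) x) j)"
    using x by (intro poly_over_closed k poly_over_eval poly_over_mono[OF QK K_sub_k]) auto
  ultimately have z: "(\<Sum>j\<le>N. monom (poly (Q j) x) j) = 0"
    using transc_k algebraic_over_def'[OF k] by blast
  have Q0: "poly (Q j) x = 0" if "j \<le> N" for j
    using arg_cong[OF z, of "\<lambda>p. coeff p j"] that by (simp add: coeff_sum)
  have "p dvd Q j" if "j \<le> N" for j using p(4)[OF QK Q0[OF that]] by auto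
  then have "p dvd smult c P" unfolding cP by (intro dvd_sum) (simp add: dvd_smult)
  then have "p dvd P" using c by (simp add: dvd_smult_iff)
  then have "separable_poly p" using separable_poly_dvd P(3) by blast
  with that p show thesis by blast
qed

lemma algebraic_splits: "algebraic_over K x \<Longrightarrow> splits_over K x"
  using algebraic_min_poly_separable splits_over_separable[OF K root_exists] by metis

lemma sep_closure_eq: "sep_closure K = k"
proof (rule Set.set_eqI, rule iffI)
  fix x assume "x \<in> sep_closure K"
  then obtain p where "is_min_poly K x p" by (auto simp: sep_closure_def separable_over_def)
  then have "p \<noteq> 0" "set (coeffs p) \<subseteq> K" "poly p x = 0" by (auto simp: is_min_poly_def)
  then show "x \<in> k" by (auto simp: algebraic_over_def)
next
  fix x assume "x \<in> k"
  then obtain p where p: "p \<noteq> 0" "poly_over K p" "poly p x = 0" "separable_poly p"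
    "\<And>r. poly_over K r \<Longrightarrow> poly r x = 0 \<Longrightarrow> \<exists>s. poly_over K s \<and> r = p * s"
    using algebraic_min_poly_separable by blast
  define q where "q = smult (inverse (lead_coeff p)) p"
  have "separable_poly q" unfolding q_def using p by (intro separable_poly_smult) auto
  moreover have "is_min_poly K x q"
    unfolding is_min_poly_def
  proof (intro conjI allI impI)
    show "lead_coeff q = 1" "poly q x = 0" using p by (auto simp: q_def)
    show "set (coeffs q) \<subseteq> K" using p K
      by (auto simp: q_def poly_over_iff_coeffs subfield_0 intro!: poly_over_closed subfield_closed poly_overD)
    fix r assume r: "r \<noteq> 0 \<and> set (coeffs r) \<subseteq> K \<and> poly r x = 0"
    then obtain s where s: "r = p * s" using p(5)[of r] K by (auto simp: poly_over_iff_coeffs subfield_0)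
    then have "s \<noteq> 0" using r by auto
    then show "degree q \<le> degree r" using p(1) by (simp add: q_def s degree_mult_eq)
  qed
  ultimately show "x \<in> sep_closure K" by (auto simp: sep_closure_def separable_over_def)
qed

lemma card_roots_of_unity:
  assumes "of_nat n \<noteq> (0::'a)" shows "card {x::'a. x ^ n = 1} = n"
proof -
  have n0: "n > 0" using assms by (cases n) auto
  obtain S where S: "finite S" "monom 1 n - 1 = smult (lead_coeff (monom 1 n - 1)) (root_poly S :: 'a poly)"
    using separable_poly_split[OF root_exists separable_poly_root_of_unity[OF assms]] by blast
  let ?p = "monom 1 n - 1 :: 'a poly"
  have deg: "degree ?p = n"
  proof (rule antisym)
    show "degree ?p \<le> n" by (rule degree_diff_le) (auto simp: degree_monom_le)
    have "coeff ?p n \<noteq> 0" using n0 by simp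
    then show "n \<le> degree ?p" by (rule le_degree)
  qed
  then have nz: "lead_coeff ?p \<noteq> 0" using n0 by auto
  have "degree ?p = card S" using arg_cong[OF S(2), of degree] nz by (simp add: degree_root_poly)
  moreover have "{x. x ^ n = 1} = S"
  proof (rule Set.set_eqI)
    fix x
    have "x ^ n = 1 \<longleftrightarrow> poly ?p x = 0" by (simp add: poly_monom)
    also have "\<dots> \<longleftrightarrow> poly (root_poly S) x = 0" using nz by (subst S(2)) simp
    finally show "x \<in> {x. x ^ n = 1} \<longleftrightarrow> x \<in> S" using root_poly_eq_0_iff[OF S(1)] by simp
  qed
  ultimately show ?thesis using deg by simp
qed

lemma root_of_unity_algebraic: "x ^ n = 1 \<Longrightarrow> n > 0 \<Longrightarrow> algebraic_over K x"
  unfolding algebraic_over_def'[OF K]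
  by (intro exI[of _ "monom 1 n - 1"] conjI poly_over_closed K subfield_closed)
     (auto simp: poly_monom monom_eq_1_iff)

lemma primitive_root:
  assumes "of_nat n \<noteq> (0::'a)"
  obtains z :: 'a where "z ^ n = 1" "\<And>j. z ^ j = 1 \<Longrightarrow> n dvd j"
  using exists_primitive_root[OF card_roots_of_unity assms] by blast

lemma primitive_root_powers:
  assumes n: "of_nat n \<noteq> (0::'a)" and z: "z ^ n = (1::'a)" "\<And>j. z ^ j = 1 \<Longrightarrow> n dvd j" and x: "x ^ n = 1"
  shows "\<exists>j<n. x = z ^ j"
proof -
  have n0: "n > 0" using n by (cases n) auto
  have z0: "z \<noteq> 0" using z(1) n0 by (auto simp: power_0_left)
  have "inj_on (\<lambda>j. z ^ j) {..<n}"
  proof (rule inj_onI)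
    fix i j assume "i \<in> {..<n}" "j \<in> {..<n}" "z ^ i = z ^ j"
    then show "i = j" using primitive_root_power_eqD[OF z0 z(2), of i j] by simp
  qed
  then have "card ((\<lambda>j. z ^ j) ` {..<n}) = n" by (simp add: card_image)
  moreover have "(\<lambda>j. z ^ j) ` {..<n} \<subseteq> {x. x ^ n = 1}"
    using z(1) by (auto simp flip: power_mult simp: mult.commute[of _ n]) (simp add: power_mult)
  moreover have "finite {x::'a. x ^ n = 1}" using card_roots_of_unity[OF n] n0 by (intro card_ge_0_finite) simp
  ultimately have "(\<lambda>j. z ^ j) ` {..<n} = {x. x ^ n = 1}"
    using card_roots_of_unity[OF n] by (metis card_subset_eq)
  then show ?thesis using x by blast
qed

end

section \<open>The tree of iterated preimages\<close>

definition iterate_poly :: "'a::field poly \<Rightarrow> nat \<Rightarrow> 'a poly" where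
  "iterate_poly f n = (pcompose f ^^ n) [:0, 1:]"

lemma poly_iterate: "poly (iterate_poly f n) x = (poly f ^^ n) x"
  by (induction n) (simp_all add: iterate_poly_def poly_pcompose)

lemma degree_iterate: "degree (iterate_poly f n) = degree f ^ n"
  by (induction n) (simp_all add: iterate_poly_def degree_pcompose)

lemma poly_over_iterate: "is_subfield K \<Longrightarrow> poly_over K f \<Longrightarrow> poly_over K (iterate_poly f n)"
  by (induction n)
     (auto simp: iterate_poly_def intro!: poly_over_closed poly_over_pCons subfield_closed)

locale arboreal = rational_sep_closure K t for K :: "'a::field set" and t :: 'a +
  fixes f :: "'a poly"
  assumes f: "poly_over K f" and degree_f: "degree f \<ge> 2"
    and tame: "of_nat (degree f) \<noteq> (0::'a)"
begin

abbreviation "d \<equiv> degree f"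
abbreviation "F n \<equiv> iterate_poly f n"
abbreviation "c n \<equiv> lead_coeff (F n)"
abbreviation "lv n \<equiv> level f t n"

lemma FK: "poly_over K (F n)" by (rule poly_over_iterate[OF K f])

lemma c_K: "c n \<in> K" by (rule poly_overD[OF FK])

lemma tame_power: "of_nat (d ^ n) \<noteq> (0::'a)" using tame by simp

lemma d_power_pos: "d ^ n > 0" using degree_f by simp

lemma F_nonzero: "F n \<noteq> 0" using degree_iterate[of f n] degree_f
  by (metis degree_0 less_not_refl d_power_pos)

lemma c_nonzero: "c n \<noteq> 0" using F_nonzero by simp

lemma mem_level: "x \<in> lv n \<longleftrightarrow> poly (F n) x = t"
  by (simp add: level_def poly_iterate)

lemma level_0: "lv 0 = {t}"
  by (auto simp: mem_level iterate_poly_def)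

lemma level_Suc: "x \<in> lv (Suc n) \<longleftrightarrow> poly f x \<in> lv n"
  by (simp add: level_def funpow_swap1)

text \<open>Otherwise \<open>t\<close>, a polynomial value at \<open>y\<close> over
  \<open>K\<close>, would be algebraic. Transcendence allows the splitting of preimages to be
  applied to every vertex and makes \<open>k(y)\<close> a rational function field.\<close>

lemma level_transcendental: "y \<in> lv n \<Longrightarrow> \<not> algebraic_over K y"
  using poly_over_eval[OF k poly_over_mono[OF FK K_sub_k], of y n] transc by (auto simp: mem_level)

lemma preimage_split:
  assumes "\<not> algebraic_over K y"
  shows "\<exists>S. finite S \<and> card S = degree (F n) \<and> F n - [:y:] = smult (c n) (root_poly S)"
proof -
  have nz: "of_nat (degree (F n)) \<noteq> (0::'a)" by (simp add: degree_iterate tame)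
  obtain S where S: "finite S" "F n - [:y:] = smult (lead_coeff (F n - [:y:])) (root_poly S)"
    using separable_poly_split[OF root_exists separable_poly_transcendental[OF K FK nz assms]] by blast
  have pos: "degree (F n) > 0" using d_power_pos by (simp add: degree_iterate)
  have "degree (F n - [:y:]) = degree (F n)"
    using pos by (metis degree_pCons_0 degree_add_eq_left diff_conv_add_uminus minus_pCons neg_equal_0_iff_equal)
  moreover from this have "lead_coeff (F n - [:y:]) = c n"
    using pos by (cases "degree (F n)") auto
  ultimately show ?thesis using S c_nonzero[of n] arg_cong[OF S(2), of degree]
    by (auto simp: degree_root_poly)
qed

lemma level_split: "finite (lv n)" "card (lv n) = d ^ n" "F n - [:t:] = smult (c n) (root_poly (lv n))"
proof -
  obtain S where S: "finite S" "card S = degree (F n)" "F n - [:t:] = smult (c n) (root_poly S)"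
    using preimage_split[OF transc] by blast
  have "S = lv n"
  proof (rule Set.set_eqI)
    fix x
    have "x \<in> lv n \<longleftrightarrow> poly (F n - [:t:]) x = 0" by (simp add: mem_level)
    then show "x \<in> S \<longleftrightarrow> x \<in> lv n" using c_nonzero root_poly_eq_0_iff[OF S(1)] by (simp add: S(3))
  qed
  then show "finite (lv n)" "card (lv n) = d ^ n" "F n - [:t:] = smult (c n) (root_poly (lv n))"
    using S by (auto simp: degree_iterate)
qed

lemma preimage_exists: "\<not> algebraic_over K y \<Longrightarrow> \<exists>x. (poly f ^^ n) x = y"
proof -
  assume y: "\<not> algebraic_over K y"
  obtain S where S: "finite S" "card S = degree (F n)" "F n - [:y:] = smult (c n) (root_poly S)"
    using preimage_split[OF y] by blast
  then obtain x where "x \<in> S" using d_power_pos by (metis card.empty degree_iterate equals0I less_irrefl)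
  then have "poly (F n - [:y:]) x = 0" using S by (simp add: root_poly_eq_0_iff)
  then show ?thesis by (auto simp: poly_iterate)
qed

definition branch :: "(nat \<Rightarrow> 'a) \<Rightarrow> bool" where
  "branch x \<longleftrightarrow> x 0 = t \<and> (\<forall>n. poly f (x (Suc n)) = x n)"

lemma branch_level: "branch x \<Longrightarrow> x n \<in> lv n"
  by (induction n) (auto simp: branch_def level_0 level_Suc)

lemma branch_F: "branch x \<Longrightarrow> poly (F m) (x (m + n)) = x n"
  by (induction m) (simp_all add: branch_def poly_iterate funpow_swap1)

lemma branch_exists:
  assumes y: "y \<in> lv n"
  obtains x where "branch x" "x n = y"
proof -
  define up where "up = (\<lambda>y. SOME z. poly f z = y)"
  have up: "poly f (up y) = y" if "\<not> algebraic_over K y" for y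
    unfolding up_def using preimage_exists[OF that, of 1] someI_ex[of "\<lambda>z. poly f z = y"] by simp
  have upl: "(up ^^ i) y \<in> lv (n + i)" for i
  proof (induction i)
    case (Suc i)
    then show ?case using up[OF level_transcendental[OF Suc]] by (simp add: level_Suc)
  qed (use y in simp)
  have downl: "(poly f ^^ i) y \<in> lv (n - i)" if "i \<le> n" for i
    using that
  proof (induction i)
    case (Suc i)
    then have "n - i = Suc (n - Suc i)" by simp
    then show ?case using Suc level_Suc by simp
  qed (use y in simp)
  \<comment> \<open>Up to level \<open>n\<close> the branch is forced, namely the images of
    \<open>y\<close> under iterates of \<open>f\<close>; beyond it, preimages are chosen.\<close>
  define x where "x = (\<lambda>i. if i \<le> n then (poly f ^^ (n - i)) y else (up ^^ (i - n)) y)"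
  have "branch x"
    unfolding branch_def
  proof (intro conjI allI)
    show "x 0 = t" using downl[of n] by (simp add: x_def level_0)
    show "poly f (x (Suc i)) = x i" for i
    proof (cases "Suc i \<le> n")
      case True
      then have "n - i = Suc (n - Suc i)" by simp
      then show ?thesis using True by (simp add: x_def)
    next
      case False
      then have e: "Suc i - n = Suc (i - n)" by simp
      have "poly f (x (Suc i)) = (up ^^ (i - n)) y"
        using False level_transcendental[OF upl] by (simp add: x_def e up)
      also have "\<dots> = x i" using False by (cases "i = n") (auto simp: x_def)
      finally show ?thesis .
    qed
  qed
  moreover have "x n = y" by (simp add: x_def)
  ultimately show thesis by (rule that)
qed

text \<open>Every vertex has descendants on all deeper levels and is a polynomial expression over
  \<open>K\<close> in each of them.\<close>

lemma level_subset_adjoin: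
  assumes "K \<subseteq> L" "n \<le> m"
  shows "lv n \<subseteq> field_adjoin L (lv m)"
proof
  fix y assume y: "y \<in> lv n"
  obtain x where x: "branch x" "x n = y" using branch_exists[OF y] .
  have "poly (F (m - n)) (x m) \<in> field_adjoin L (lv m)"
    using field_adjoin_base[of L "lv m"] field_adjoin_gen[of "lv m" L] branch_level[OF x(1)] assms(1)
    by (intro poly_over_eval subfield_field_adjoin poly_over_mono[OF FK]) auto
  then show "y \<in> field_adjoin L (lv m)" using branch_F[OF x(1), of "m - n" n] assms(2) x(2) by simp
qed

lemma adjoin_level_mono: "K \<subseteq> L \<Longrightarrow> n \<le> m \<Longrightarrow> field_adjoin L (lv n) \<subseteq> field_adjoin L (lv m)"
  by (intro field_adjoin_minimal subfield_field_adjoin field_adjoin_base level_subset_adjoin)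

lemma preimage_field_subfield:
  assumes "K \<subseteq> L" shows "is_subfield (preimage_field L f t l)"
proof (cases l)
  case infinity
  let ?A = "\<lambda>n. field_adjoin L (lv n)"
  have sub: "is_subfield (?A n)" for n by (rule subfield_field_adjoin)
  have two: "\<exists>n. x \<in> ?A n \<and> y \<in> ?A n" if "x \<in> (\<Union>n. ?A n)" "y \<in> (\<Union>n. ?A n)" for x y
  proof -
    from that obtain i j where "x \<in> ?A i" "y \<in> ?A j" by blast
    then have "x \<in> ?A (max i j)" "y \<in> ?A (max i j)"
      using adjoin_level_mono[OF assms, of i "max i j"] adjoin_level_mono[OF assms, of j "max i j"] by auto
    then show ?thesis by blast
  qed
  have "is_subfield (\<Union>n. ?A n)" unfolding is_subfield_def
  proof (intro conjI ballI)
    fix x y assume xy: "x \<in> (\<Union>n. ?A n)" "y \<in> (\<Union>n. ?A n)"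
    obtain n where "x \<in> ?A n" "y \<in> ?A n" using two[OF xy] by blast
    then have "x - y \<in> ?A n" "x * y \<in> ?A n"
      by (auto intro: subfield_diff[OF sub] subfield_mult[OF sub])
    then show "x - y \<in> (\<Union>n. ?A n)" "x * y \<in> (\<Union>n. ?A n)" by blast+
  next
    show "0 \<in> (\<Union>n. ?A n)" "1 \<in> (\<Union>n. ?A n)" using subfield_0[OF sub] subfield_1[OF sub] by blast+
    fix x assume "x \<in> (\<Union>n. ?A n)"
    then obtain n where "x \<in> ?A n" by blast
    then have "inverse x \<in> ?A n" by (rule subfield_inverse[OF sub])
    then show "inverse x \<in> (\<Union>n. ?A n)" by blast
  qed
  then show ?thesis using infinity by (simp add: preimage_field_def)
qed (simp add: preimage_field_def subfield_field_adjoin)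

lemma preimage_field_base: "L \<subseteq> preimage_field L f t l"
  using field_adjoin_base by (cases l) (fastforce simp: preimage_field_def)+

lemma preimage_field_levels: "K \<subseteq> L \<Longrightarrow> levels_upto f t l \<subseteq> preimage_field L f t l"
proof
  fix y assume L: "K \<subseteq> L" and "y \<in> levels_upto f t l"
  then obtain n where n: "enat n \<le> l" "y \<in> lv n" by (auto simp: levels_upto_def)
  show "y \<in> preimage_field L f t l"
  proof (cases l)
    case (enat m)
    then show ?thesis using level_subset_adjoin[OF L, of n m] n by (auto simp: preimage_field_def)
  next
    case infinity
    have "y \<in> field_adjoin L (lv n)" using field_adjoin_gen n(2) by blast
    then show ?thesis using infinity by (auto simp: preimage_field_def)
  qed
qed

lemma preimage_field_minimal:
  assumes "is_subfield E" "L \<subseteq> E" "levels_upto f t l \<subseteq> E"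
  shows "preimage_field L f t l \<subseteq> E"
proof -
  have *: "field_adjoin L (lv n) \<subseteq> E" if "enat n \<le> l" for n
    using that assms by (intro field_adjoin_minimal) (auto simp: levels_upto_def)
  show ?thesis
  proof (cases l)
    case (enat m)
    then show ?thesis using *[of m] by (simp add: preimage_field_def)
  next
    case infinity
    then show ?thesis using * by (auto simp: preimage_field_def)
  qed
qed

lemma level_tree: "lv n \<subseteq> tree f t" by (auto simp: levels_upto_def)

lemma treeE: "y \<in> tree f t \<Longrightarrow> (\<And>n. y \<in> lv n \<Longrightarrow> P) \<Longrightarrow> P"
  by (auto simp: levels_upto_def)

section \<open>The field generated by all levels over \<open>k\<close>, and the roots of unity of
  order dividing \<open>d ^ n\<close>\<close>

definition M where "M = preimage_field k f t \<infinity>"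

lemma M: "is_subfield M" unfolding M_def by (rule preimage_field_subfield[OF K_sub_k])

lemma k_sub_M: "k \<subseteq> M" unfolding M_def by (rule preimage_field_base)

lemma level_sub_M: "lv n \<subseteq> M"
  unfolding M_def using preimage_field_levels[OF K_sub_k, of \<infinity>] level_tree by blast

lemma t_M: "t \<in> M" using level_sub_M[of 0] by (simp add: level_0)

abbreviation "E \<equiv> field_adjoin k {t}"

lemma E_sub_M: "E \<subseteq> M" by (rule field_adjoin_minimal[OF M k_sub_M]) (simp add: t_M)

lemma level_nonzero: "y \<in> lv n \<Longrightarrow> y \<noteq> 0"
  using level_transcendental algebraic_over_base[OF K subfield_0[OF K]] by blast

definition \<mu> :: "nat \<Rightarrow> 'a set" where "\<mu> n = {z. z ^ (d ^ n) = 1}"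

lemma \<mu>_k: "z \<in> \<mu> n \<Longrightarrow> algebraic_over K z"
  unfolding \<mu>_def using root_of_unity_algebraic d_power_pos by blast

lemma \<mu>_nonzero: "z \<in> \<mu> n \<Longrightarrow> z \<noteq> 0"
  unfolding \<mu>_def using d_power_pos[of n] by (auto simp: power_0_left)

lemma card_\<mu>: "finite (\<mu> n)" "card (\<mu> n) = d ^ n"
  using card_roots_of_unity[OF tame_power[of n]] d_power_pos[of n]
  by (auto simp: \<mu>_def intro: card_ge_0_finite)

text \<open>As polynomials in \<open>x\<close> both sides are monic of degree \<open>d ^ n\<close>
  and vanish on \<open>\<mu> n\<close>. Their difference has smaller degree and \<open>d ^ n\<close>
  roots.\<close>

lemma prod_\<mu>: "(\<Prod>z\<in>\<mu> n. x - z) = x ^ (d ^ n) - 1"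
proof -
  let ?p = "monom 1 (d ^ n) - 1 - root_poly (\<mu> n)"
  have "?p = 0"
  proof (rule ccontr)
    assume nz: "?p \<noteq> 0"
    have "\<mu> n \<subseteq> {x. poly ?p x = 0}"
      using root_poly_eq_0_iff[OF card_\<mu>(1)[of n]] by (auto simp: poly_monom \<mu>_def)
    then have "d ^ n \<le> card {x. poly ?p x = 0}"
      using card_mono[OF poly_roots_finite[OF nz]] card_\<mu>(2) by metis
    also have "\<dots> \<le> degree ?p" by (rule card_poly_roots_bound[OF nz])
    finally have le: "d ^ n \<le> degree ?p" .
    have "coeff ?p (d ^ n) = 0"
      using lead_coeff_root_poly[of "\<mu> n"] degree_root_poly[of "\<mu> n"] card_\<mu>(2)[of n] d_power_pos[of n] by simp
    moreover have "degree ?p \<le> d ^ n"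
      by (intro degree_diff_le) (auto simp: degree_monom_le degree_root_poly card_\<mu>)
    ultimately show False using le nz by (metis leading_coeff_0_iff le_antisym)
  qed
  from arg_cong[OF this, of "\<lambda>p. poly p x"] show ?thesis by (simp add: poly_monom poly_root_poly)
qed

end

section \<open>Places over infinity\<close>

locale place_at_infinity = arboreal K t f for K :: "'a::field set" and t f +
  fixes V :: "'a set"
  assumes V: "valuation_ring_of M V" and V_E: "V \<inter> E = infinity_ring k t"
begin

lemma V_sub_M: "V \<subseteq> M" and V_1: "1 \<in> V"
  and V_diff: "x \<in> V \<Longrightarrow> y \<in> V \<Longrightarrow> x - y \<in> V"
  and V_mult: "x \<in> V \<Longrightarrow> y \<in> V \<Longrightarrow> x * y \<in> V"
  and V_total: "x \<in> M \<Longrightarrow> x \<in> V \<or> inverse x \<in> V"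
  using V by (auto simp: valuation_ring_of_def)

lemma V_0: "0 \<in> V" using V_diff[OF V_1 V_1] by simp

lemma V_uminus: "x \<in> V \<Longrightarrow> - x \<in> V" using V_diff[OF V_0, of x] by simp

lemma V_add: "x \<in> V \<Longrightarrow> y \<in> V \<Longrightarrow> x + y \<in> V" using V_diff[OF _ V_uminus, of x y] by simp

lemma V_power: "x \<in> V \<Longrightarrow> x ^ n \<in> V" by (induction n) (auto intro: V_1 V_mult)

lemma V_prod: "(\<And>i. i \<in> I \<Longrightarrow> h i \<in> V) \<Longrightarrow> prod h I \<in> V"
  by (induction I rule: infinite_finite_induct) (auto intro: V_1 V_mult)

lemma k_sub_V: "k \<subseteq> V"
proof
  fix a assume a: "a \<in> k"
  have "a = poly [:a:] t / poly 1 t" by simp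
  moreover have "set (coeffs [:a:]) \<subseteq> k" "set (coeffs (1 :: 'a poly)) \<subseteq> k"
    using poly_over_iff_coeffs[OF subfield_0[OF k]] poly_over_const[OF k a] poly_over_1[OF k] by blast+
  ultimately have "a \<in> infinity_ring k t"
    unfolding infinity_ring_def by (intro CollectI exI[of _ "[:a:]"] exI[of _ "1"]) auto
  then show "a \<in> V" using V_E by blast
qed

lemma t_notin_V: "t \<notin> V"
proof
  assume "t \<in> V"
  then have "t \<in> infinity_ring k t" using V_E field_adjoin_gen[of "{t}" k] by auto
  then obtain p q where pq: "t = poly p t / poly q t" "poly_over k p" "poly_over k q" "q \<noteq> 0" "degree p \<le> degree q"
    unfolding infinity_ring_def by (auto simp: poly_over_iff_coeffs[OF subfield_0[OF k]])
  have t0: "t \<noteq> 0" using level_nonzero[of t 0] by (simp add: level_0)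
  then have "poly q t \<noteq> 0" using pq(1) by auto
  then have "poly (pCons 0 q - p) t = 0" using pq(1) by (simp add: field_simps)
  moreover have "pCons 0 q - p \<noteq> 0"
  proof
    assume "pCons 0 q - p = 0"
    then have "degree p = Suc (degree q)" using pq(4) by (metis degree_pCons_eq eq_iff_diff_eq_0)
    then show False using pq(5) by simp
  qed
  moreover have "poly_over k (pCons 0 q - p)"
    using pq by (intro poly_over_closed poly_over_pCons k subfield_0)
  ultimately show False using transc_k algebraic_over_def'[OF k] by blast
qed

definition \<mm> where "\<mm> = valuation_ideal V"

lemma mem_\<mm>: "x \<in> \<mm> \<longleftrightarrow> x \<in> V \<and> (x = 0 \<or> inverse x \<notin> V)"
  by (simp add: \<mm>_def valuation_ideal_def)

lemma \<mm>_V: "x \<in> \<mm> \<Longrightarrow> x \<in> V" by (simp add: mem_\<mm>)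

lemma one_notin_\<mm>: "1 \<notin> \<mm>" by (simp add: mem_\<mm> V_1)

lemma \<mm>_unit: "x \<in> V \<Longrightarrow> x \<notin> \<mm> \<Longrightarrow> inverse x \<in> V" by (auto simp: mem_\<mm>)

lemma inverse_\<mm>: "x \<in> M \<Longrightarrow> x \<notin> V \<Longrightarrow> inverse x \<in> \<mm>"
  using V_total[of x] by (auto simp: mem_\<mm> V_0)

lemma \<mm>_mult: assumes "v \<in> V" "x \<in> \<mm>" shows "v * x \<in> \<mm>"
proof (cases "v * x = 0")
  case False
  then have "inverse x = v * inverse (v * x)" by (simp add: field_simps)
  moreover have "inverse x \<notin> V" using assms(2) False by (simp add: mem_\<mm>)
  ultimately have "inverse (v * x) \<notin> V" using V_mult[OF assms(1)] by metis
  then show ?thesis using assms V_mult by (simp add: mem_\<mm>)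
qed (auto simp: mem_\<mm> V_0)

lemma \<mm>_diff: assumes "x \<in> \<mm>" "y \<in> \<mm>" shows "x - y \<in> \<mm>"
proof (cases "y = 0")
  case False
  have xM: "x \<in> M" "y \<in> M" using assms \<mm>_V V_sub_M by auto
  show ?thesis
  proof (cases "x / y \<in> V")
    case True
    have "x - y = (x / y - 1) * y" using False by (simp add: field_simps)
    then show ?thesis using \<mm>_mult[OF V_diff[OF True V_1] assms(2)] by simp
  next
    case False
    have "x / y \<in> M" using xM M subfield_divide by blast
    then have yx: "y / x \<in> V" using V_total[of "x / y"] False by simp
    then have "x \<noteq> 0" using False V_0 by auto
    then have "x - y = (1 - y / x) * x" by (simp add: field_simps)
    then show ?thesis using \<mm>_mult[OF V_diff[OF V_1 yx] assms(1)] by simp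
  qed
qed (use assms in simp)

lemma k_\<mm>: "x \<in> k \<Longrightarrow> x \<in> \<mm> \<Longrightarrow> x = 0"
  using subfield_inverse[OF k] k_sub_V unfolding mem_\<mm> by blast

lemma \<mm>_prime: assumes "x \<in> V" "y \<in> V" "x * y \<in> \<mm>" shows "x \<in> \<mm> \<or> y \<in> \<mm>"
proof (rule ccontr)
  assume "\<not> ?thesis"
  then have u: "inverse x \<in> V" "inverse y \<in> V" "x \<noteq> 0" "y \<noteq> 0" using assms \<mm>_unit by (auto simp: mem_\<mm>)
  then have "(inverse x * inverse y) * (x * y) \<in> \<mm>" by (intro \<mm>_mult V_mult assms)
  moreover have "(inverse x * inverse y) * (x * y) = 1" using u by (simp add: field_simps)
  ultimately show False using one_notin_\<mm> by simp
qed

lemma \<mm>_prime_prod: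
  "finite I \<Longrightarrow> (\<And>i. i \<in> I \<Longrightarrow> h i \<in> V) \<Longrightarrow> prod h I \<in> \<mm> \<Longrightarrow> \<exists>i\<in>I. h i \<in> \<mm>"
proof (induction I rule: finite_induct)
  case (insert i I)
  then show ?case using \<mm>_prime[of "h i" "prod h I"] V_prod[of I h] by auto
qed (simp add: one_notin_\<mm>)

lemma level_notin_V: assumes "y \<in> lv n" shows "y \<notin> V"
proof
  assume y: "y \<in> V"
  have "poly p y \<in> V" if "poly_over k p" for p
    using that
  proof (induction p)
    case (pCons a p)
    then show ?case using y k_sub_V by (auto simp: poly_over_pCons_iff intro!: V_add V_mult)
  qed (simp add: V_0)
  from this[OF poly_over_mono[OF FK K_sub_k], of n] show False
    using assms t_notin_V by (simp add: mem_level)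
qed

lemma inverse_level: "y \<in> lv n \<Longrightarrow> inverse y \<in> \<mm>"
  using inverse_\<mm> level_notin_V level_sub_M by blast

text \<open>Congruences are needed modulo two kinds of ideals: the maximal ideal, for residues, and
  \<open>{a. w * a \<in> V}\<close>, that is \<open>V / w\<close>, for the precision of the Newton
  iteration. One predicate covers both.\<close>

definition v_ideal :: "'a set \<Rightarrow> bool" where
  "v_ideal J \<longleftrightarrow> J \<subseteq> V \<and> (\<forall>a\<in>J. \<forall>b\<in>J. a - b \<in> J) \<and> (\<forall>v\<in>V. \<forall>a\<in>J. v * a \<in> J) \<and> 0 \<in> J"

lemma v_idealD:
  assumes "v_ideal J"
  shows "a \<in> J \<Longrightarrow> a \<in> V" "a \<in> J \<Longrightarrow> b \<in> J \<Longrightarrow> a - b \<in> J" "v \<in> V \<Longrightarrow> a \<in> J \<Longrightarrow> v * a \<in> J" "0 \<in> J"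
    "a \<in> J \<Longrightarrow> b \<in> J \<Longrightarrow> a + b \<in> J"
proof -
  show *: "a \<in> J \<Longrightarrow> a \<in> V" "a \<in> J \<Longrightarrow> b \<in> J \<Longrightarrow> a - b \<in> J" "v \<in> V \<Longrightarrow> a \<in> J \<Longrightarrow> v * a \<in> J" "0 \<in> J" for a b v
    using assms by (auto simp: v_ideal_def)
  show "a \<in> J \<Longrightarrow> b \<in> J \<Longrightarrow> a + b \<in> J" using *(2)[of a "- b"] *(3)[of "-1" b] V_uminus[OF V_1] by simp
qed

lemma v_ideal_\<mm>: "v_ideal \<mm>"
  by (auto simp: v_ideal_def \<mm>_V \<mm>_diff \<mm>_mult) (simp add: mem_\<mm> V_0)

lemma v_ideal_inverse: assumes "inverse w \<in> V" "w \<noteq> 0" shows "v_ideal {a. w * a \<in> V}"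
proof -
  have A: "a \<in> V" if "w * a \<in> V" for a
    using V_mult[OF assms(1) that] assms(2) by (simp flip: mult.assoc)
  have B: "w * (v * a) \<in> V" if "v \<in> V" "w * a \<in> V" for v a
    using V_mult[OF that] by (simp add: mult.left_commute)
  have C: "w * (a - b) \<in> V" if "w * a \<in> V" "w * b \<in> V" for a b
    using V_diff[OF that] by (simp add: right_diff_distrib)
  show ?thesis
    unfolding v_ideal_def
    by (intro conjI ballI subsetI CollectI) (erule CollectE, erule A, (erule CollectE)+, erule C, assumption,
      erule CollectE, erule B, assumption, simp add: V_0)
qed

lemma v_ideal_sum: "v_ideal J \<Longrightarrow> (\<And>i. i \<in> I \<Longrightarrow> h i \<in> J) \<Longrightarrow> sum h I \<in> J"
  by (induction I rule: infinite_finite_induct) (auto intro: v_idealD)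

lemma cong_mult:
  assumes "v_ideal J" "a - a' \<in> J" "b - b' \<in> J" "a \<in> V" "b' \<in> V"
  shows "a * b - a' * b' \<in> J"
proof -
  have "a * b - a' * b' = a * (b - b') + b' * (a - a')" by (simp add: algebra_simps)
  then show ?thesis using assms by (auto intro!: v_idealD(5)[OF assms(1)] v_idealD(3)[OF assms(1)])
qed

lemma cong_prod:
  assumes "v_ideal J" "\<And>i. i \<in> I \<Longrightarrow> h i - h' i \<in> J \<and> h i \<in> V \<and> h' i \<in> V"
  shows "prod h I - prod h' I \<in> J"
  using assms(2)
  by (induction I rule: infinite_finite_induct) (auto intro!: cong_mult V_prod simp: v_idealD(4) assms(1))

lemma cong_power: "v_ideal J \<Longrightarrow> a - b \<in> J \<Longrightarrow> a \<in> V \<Longrightarrow> b \<in> V \<Longrightarrow> a ^ n - b ^ n \<in> J"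
  using cong_prod[of J "{..<n}" "\<lambda>_. a" "\<lambda>_. b"] by simp

text \<open>At a pole a polynomial is dominated by its leading term: all other terms carry a factor
  \<open>inverse y\<close>. A bound \<open>e\<close> above the degree is allowed, the coefficient
  then being 0.\<close>

lemma lead_term:
  assumes J: "v_ideal J" and y: "inverse y \<in> J" "y \<noteq> 0" and p: "poly_over k p" "degree p \<le> e"
  shows "poly p y / y ^ e - coeff p e \<in> J"
proof -
  have "poly p y = (\<Sum>i\<le>e. coeff p i * y ^ i)"
    unfolding poly_altdef using p(2) by (intro sum.mono_neutral_left) (auto simp: coeff_eq_0)
  then have "poly p y / y ^ e - coeff p e = (\<Sum>i<e. coeff p i * (y ^ i / y ^ e))"
    using y(2) by (simp add: add_divide_distrib sum_divide_distrib flip: lessThan_Suc_atMost)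
  also have "\<dots> = (\<Sum>i<e. (coeff p i * inverse y ^ (e - i - 1)) * inverse y)"
  proof (intro sum.cong refl)
    fix i assume "i \<in> {..<e}"
    then have i: "y ^ e = y ^ i * y ^ (e - i - 1) * y" by (simp flip: power_add power_Suc2)
    show "coeff p i * (y ^ i / y ^ e) = coeff p i * inverse y ^ (e - i - 1) * inverse y"
      using y(2) unfolding i by (simp add: divide_simps)
  qed
  also have "\<dots> \<in> J"
    using y v_idealD(1)[OF J y(1)] poly_overD[OF p(1)] k_sub_V
    by (intro v_ideal_sum[OF J] v_idealD(3)[OF J] V_mult V_power) auto
  finally show ?thesis .
qed

lemma lead_unit:
  assumes y: "y \<in> lv n" and p: "poly_over k p" "p \<noteq> 0"
  shows "poly p y / y ^ degree p \<in> V" "poly p y / y ^ degree p \<notin> \<mm>"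
proof -
  have "poly p y / y ^ degree p - lead_coeff p \<in> \<mm>"
    by (rule lead_term[OF v_ideal_\<mm> inverse_level[OF y] level_nonzero[OF y] p(1) order_refl])
  moreover have lk: "lead_coeff p \<in> k" by (rule poly_overD[OF p(1)])
  moreover have "lead_coeff p \<notin> \<mm>" using k_\<mm>[OF lk] p(2) by auto
  ultimately show "poly p y / y ^ degree p \<in> V" "poly p y / y ^ degree p \<notin> \<mm>"
    using \<mm>_V V_add[of "poly p y / y ^ degree p - lead_coeff p" "lead_coeff p"] k_sub_V
      \<mm>_diff[of "poly p y / y ^ degree p" "poly p y / y ^ degree p - lead_coeff p"] by auto
qed

lemma poly_level_nonzero: "y \<in> lv n \<Longrightarrow> poly_over k p \<Longrightarrow> p \<noteq> 0 \<Longrightarrow> poly p y \<noteq> 0"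
  using lead_unit(2)[of y n p] by (auto simp: mem_\<mm> V_0)

text \<open>The quotient is a unit of \<open>V\<close> times \<open>inverse y\<close> to the power
  \<open>degree q - degree p\<close>, and \<open>inverse y\<close> lies in \<open>\<mm>\<close>. So
  \<open>V\<close> induces on \<open>k(y)\<close> the place at infinity.\<close>

lemma rational_V_iff:
  assumes y: "y \<in> lv n" and p: "poly_over k p" "p \<noteq> 0" and q: "poly_over k q" "q \<noteq> 0"
  shows "poly p y / poly q y \<in> V \<longleftrightarrow> degree p \<le> degree q"
    "poly p y / poly q y \<in> \<mm> \<longleftrightarrow> degree p < degree q"
proof -
  define a where "a = poly p y / y ^ degree p"
  define b where "b = poly q y / y ^ degree q"
  have y0: "y \<noteq> 0" using level_nonzero[OF y] .
  have a1: "a \<in> V" "a \<notin> \<mm>" "a \<noteq> 0" and b1: "b \<in> V" "b \<notin> \<mm>" "b \<noteq> 0"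
    using lead_unit[OF y p] lead_unit[OF y q]
      poly_level_nonzero[OF y p] poly_level_nonzero[OF y q] y0 by (auto simp: a_def b_def)
  note a = a1(1,2) \<mm>_unit[OF a1(1,2)] a1(3) and b = b1(1,2) \<mm>_unit[OF b1(1,2)] b1(3)
  have eq: "poly p y / poly q y = a * inverse b * (y ^ degree p / y ^ degree q)"
    using y0 b(4) by (simp add: a_def b_def field_simps)
  have iy: "inverse y \<in> \<mm>" using inverse_level[OF y] .
  have abV: "a * inverse b \<in> V" "inverse a * b \<in> V" using a b V_mult by auto
  consider "degree p < degree q" | "degree p = degree q" | "degree p > degree q" by linarith
  then have "(poly p y / poly q y \<in> V \<longleftrightarrow> degree p \<le> degree q) \<and> (poly p y / poly q y \<in> \<mm> \<longleftrightarrow> degree p < degree q)"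
  proof cases
    case 1
    then obtain j where j: "degree q = degree p + Suc j" using less_imp_Suc_add by fastforce
    have "y ^ degree p / y ^ degree q = inverse y ^ j * inverse y"
      using y0 by (simp add: j power_add power_inverse field_simps)
    then have "poly p y / poly q y = (a * inverse b * inverse y ^ j) * inverse y"
      unfolding eq by (simp add: mult.assoc)
    also have "\<dots> \<in> \<mm>" using a b iy \<mm>_V by (intro \<mm>_mult V_mult V_power) auto
    finally show ?thesis using 1 \<mm>_V by auto
  next
    case 2
    then have e: "poly p y / poly q y = a * inverse b" unfolding eq using y0 by simp
    have "a * inverse b \<notin> \<mm>"
    proof
      assume "a * inverse b \<in> \<mm>"
      then have "(inverse a * b) * (a * inverse b) \<in> \<mm>" using abV \<mm>_mult by blast
      then show False using a b one_notin_\<mm> by (simp add: field_simps)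
    qed
    then show ?thesis using 2 abV e by simp
  next
    case 3
    then obtain j where j: "degree p = degree q + Suc j" using less_imp_Suc_add by fastforce
    have "y ^ degree q / y ^ degree p = inverse y ^ j * inverse y"
      using y0 by (simp add: j power_add power_inverse field_simps)
    moreover have "inverse (poly p y / poly q y) = inverse a * b * (y ^ degree q / y ^ degree p)"
      unfolding eq using a(4) b(4) y0 by (simp add: field_simps)
    ultimately have "inverse (poly p y / poly q y) = (inverse a * b * inverse y ^ j) * inverse y"
      by (simp add: mult.assoc)
    also have "\<dots> \<in> \<mm>" using a b iy \<mm>_V by (intro \<mm>_mult V_mult V_power) auto
    finally have "inverse (poly p y / poly q y) \<in> \<mm>" .
    moreover have "poly p y / poly q y \<noteq> 0" using poly_level_nonzero[OF y] p q by simp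
    ultimately have "poly p y / poly q y \<notin> V" by (auto simp: mem_\<mm>)
    then show ?thesis using 3 \<mm>_V by auto
  qed
  then show "poly p y / poly q y \<in> V \<longleftrightarrow> degree p \<le> degree q"
    "poly p y / poly q y \<in> \<mm> \<longleftrightarrow> degree p < degree q" by auto
qed

text \<open>Numerator and denominator are both compared with their terms of degree
  \<open>degree q\<close>. The residue depends on the coefficients only and not on the vertex, which
  is what the inertia property of the lifts rests on.\<close>

lemma rational_residue:
  assumes y: "y \<in> lv n" and p: "poly_over k p" and q: "poly_over k q" "q \<noteq> 0" and le: "degree p \<le> degree q"
  shows "poly p y / poly q y - coeff p (degree q) / lead_coeff q \<in> \<mm>"
proof -
  let ?e = "degree q"
  have y0: "y \<noteq> 0" using level_nonzero[OF y] .
  have 1: "poly p y / y ^ ?e - coeff p ?e \<in> \<mm>" "poly q y / y ^ ?e - coeff q ?e \<in> \<mm>"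
    using lead_term[OF v_ideal_\<mm> inverse_level[OF y] y0] p q le by auto
  have u: "inverse (poly q y / y ^ ?e) \<in> V" using lead_unit[OF y q] \<mm>_unit by blast
  have qn: "poly q y \<noteq> 0" using poly_level_nonzero[OF y q] .
  have lk: "coeff p ?e / lead_coeff q \<in> V" using poly_overD[OF p] poly_overD[OF q(1)] k_sub_V subfield_divide[OF k] by blast
  have "poly p y / poly q y - coeff p ?e / lead_coeff q =
     inverse (poly q y / y ^ ?e) * ((poly p y / y ^ ?e - coeff p ?e) - (coeff p ?e / lead_coeff q) * (poly q y / y ^ ?e - coeff q ?e))"
    using y0 qn q(2) by (simp add: field_simps)
  also have "\<dots> \<in> \<mm>" by (intro \<mm>_mult \<mm>_diff 1 u lk)
  finally show ?thesis .
qed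

end

context place_at_infinity
begin

section \<open>Residues on a level\<close>

lemma t_level: "t \<in> lv 0" by (simp add: level_0)

lemma t_nonzero: "t \<noteq> 0" by (rule level_nonzero[OF t_level])

lemma inverse_t: "inverse t \<in> \<mm>" by (rule inverse_level[OF t_level])

lemma FK_k: "poly_over k (F n)" by (rule poly_over_mono[OF FK K_sub_k])

lemma c_k: "c n \<in> k" using c_K K_sub_k by blast

lemma t_over_level:
  assumes "y \<in> lv n"
  shows "t / y ^ (d ^ n) - c n \<in> \<mm>" "t / y ^ (d ^ n) \<in> V" "t / y ^ (d ^ n) \<notin> \<mm>"
  using lead_term[OF v_ideal_\<mm> inverse_level[OF assms] level_nonzero[OF assms] FK_k order_refl, of n]
    lead_unit[OF assms FK_k F_nonzero, of n] assms
  by (simp_all add: mem_level degree_iterate)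

text \<open>Since \<open>t\<close> is the value of \<open>F n\<close> at both vertices,
  \<open>t / y ^ (d ^ n)\<close> and \<open>t / w ^ (d ^ n)\<close> have the same nonzero residue
  \<open>c n\<close>. The second divided by the first is \<open>(y / w) ^ (d ^ n)\<close>.\<close>

lemma ratio_V:
  assumes y: "y \<in> lv n" and w: "w \<in> lv n"
  shows "y / w \<in> V" "(y / w) ^ (d ^ n) - 1 \<in> \<mm>"
proof -
  define u where "u = y / w"
  have nz: "y \<noteq> 0" "w \<noteq> 0" using level_nonzero y w by auto
  have eq: "t / w ^ (d ^ n) = t / y ^ (d ^ n) * u ^ (d ^ n)"
    using nz by (simp add: u_def power_divide)
  have uM: "u \<in> M" unfolding u_def using y w level_sub_M M by (blast intro: subfield_divide)
  have uV: "u \<in> V"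
  proof (rule ccontr)
    assume "u \<notin> V"
    then have iu: "inverse u \<in> \<mm>" using inverse_\<mm> uM by blast
    obtain j where j: "d ^ n = Suc j" using d_power_pos[of n] by (metis Suc_pred)
    have "t / y ^ (d ^ n) = (t / w ^ (d ^ n) * inverse u ^ j) * inverse u"
      using nz unfolding eq by (simp add: j u_def field_simps)
    also have "\<dots> \<in> \<mm>" using t_over_level(2)[OF w] iu \<mm>_V by (intro \<mm>_mult V_mult V_power) auto
    finally show False using t_over_level(3)[OF y] by simp
  qed
  then show "y / w \<in> V" by (simp add: u_def)
  have "t / y ^ (d ^ n) * (u ^ (d ^ n) - 1) = (t / w ^ (d ^ n) - c n) - (t / y ^ (d ^ n) - c n)"
    unfolding eq by (simp add: right_diff_distrib)
  also have "\<dots> \<in> \<mm>" by (intro \<mm>_diff t_over_level y w)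
  finally have "u ^ (d ^ n) - 1 \<in> \<mm>"
    using \<mm>_prime[OF t_over_level(2)[OF y] V_diff[OF V_power[OF uV] V_1]] t_over_level(3)[OF y] by blast
  then show "(y / w) ^ (d ^ n) - 1 \<in> \<mm>" by (simp add: u_def)
qed

lemma \<mu>_V: "z \<in> \<mu> n \<Longrightarrow> z \<in> V" using \<mu>_k k_sub_V by blast

text \<open>The product of the differences \<open>y / w - z\<close> over \<open>\<mu> n\<close> is
  \<open>(y / w) ^ (d ^ n) - 1\<close>, and \<open>\<mm>\<close> is prime. This locates the residue
  without determining the residue field of \<open>V\<close>.\<close>

lemma residue_exists:
  assumes y: "y \<in> lv n" and w: "w \<in> lv n"
  obtains z where "z \<in> \<mu> n" "y / w - z \<in> \<mm>"
proof -
  have "(\<Prod>z\<in>\<mu> n. y / w - z) \<in> \<mm>" using ratio_V(2)[OF y w] prod_\<mu> by simp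
  then have "\<exists>z\<in>\<mu> n. y / w - z \<in> \<mm>"
    using ratio_V(1)[OF y w] \<mu>_V by (intro \<mm>_prime_prod card_\<mu> V_diff) auto
  with that show thesis by blast
qed

lemma cong_unit: "u - z \<in> \<mm> \<Longrightarrow> z \<in> k \<Longrightarrow> z \<noteq> 0 \<Longrightarrow> u \<notin> \<mm>"
  using \<mm>_diff[of u "u - z"] k_\<mm>[of z] by auto

lemma ratio_unit: assumes "y \<in> lv n" "w \<in> lv n" shows "y / w \<notin> \<mm>"
proof -
  obtain z where "z \<in> \<mu> n" "y / w - z \<in> \<mm>" using residue_exists[OF assms] .
  then show ?thesis using cong_unit \<mu>_k \<mu>_nonzero by blast
qed

lemma coeff_pderiv_F: "coeff (pderiv (F n)) (d ^ n - 1) = of_nat (d ^ n) * c n"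
  using d_power_pos[of n] by (simp add: coeff_pderiv degree_iterate)

lemma pderiv_F_level:
  assumes y: "y \<in> lv n" and w: "w \<noteq> 0"
  shows "(\<Prod>r\<in>lv n - {y}. (y - r) / w) = poly (pderiv (F n)) y / (c n * w ^ (d ^ n - 1))"
proof -
  have "pderiv (F n) = pderiv (F n - [:t:])" by (simp add: pderiv_diff pderiv_pCons)
  then have "poly (pderiv (F n)) y = c n * (\<Prod>r\<in>lv n - {y}. y - r)"
    using pderiv_root_poly[OF level_split(1) y] by (simp add: level_split(3) pderiv_smult)
  moreover have "card (lv n - {y}) = d ^ n - 1" using y level_split by simp
  ultimately show ?thesis using c_nonzero[of n] by (simp add: prod_dividef)
qed

lemma pderiv_F_lead:
  assumes "y \<in> lv n" "v_ideal J" "inverse y \<in> J"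
  shows "poly (pderiv (F n)) y / y ^ (d ^ n - 1) - of_nat (d ^ n) * c n \<in> J"
  using lead_term[OF assms(2,3) level_nonzero[OF assms(1)], of "pderiv (F n)" "d ^ n - 1"]
    poly_over_pderiv[OF k FK_k] degree_le[of "degree (F n) - 1" "pderiv (F n)"] coeff_pderiv_F[of n]
  by (simp add: degree_iterate coeff_pderiv coeff_eq_0)

text \<open>The product of \<open>(y - s) / y\<close> over the other vertices \<open>s\<close> is,
  up to normalisation, the derivative of \<open>F n\<close> at \<open>y\<close>, and its residue is
  \<open>d ^ n\<close>. This is nonzero because \<open>d\<close> is prime to the characteristic, so
  no factor lies in \<open>\<mm>\<close>.\<close>

lemma level_distinct:
  assumes y: "y \<in> lv n" and r: "r \<in> lv n" "y \<noteq> r" and w: "w \<in> lv n"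
  shows "(y - r) / w \<notin> \<mm>"
proof -
  have y0: "y \<noteq> 0" using level_nonzero[OF y] .
  have inV: "(y - s) / y \<in> V" if "s \<in> lv n" for s
    using V_diff[OF ratio_V(1)[OF y y] ratio_V(1)[OF that y]] by (simp add: diff_divide_distrib)
  have "(y - r) / y \<notin> \<mm>"
  proof
    assume *: "(y - r) / y \<in> \<mm>"
    have "(\<Prod>s\<in>lv n - {y}. (y - s) / y) = (\<Prod>s\<in>lv n - {y} - {r}. (y - s) / y) * ((y - r) / y)"
      using r level_split(1) by (subst prod.remove[of _ r]) (auto simp: mult.commute)
    also have "\<dots> \<in> \<mm>" using * inV by (intro \<mm>_mult V_prod) auto
    finally have "c n * (\<Prod>s\<in>lv n - {y}. (y - s) / y) \<in> \<mm>"
      using \<mm>_mult c_k k_sub_V by blast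
    then have "poly (pderiv (F n)) y / y ^ (d ^ n - 1) \<in> \<mm>"
      using c_nonzero[of n] by (simp add: pderiv_F_level[OF y y0])
    moreover have "of_nat (d ^ n) * c n \<in> k" by (intro subfield_closed k c_k)
    moreover have "of_nat (d ^ n) * c n \<noteq> 0" using tame c_nonzero by simp
    ultimately show False
      using cong_unit[OF pderiv_F_lead[OF y v_ideal_\<mm> inverse_level[OF y]]] by blast
  qed
  moreover have "(y - r) / w = (y - r) / y * (y / w)" using y0 by simp
  ultimately show ?thesis using \<mm>_prime[OF inV[OF r(1)] ratio_V(1)[OF y w]] ratio_unit[OF y w] by metis
qed

lemma residue_unique:
  assumes "y \<in> lv n" "r \<in> lv n" "w \<in> lv n" "y / w - a \<in> \<mm>" "r / w - a \<in> \<mm>"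
  shows "y = r"
  using level_distinct[of y n r w] \<mm>_diff[OF assms(4,5)] assms by (auto simp: diff_divide_distrib)

text \<open>Distinct vertices have distinct residues relative to \<open>w\<close>, and a level has
  as many elements as \<open>\<mu> n\<close>.\<close>

lemma residue_surj:
  assumes w: "w \<in> lv n" and z: "z \<in> \<mu> n"
  obtains y where "y \<in> lv n" "y / w - z \<in> \<mm>"
proof -
  have "\<forall>y\<in>lv n. \<exists>z. z \<in> \<mu> n \<and> y / w - z \<in> \<mm>" using residue_exists[OF _ w] by metis
  then obtain \<zeta> where \<zeta>: "\<And>y. y \<in> lv n \<Longrightarrow> \<zeta> y \<in> \<mu> n \<and> y / w - \<zeta> y \<in> \<mm>" by (meson bchoice)
  have "inj_on \<zeta> (lv n)"
  proof (rule inj_onI)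
    fix y r assume "y \<in> lv n" "r \<in> lv n" "\<zeta> y = \<zeta> r"
    then show "y = r" using residue_unique[of y n r w "\<zeta> y"] \<zeta> w by metis
  qed
  then have "card (\<zeta> ` lv n) = card (\<mu> n)" by (simp add: card_image level_split card_\<mu>)
  then have "\<zeta> ` lv n = \<mu> n" using \<zeta> card_\<mu>(1) by (intro card_subset_eq) auto
  with z have "z \<in> \<zeta> ` lv n" by simp
  then obtain y where "z = \<zeta> y" "y \<in> lv n" by (rule imageE)
  with \<zeta>[of y] that[of y] show thesis by simp
qed

section \<open>Newton approximation of the vertices\<close>

text \<open>The equation solved is \<open>(F n (w X) - t) / (c n * w ^ (d ^ n)) = 0\<close>, with
  root \<open>y / w\<close>; its left side is congruent to \<open>X ^ (d ^ n) - 1\<close>. The slope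
  is frozen at the derivative of the latter at the starting value \<open>z\<close>. Convergence is
  then linear, which suffices.\<close>

definition newton :: "nat \<Rightarrow> 'a \<Rightarrow> 'a \<Rightarrow> 'a \<Rightarrow> 'a" where
  "newton n w z b = b - (poly (F n) (w * b) - t) / (c n * w ^ (d ^ n)) / (of_nat (d ^ n) * z ^ (d ^ n - 1))"

context
  fixes n w y z
  assumes w: "w \<in> lv n" and y: "y \<in> lv n" and z: "z \<in> \<mu> n" and yz: "y / w - z \<in> \<mm>"
begin

private lemma w0: "w \<noteq> 0" by (rule level_nonzero[OF w])

private lemma J: "v_ideal {a. w * a \<in> V}"
  by (rule v_ideal_inverse[OF \<mm>_V[OF inverse_level[OF w]] w0])

private lemma iw: "inverse w \<in> {a. w * a \<in> V}" using w0 V_1 by simp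

private lemma F_factor: "(poly (F n) (w * b) - t) / (c n * w ^ (d ^ n)) = (b - y / w) * (\<Prod>r\<in>lv n - {y}. b - r / w)"
proof -
  have "poly (F n) (w * b) - t = poly (F n - [:t:]) (w * b)" by simp
  also have "\<dots> = c n * (\<Prod>r\<in>lv n. w * b - r)" by (simp add: level_split(3) poly_root_poly)
  also have "(\<Prod>r\<in>lv n. w * b - r) = (\<Prod>r\<in>lv n. w * (b - r / w))"
    using w0 by (intro prod.cong) (auto simp: right_diff_distrib)
  also have "\<dots> = w ^ (d ^ n) * (\<Prod>r\<in>lv n. b - r / w)" by (simp add: prod.distrib level_split)
  finally show ?thesis using w0 c_nonzero[of n] prod.remove[OF level_split(1) y, of "\<lambda>r. b - r / w"] by simp
qed

text \<open>The residue gives only \<open>z - y / w \<in> \<mm>\<close>, while the iteration must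
  start with precision \<open>V / w\<close>. Divided by \<open>w ^ (d ^ n)\<close>, both
  \<open>F n (w * z)\<close> and \<open>t\<close> are congruent to \<open>c n\<close> modulo
  \<open>V / w\<close>, because \<open>z ^ (d ^ n) = 1\<close>. The factors \<open>z - r / w\<close>
  for the other vertices \<open>r\<close> are units.\<close>

lemma newton_start: "w * (z - y / w) \<in> V"
proof -
  have zk: "z \<in> k" "z \<in> V" using z \<mu>_k \<mu>_V by auto
  let ?p = "pcompose (F n) [:0, z:]"
  have z0: "z \<noteq> 0" using z \<mu>_nonzero by blast
  have pk: "poly_over k ?p" using zk(1) by (intro poly_over_closed poly_over_pCons k subfield_0 FK_k)
  have dp: "degree ?p = d ^ n" using z0 by (simp add: degree_pcompose degree_iterate)
  have lp: "coeff ?p (d ^ n) = c n"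
    using lead_coeff_comp[of "[:0, z:]" "F n"] z z0 dp by (simp add: degree_iterate \<mu>_def)
  have 1: "poly (F n) (w * z) / w ^ (d ^ n) - c n \<in> {a. w * a \<in> V}"
    using lead_term[OF J iw w0 pk order_refl] by (simp add: dp lp poly_pcompose)
  have 2: "t / w ^ (d ^ n) - c n \<in> {a. w * a \<in> V}"
    using lead_term[OF J iw w0 FK_k order_refl, of n] w by (simp add: degree_iterate mem_level)
  have "(poly (F n) (w * z) - t) / w ^ (d ^ n) \<in> {a. w * a \<in> V}"
    using v_idealD(2)[OF J 1 2] by (simp add: diff_divide_distrib)
  moreover have "inverse (c n) \<in> V" using subfield_inverse[OF k c_k] k_sub_V by blast
  ultimately have "inverse (c n) * ((poly (F n) (w * z) - t) / w ^ (d ^ n)) \<in> {a. w * a \<in> V}"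
    by (intro v_idealD(3)[OF J])
  moreover have "inverse (c n) * ((poly (F n) (w * z) - t) / w ^ (d ^ n)) = (z - y / w) * (\<Prod>r\<in>lv n - {y}. z - r / w)"
    unfolding F_factor[symmetric] by (simp add: field_simps)
  ultimately have 3: "(z - y / w) * (\<Prod>r\<in>lv n - {y}. z - r / w) \<in> {a. w * a \<in> V}" by metis
  define P where "P = (\<Prod>r\<in>lv n - {y}. z - r / w)"
  have rV: "z - r / w \<in> V" if "r \<in> lv n - {y}" for r using that zk ratio_V(1)[OF _ w] V_diff by blast
  have PV: "P \<in> V" unfolding P_def by (intro V_prod rV)
  have "P \<notin> \<mm>"
  proof
    assume "P \<in> \<mm>"
    then obtain r where r: "r \<in> lv n - {y}" "z - r / w \<in> \<mm>"
      unfolding P_def using \<mm>_prime_prod[of "lv n - {y}" "\<lambda>r. z - r / w"] rV level_split(1) by blast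
    have "r / w - z \<in> \<mm>" using \<mm>_diff[OF v_idealD(4)[OF v_ideal_\<mm>] r(2)] by simp
    then show False using residue_unique[OF y _ w yz] r by blast
  qed
  then have P: "inverse P \<in> V" "P \<noteq> 0" using \<mm>_unit PV by (auto simp: mem_\<mm>)
  have "inverse P * ((z - y / w) * P) \<in> {a. w * a \<in> V}"
    using v_idealD(3)[OF J P(1) 3[folded P_def]] .
  moreover have "inverse P * ((z - y / w) * P) = z - y / w" using P(2) by simp
  ultimately show ?thesis by (simp only: mem_Collect_eq)
qed

lemma newton_step:
  assumes b: "w ^ Suc N * (b - y / w) \<in> V"
  shows "w ^ Suc (Suc N) * (newton n w z b - y / w) \<in> V"
proof -
  let ?J = "{a. w * a \<in> V}"
  define u where "u = y / w"
  define P where "P = (\<Prod>r\<in>lv n - {y}. b - r / w)"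
  define Q where "Q = (\<Prod>r\<in>lv n - {y}. u - r / w)"
  define e where "e = of_nat (d ^ n) * z ^ (d ^ n - 1)"
  have zk: "z \<in> k" "z \<in> V" "z \<noteq> 0" using z \<mu>_k \<mu>_V \<mu>_nonzero by auto
  have ek: "e \<in> k" unfolding e_def by (intro subfield_closed k zk)
  have e0: "e \<noteq> 0" unfolding e_def using zk tame_power by simp
  have ie: "inverse e \<in> V" using subfield_inverse[OF k ek] k_sub_V by blast
  have uV: "u \<in> V" unfolding u_def by (rule ratio_V(1)[OF y w])
  have iwV: "inverse w \<in> V" using inverse_level[OF w] \<mm>_V by blast
  have "inverse w ^ N * (w ^ Suc N * (b - u)) \<in> V"
    using V_mult[OF V_power[OF iwV] b] by (simp add: u_def)
  moreover have "inverse w ^ N * (w ^ Suc N * (b - u)) = w * (b - u)"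
  proof -
    have "inverse w ^ N * w ^ N = 1" using w0 by (simp add: power_inverse)
    moreover have "inverse w ^ N * (w ^ Suc N * (b - u)) = (inverse w ^ N * w ^ N) * (w * (b - u))"
      by (simp add: mult_ac)
    ultimately show ?thesis by simp
  qed
  ultimately have bu: "b - u \<in> ?J" by (simp only: mem_Collect_eq)
  have bV: "b \<in> V" using V_add[OF v_idealD(1)[OF J bu] uV] by simp
  have PQ: "P - Q \<in> ?J" unfolding P_def Q_def
    using bu bV uV ratio_V(1)[OF _ w] by (intro cong_prod[OF J]) (auto intro!: V_diff)
  have Q: "Q = poly (pderiv (F n)) y / y ^ (d ^ n - 1) * inverse (c n) * u ^ (d ^ n - 1)"
    unfolding Q_def u_def diff_divide_distrib[symmetric] pderiv_F_level[OF y w0]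
    using level_nonzero[OF y] by (simp add: power_divide field_simps)
  have y0: "y \<noteq> 0" using level_nonzero[OF y] .
  have "w * inverse y \<in> V" using ratio_V(1)[OF w y] by (simp add: divide_inverse)
  then have iy: "inverse y \<in> ?J" by simp
  have cn: "inverse (c n) \<in> V" "of_nat (d ^ n) * c n \<in> V"
    using subfield_inverse[OF k c_k] k_sub_V subfield_mult[OF k subfield_of_nat[OF k] c_k] by blast+
  have yV: "poly (pderiv (F n)) y / y ^ (d ^ n - 1) \<in> V"
    using V_add[OF v_idealD(1)[OF J pderiv_F_lead[OF y J iy]] cn(2)] by simp
  have uz: "u - z \<in> ?J" using newton_start V_uminus u_def by (metis mem_Collect_eq minus_diff_eq mult_minus_right)
  have "inverse (c n) * (poly (pderiv (F n)) y / y ^ (d ^ n - 1) - of_nat (d ^ n) * c n) \<in> ?J"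
    by (intro v_idealD(3)[OF J] pderiv_F_lead[OF y J iy] cn)
  then have "poly (pderiv (F n)) y / y ^ (d ^ n - 1) * inverse (c n) - of_nat (d ^ n) \<in> ?J"
    using c_nonzero[of n] by (simp add: right_diff_distrib mult_ac)
  then have Qe: "Q - e \<in> ?J" unfolding Q e_def
    using yV cn uV zk by (intro cong_mult[OF J] cong_power[OF J uz] V_mult V_power) auto
  have "e - P = - (1::'a) * (P - Q) - (Q - e)" by simp
  also have "\<dots> \<in> ?J" by (intro v_idealD(2)[OF J] v_idealD(3)[OF J] PQ Qe V_uminus V_1)
  finally have "inverse e * (e - P) \<in> ?J" using ie v_idealD(3)[OF J] by blast
  moreover have "inverse e * (e - P) = 1 - P / e" using e0 by (simp add: field_simps)
  ultimately have fac: "w * (1 - P / e) \<in> V" by (simp only: mem_Collect_eq)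
  have "newton n w z b - y / w = (b - u) * (1 - P / e)"
    unfolding newton_def F_factor P_def[symmetric] u_def[symmetric] e_def[symmetric] by (simp add: algebra_simps)
  then have "w ^ Suc (Suc N) * (newton n w z b - y / w) = (w ^ Suc N * (b - u)) * (w * (1 - P / e))"
    by (simp add: mult_ac)
  also have "\<dots> \<in> V" using V_mult[OF b[folded u_def] fac] .
  finally show ?thesis .
qed

lemma newton_iterate: "w ^ Suc N * ((newton n w z ^^ N) z - y / w) \<in> V"
  by (induction N) (use newton_start newton_step in auto)

text \<open>\<open>w ^ (d ^ n)\<close> has the size of \<open>t\<close>, hence
  \<open>d ^ n * N\<close> steps for precision \<open>t ^ N\<close>. The surplus factor
  \<open>w\<close> in \<open>newton_iterate\<close> pays for passing from \<open>y / w\<close> to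
  \<open>y\<close>.\<close>

lemma newton_approx: "t ^ N * (y - w * (newton n w z ^^ (d ^ n * N)) z) \<in> V"
proof -
  define b where "b = (newton n w z ^^ (d ^ n * N)) z"
  define u where "u = t / w ^ (d ^ n)"
  have uV: "u \<in> V" unfolding u_def by (rule t_over_level(2)[OF w])
  have "u ^ N * w ^ (d ^ n * N) = t ^ N" using w0 by (simp add: u_def power_divide power_mult)
  moreover have "y - w * b = - (w * (b - y / w))" using w0 by (simp add: right_diff_distrib)
  ultimately have "t ^ N * (y - w * b) = - (u ^ N * (w ^ Suc (d ^ n * N) * (b - y / w)))"
    by (simp add: mult_ac)
  also have "\<dots> \<in> V" unfolding b_def by (intro V_uminus V_mult V_power uV newton_iterate)
  finally show ?thesis by (simp add: b_def)
qed

end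

section \<open>Bounds in powers of \<open>t\<close>\<close>

lemma t_power_mono: assumes "t ^ n * z \<in> V" "m \<le> n" shows "t ^ m * z \<in> V"
proof -
  have "inverse t ^ (n - m) * (t ^ n * z) \<in> V"
    using inverse_t \<mm>_V by (intro V_mult V_power assms) auto
  moreover have "inverse t ^ (n - m) * (t ^ n * z) = t ^ m * z"
  proof -
    have "t ^ n = t ^ (n - m) * t ^ m" using assms(2) by (simp flip: power_add)
    then show ?thesis using t_nonzero by (simp add: power_inverse)
  qed
  ultimately show ?thesis by simp
qed

lemma t_mult_V: assumes "t ^ 1 * u \<in> V" shows "u \<in> \<mm>"
proof -
  have "(t ^ 1 * u) * inverse t \<in> \<mm>" by (rule \<mm>_mult[OF assms inverse_t])
  moreover have "(t ^ 1 * u) * inverse t = u" using t_nonzero by (simp add: field_simps)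
  ultimately show ?thesis by (simp only:)
qed

lemma inverse_t_power_mono: "inverse t ^ m * z \<in> V \<Longrightarrow> m \<le> n \<Longrightarrow> inverse t ^ n * z \<in> V"
  using V_mult[OF V_power[OF \<mm>_V[OF inverse_t]], of "inverse t ^ m * z" "n - m"]
  by (simp flip: mult.assoc power_add)

lemma rational_bound:
  assumes y: "y \<in> lv n" and p: "poly_over k p" and q: "poly_over k q" "q \<noteq> 0"
  shows "inverse t ^ degree p * (poly p y / poly q y) \<in> V"
proof (cases "p = 0")
  case False
  have "degree (q * F n ^ degree p) = degree q + degree p * d ^ n"
    using q F_nonzero by (simp add: degree_mult_eq degree_power_eq degree_iterate)
  moreover have "degree p * 1 \<le> degree p * d ^ n" using d_power_pos[of n] by (intro mult_le_mono) auto
  then have "degree p \<le> degree q + degree p * d ^ n" by linarith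
  ultimately have "poly p y / poly (q * F n ^ degree p) y \<in> V"
    using q F_nonzero False
    by (subst rational_V_iff(1)[OF y p False]) (auto intro!: poly_over_closed k FK_k)
  moreover have "poly (F n) y = t" using y by (simp add: mem_level)
  ultimately show ?thesis by (simp add: power_inverse field_simps)
qed (simp add: V_0)

text \<open>As \<open>z\<close> is algebraic over \<open>K(t)\<close>, its inverse is a polynomial
  \<open>q\<close> in \<open>z\<close> whose coefficients are bounded by powers of \<open>t\<close>.
  If \<open>z\<close> were infinitely small, \<open>1 = q(z) * z\<close> would lie in
  \<open>\<mm>\<close>.\<close>

lemma t_adic_separated:
  assumes z: "\<And>N. t ^ N * z \<in> V"
  shows "z = 0"
proof (rule ccontr)
  assume z0: "z \<noteq> 0"
  let ?E0 = "field_adjoin K {t}"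
  have "algebraic_over ?E0 z" by (rule splits_over_algebraic[OF subfield_field_adjoin splits_over_Kt])
  then obtain q where q: "poly_over ?E0 q" "inverse z = poly q z" using inverse_poly[OF subfield_field_adjoin] by blast
  have "\<forall>i. \<exists>C. inverse t ^ C * coeff q i \<in> V"
  proof
    fix i
    obtain a b where ab: "poly_over K a" "poly_over K b" "poly b t \<noteq> 0" "coeff q i = poly a t / poly b t"
      using field_adjoin_rational[OF K poly_overD[OF q(1)]] by blast
    then have "b \<noteq> 0" by auto
    then show "\<exists>C. inverse t ^ C * coeff q i \<in> V"
      using rational_bound[OF t_level poly_over_mono[OF ab(1) K_sub_k] poly_over_mono[OF ab(2) K_sub_k]] ab(4) by metis
  qed
  then obtain C where C: "\<And>i. inverse t ^ C i * coeff q i \<in> V" by metis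
  define D where "D = (\<Sum>i\<le>degree q. C i)"
  have D: "inverse t ^ D * coeff q i \<in> V" if "i \<le> degree q" for i
    using inverse_t_power_mono[OF C] that unfolding D_def by (intro inverse_t_power_mono[OF C] member_le_sum) auto
  have "1 = poly q z * z" using q(2) z0 by (metis left_inverse)
  also have "\<dots> = (\<Sum>i\<le>degree q. coeff q i * z ^ i * z)" by (simp add: poly_altdef sum_distrib_right)
  \<comment> \<open>\<open>D\<close> powers of \<open>t\<close> compensate the size of the
    coefficients; the one further power leaves the factor \<open>inverse t\<close>, which lies in
    \<open>\<mm>\<close>.\<close>
  also have "\<dots> = (\<Sum>i\<le>degree q. ((inverse t ^ D * coeff q i) * z ^ i * (t ^ Suc D * z)) * inverse t)"
    using t_nonzero by (intro sum.cong refl) (simp add: power_inverse field_simps)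
  also have "\<dots> \<in> \<mm>"
    using z[of 0] by (intro v_ideal_sum[OF v_ideal_\<mm>] \<mm>_mult inverse_t V_mult V_power D z) auto
  finally show False using one_notin_\<mm> by simp
qed

end

section \<open>Lifting automorphisms of \<open>k\<close> to the decomposition group\<close>

text \<open>The union \<open>T\<close> of the fields \<open>k(x\<^sub>n)\<close> along a branch is dense in \<open>M\<close> for the \<open>1/t\<close>-adic topology, so a
  semilinear isomorphism \<open>T \<rightarrow> T'\<close> mapping \<open>x\<^sub>n\<close> to \<open>x'\<^sub>n\<close> extends to \<open>M\<close> by continuity. Both the isomorphism and
  its extension are given as graphs.\<close>

locale branch_lift = place_at_infinity K t f V for K :: "'a::field set" and t f V +
  fixes \<tau> :: "'a \<Rightarrow> 'a" and x x' :: "nat \<Rightarrow> 'a"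
  assumes \<tau>: "\<tau> \<in> carrier (Gal k K)" and x: "branch x" and x': "branch x'"
begin

abbreviation "G\<^sub>k \<equiv> graph_on k \<tau>"

lemma Gk: "hom_graph G\<^sub>k" by (rule hom_graph_Gal[OF k \<tau>])

lemma Gk_K: "Id_on K \<subseteq> G\<^sub>k" using \<tau> K_sub_k by (auto simp: graph_on_iff Gal_carrier)

lemma Gk_k: "(a, b) \<in> G\<^sub>k \<Longrightarrow> a \<in> k \<and> b \<in> k"
  using \<tau> Bij_mem[of \<tau> k] by (auto simp: graph_on_iff Gal_carrier)

lemma pg_k: assumes "poly_graph G\<^sub>k p p'" shows "poly_over k p" "poly_over k p'"
  using assms Gk_k unfolding poly_graph_def poly_over_def by blast+

lemma pg_F: "poly_graph G\<^sub>k (F n) (F n)" by (rule poly_graph_same[OF FK Gk_K])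

lemma pg_0: assumes "poly_graph G\<^sub>k p p'" shows "p = 0 \<longleftrightarrow> p' = 0"
  using assms hom_graph_zeroD[OF Gk] hom_graph_zeroD'[OF Gk] unfolding poly_graph_def poly_eq_iff
  by (metis coeff_0)

definition \<phi> :: "('a \<times> 'a) set" where
  "\<phi> = {(poly p (x n) / poly q (x n), poly p' (x' n) / poly q' (x' n)) | n p p' q q'.
     poly_graph G\<^sub>k p p' \<and> poly_graph G\<^sub>k q q' \<and> q \<noteq> 0}"

lemma \<phi>I: "poly_graph G\<^sub>k p p' \<Longrightarrow> poly_graph G\<^sub>k q q' \<Longrightarrow> q \<noteq> 0 \<Longrightarrow>
    (poly p (x n) / poly q (x n), poly p' (x' n) / poly q' (x' n)) \<in> \<phi>"
  unfolding \<phi>_def by blast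

text \<open>Composition with \<open>F (m - n)\<close> turns fractions in \<open>x n\<close> into
  fractions in \<open>x m\<close>; this polynomial has coefficients in \<open>K\<close> and is
  unchanged by \<tau>. Two elements can thus be written on a common level.\<close>

lemma \<phi>E:
  assumes "(a, a') \<in> \<phi>"
  obtains n0 where "\<And>m. m \<ge> n0 \<Longrightarrow> \<exists>p p' q q'. poly_graph G\<^sub>k p p' \<and> poly_graph G\<^sub>k q q' \<and> q \<noteq> 0 \<and>
     a = poly p (x m) / poly q (x m) \<and> a' = poly p' (x' m) / poly q' (x' m)"
proof -
  obtain n p p' q q' where *: "poly_graph G\<^sub>k p p'" "poly_graph G\<^sub>k q q'" "q \<noteq> 0"
    "a = poly p (x n) / poly q (x n)" "a' = poly p' (x' n) / poly q' (x' n)"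
    using assms unfolding \<phi>_def by blast
  show thesis
  proof (rule that[of n])
    fix m assume m: "n \<le> m"
    let ?F = "F (m - n)"
    have eq: "poly ?F (x m) = x n" "poly ?F (x' m) = x' n"
      using branch_F[OF x, of "m - n" n] branch_F[OF x', of "m - n" n] m by auto
    have "degree ?F > 0" using degree_f by (simp add: degree_iterate)
    then have "pcompose q ?F \<noteq> 0" using *(3) by (metis pcompose_eq_0)
    then show "\<exists>p p' q q'. poly_graph G\<^sub>k p p' \<and> poly_graph G\<^sub>k q q' \<and> q \<noteq> 0 \<and>
     a = poly p (x m) / poly q (x m) \<and> a' = poly p' (x' m) / poly q' (x' m)"
      using poly_graph_pcompose[OF Gk *(1) pg_F] poly_graph_pcompose[OF Gk *(2) pg_F]
      by (intro exI[of _ "pcompose p ?F"] exI[of _ "pcompose p' ?F"] exI[of _ "pcompose q ?F"]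
          exI[of _ "pcompose q' ?F"]) (simp add: poly_pcompose eq *)
  qed
qed

lemma \<phi>_const: "a \<in> k \<Longrightarrow> (a, \<tau> a) \<in> \<phi>"
  using \<phi>I[of "[:a:]" "[:\<tau> a:]" 1 1 0]
    poly_graph_same[OF poly_over_1[OF K] Gk_K] poly_graph_pCons[OF _ poly_graph_0[OF Gk], of a "\<tau> a"]
  by (simp add: graph_on_iff)

lemma \<phi>_x: "(x n, x' n) \<in> \<phi>"
proof -
  have "poly_over K [:0, 1:]" by (intro poly_over_closed poly_over_pCons subfield_closed K)
  then show ?thesis
    using \<phi>I[of "[:0, 1:]" "[:0, 1:]" 1 1 n] poly_graph_same[OF poly_over_1[OF K] Gk_K]
      poly_graph_same[OF _ Gk_K] by simp
qed

lemma \<phi>_t: "(t, t) \<in> \<phi>" using \<phi>_x[of 0] x x' by (simp add: branch_def)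

text \<open>On either branch membership in \<open>V\<close> and \<open>\<mm>\<close> compares
  degrees, and \<tau> preserves degrees.\<close>

lemma \<phi>_V: assumes "(a, a') \<in> \<phi>" shows "a \<in> V \<longleftrightarrow> a' \<in> V" "a \<in> \<mm> \<longleftrightarrow> a' \<in> \<mm>"
proof -
  obtain n p p' q q' where *: "poly_graph G\<^sub>k p p'" "poly_graph G\<^sub>k q q'" "q \<noteq> 0"
    "a = poly p (x n) / poly q (x n)" "a' = poly p' (x' n) / poly q' (x' n)"
    using assms unfolding \<phi>_def by blast
  have q': "q' \<noteq> 0" using pg_0[OF *(2)] *(3) by simp
  have deg: "degree p' = degree p" "degree q' = degree q" using poly_graph_degree[OF Gk] * by auto
  have "(a \<in> V \<longleftrightarrow> a' \<in> V) \<and> (a \<in> \<mm> \<longleftrightarrow> a' \<in> \<mm>)"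
  proof (cases "p = 0")
    case True
    then show ?thesis using pg_0[OF *(1)] * by simp
  next
    case False
    then have p': "p' \<noteq> 0" using pg_0[OF *(1)] by simp
    show ?thesis unfolding *(4,5)
      using rational_V_iff[OF branch_level[OF x] pg_k(1)[OF *(1)] False pg_k(1)[OF *(2)] *(3)]
        rational_V_iff[OF branch_level[OF x'] pg_k(2)[OF *(1)] p' pg_k(2)[OF *(2)] q'] deg by simp
  qed
  then show "a \<in> V \<longleftrightarrow> a' \<in> V" "a \<in> \<mm> \<longleftrightarrow> a' \<in> \<mm>" by auto
qed

lemma hom_graph_\<phi>: "hom_graph \<phi>"
proof (rule hom_graphI)
  show "(1, 1) \<in> \<phi>"
    using \<phi>I[of 1 1 1 1 0] poly_graph_same[OF poly_over_1[OF K] Gk_K] by simp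
next
  fix a a' b b' assume ab: "(a, a') \<in> \<phi>" "(b, b') \<in> \<phi>"
  obtain m n where mn: "\<And>j. j \<ge> m \<Longrightarrow> \<exists>p p' q q'. poly_graph G\<^sub>k p p' \<and> poly_graph G\<^sub>k q q' \<and> q \<noteq> 0 \<and>
     a = poly p (x j) / poly q (x j) \<and> a' = poly p' (x' j) / poly q' (x' j)"
    "\<And>j. j \<ge> n \<Longrightarrow> \<exists>p p' q q'. poly_graph G\<^sub>k p p' \<and> poly_graph G\<^sub>k q q' \<and> q \<noteq> 0 \<and>
     b = poly p (x j) / poly q (x j) \<and> b' = poly p' (x' j) / poly q' (x' j)"
    using \<phi>E[OF ab(1)] \<phi>E[OF ab(2)] by metis
  define j where "j = max m n"
  obtain p p' q q' where p: "poly_graph G\<^sub>k p p'" "poly_graph G\<^sub>k q q'" "q \<noteq> 0"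
     "a = poly p (x j) / poly q (x j)" "a' = poly p' (x' j) / poly q' (x' j)"
    using mn(1)[of j] unfolding j_def by auto
  obtain r r' s s' where r: "poly_graph G\<^sub>k r r'" "poly_graph G\<^sub>k s s'" "s \<noteq> 0"
     "b = poly r (x j) / poly s (x j)" "b' = poly r' (x' j) / poly s' (x' j)"
    using mn(2)[of j] unfolding j_def by auto
  have nz: "poly q (x j) \<noteq> 0" "poly s (x j) \<noteq> 0" "poly q' (x' j) \<noteq> 0" "poly s' (x' j) \<noteq> 0"
    using poly_level_nonzero[OF branch_level[OF x]] poly_level_nonzero[OF branch_level[OF x']]
      pg_k[OF p(2)] pg_k[OF r(2)] pg_0[OF p(2)] pg_0[OF r(2)] p(3) r(3) by auto
  have "poly_graph G\<^sub>k (p * s - r * q) (p' * s' - r' * q')" "poly_graph G\<^sub>k (q * s) (q' * s')"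
    "poly_graph G\<^sub>k (p * r) (p' * r')" by (intro poly_graph_diff poly_graph_mult Gk p r)+
  from \<phi>I[OF this(1,2), of j] \<phi>I[OF this(3,2), of j]
  show "(a - b, a' - b') \<in> \<phi>" "(a * b, a' * b') \<in> \<phi>"
    using p(3) r(3) nz by (auto simp: p r diff_frac_eq)
next
  fix a a' assume "(a, a') \<in> \<phi>"
  then obtain n p p' q q' where *: "poly_graph G\<^sub>k p p'" "poly_graph G\<^sub>k q q'" "q \<noteq> 0"
    "a = poly p (x n) / poly q (x n)" "a' = poly p' (x' n) / poly q' (x' n)"
    unfolding \<phi>_def by blast
  show "(inverse a, inverse a') \<in> \<phi>"
  proof (cases "p = 0")
    case True
    then have "a = 0" "a' = 0" using pg_0[OF *(1)] * by auto
    moreover have "(0, \<tau> 0) \<in> \<phi>" using \<phi>_const[of 0] subfield_0[OF k] by simp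
    moreover have "\<tau> 0 = 0" using \<tau> subfield_0[OF K] by (simp add: Gal_carrier)
    ultimately show ?thesis by simp
  next
    case False
    then show ?thesis using \<phi>I[OF *(2,1), of n] by (simp add: *)
  qed
next
  fix y assume "(0, y) \<in> \<phi>"
  then obtain n p p' q q' where *: "poly_graph G\<^sub>k p p'" "poly_graph G\<^sub>k q q'" "q \<noteq> 0"
    "0 = poly p (x n) / poly q (x n)" "y = poly p' (x' n) / poly q' (x' n)"
    unfolding \<phi>_def by blast
  then have "p = 0"
    using poly_level_nonzero[OF branch_level[OF x]] pg_k(1)[OF *(1)] pg_k(1)[OF *(2)]
    by (metis divide_eq_0_iff)
  then show "y = 0" using pg_0[OF *(1)] * by simp
qed

lemma \<phi>_power: "(a, a') \<in> \<phi> \<Longrightarrow> (a ^ n, a' ^ n) \<in> \<phi>"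
  by (induction n) (auto intro: hom_graph_mult[OF hom_graph_\<phi>] hom_graph_1[OF hom_graph_\<phi>])

lemma \<phi>_scale: "(a, a') \<in> \<phi> \<Longrightarrow> (t ^ n * a, t ^ n * a') \<in> \<phi>"
  by (intro hom_graph_mult[OF hom_graph_\<phi>] \<phi>_power \<phi>_t)

lemma \<phi>_M: assumes "(a, a') \<in> \<phi>" shows "a \<in> M" "a' \<in> M"
proof -
  obtain n p p' q q' where *: "poly_graph G\<^sub>k p p'" "poly_graph G\<^sub>k q q'"
    "a = poly p (x n) / poly q (x n)" "a' = poly p' (x' n) / poly q' (x' n)"
    using assms unfolding \<phi>_def by blast
  have "x n \<in> M" "x' n \<in> M" using branch_level[OF x] branch_level[OF x'] level_sub_M by blast+
  then show "a \<in> M" "a' \<in> M" unfolding *(3,4) using pg_k[OF *(1)] pg_k[OF *(2)]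
    by (auto intro!: subfield_divide[OF M] poly_over_eval[OF M] poly_over_mono[OF _ k_sub_M])
qed

lemma \<phi>_bound: assumes "(a, a') \<in> \<phi>" shows "\<exists>C. inverse t ^ C * a \<in> V \<and> inverse t ^ C * a' \<in> V"
proof -
  obtain n p p' q q' where *: "poly_graph G\<^sub>k p p'" "poly_graph G\<^sub>k q q'" "q \<noteq> 0"
    "a = poly p (x n) / poly q (x n)" "a' = poly p' (x' n) / poly q' (x' n)"
    using assms unfolding \<phi>_def by blast
  have "inverse t ^ degree p * a \<in> V" unfolding *(4)
    by (rule rational_bound[OF branch_level[OF x] pg_k(1)[OF *(1)] pg_k(1)[OF *(2)] *(3)])
  moreover have "(inverse t ^ degree p * a, inverse t ^ degree p * a') \<in> \<phi>"
    by (intro hom_graph_mult[OF hom_graph_\<phi>] \<phi>_power hom_graph_inverse[OF hom_graph_\<phi>] \<phi>_t assms)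
  ultimately show ?thesis using \<phi>_V by blast
qed

text \<open>The closure of \<open>\<phi>\<close> for the topology given by powers of
  \<open>inverse t\<close>: a single pair has to approximate both coordinates at once.\<close>

definition \<Phi> :: "('a \<times> 'a) set" where
  "\<Phi> = {(z, z'). \<forall>N. \<exists>a a'. (a, a') \<in> \<phi> \<and> t ^ N * (z - a) \<in> V \<and> t ^ N * (z' - a') \<in> V}"

lemma \<Phi>E:
  assumes "(z, z') \<in> \<Phi>"
  obtains a a' where "(a, a') \<in> \<phi>" "t ^ N * (z - a) \<in> V" "t ^ N * (z' - a') \<in> V"
  using assms unfolding \<Phi>_def by blast

lemma \<phi>_sub_\<Phi>: "\<phi> \<subseteq> \<Phi>"
proof clarify
  fix a a' assume "(a, a') \<in> \<phi>"
  then have "\<exists>b b'. (b, b') \<in> \<phi> \<and> t ^ N * (a - b) \<in> V \<and> t ^ N * (a' - b') \<in> V" for N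
    by (intro exI[of _ a] exI[of _ a']) (simp add: V_0)
  then show "(a, a') \<in> \<Phi>" unfolding \<Phi>_def by blast
qed

lemma \<Phi>_M: assumes "(z, z') \<in> \<Phi>" shows "z \<in> M" "z' \<in> M"
proof -
  obtain a a' where a: "(a, a') \<in> \<phi>" "t ^ 0 * (z - a) \<in> V" "t ^ 0 * (z' - a') \<in> V"
    using \<Phi>E[OF assms] by blast
  then have "z - a \<in> M" "z' - a' \<in> M" using V_sub_M by auto
  then show "z \<in> M" "z' \<in> M"
    using subfield_add[OF M \<open>z - a \<in> M\<close> \<phi>_M(1)[OF a(1)]] subfield_add[OF M \<open>z' - a' \<in> M\<close> \<phi>_M(2)[OF a(1)]] by auto
qed

lemma \<Phi>_V:
  assumes "(z, z') \<in> \<Phi>"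
  shows "t ^ N * z \<in> V \<longleftrightarrow> t ^ N * z' \<in> V" "z \<in> \<mm> \<longleftrightarrow> z' \<in> \<mm>"
proof -
  obtain a a' where a: "(a, a') \<in> \<phi>" "t ^ N * (z - a) \<in> V" "t ^ N * (z' - a') \<in> V"
    using \<Phi>E[OF assms] by blast
  have "t ^ N * z \<in> V \<longleftrightarrow> t ^ N * a \<in> V" "t ^ N * z' \<in> V \<longleftrightarrow> t ^ N * a' \<in> V"
    using a(2,3) V_diff[of "t ^ N * z" "t ^ N * (z - a)"] V_add[of "t ^ N * a" "t ^ N * (z - a)"]
      V_diff[of "t ^ N * z'" "t ^ N * (z' - a')"] V_add[of "t ^ N * a'" "t ^ N * (z' - a')"]
    by (auto simp: right_diff_distrib)
  then show "t ^ N * z \<in> V \<longleftrightarrow> t ^ N * z' \<in> V" using \<phi>_V(1)[OF \<phi>_scale[OF a(1), of N]] by simp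
next
  obtain a a' where a: "(a, a') \<in> \<phi>" "t ^ 1 * (z - a) \<in> V" "t ^ 1 * (z' - a') \<in> V"
    using \<Phi>E[OF assms] by blast
  have eq: "u \<in> \<mm> \<longleftrightarrow> b \<in> \<mm>" if "u - b \<in> \<mm>" for u b
    using that \<mm>_diff[of u "u - b"] v_idealD(5)[OF v_ideal_\<mm>, of b "u - b"] by auto
  have "z \<in> \<mm> \<longleftrightarrow> a \<in> \<mm>" "z' \<in> \<mm> \<longleftrightarrow> a' \<in> \<mm>"
    by (rule eq[OF t_mult_V[OF a(2)]], rule eq[OF t_mult_V[OF a(3)]])
  then show "z \<in> \<mm> \<longleftrightarrow> z' \<in> \<mm>" using \<phi>_V(2)[OF a(1)] by simp
qed

text \<open>The conditions \<open>t ^ N * z \<in> V\<close> characterise 0 and are carried from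
  \<open>z\<close> to \<open>z'\<close>. This makes the closure single-valued.\<close>

lemma \<Phi>_zero: assumes "(z, z') \<in> \<Phi>" shows "z = 0 \<longleftrightarrow> z' = 0"
  using \<Phi>_V(1)[OF assms] t_adic_separated[of z] t_adic_separated[of z'] V_0 by (metis mult_zero_right)

lemma \<Phi>_bound: assumes "(z, z') \<in> \<Phi>" shows "\<exists>C. inverse t ^ C * z \<in> V \<and> inverse t ^ C * z' \<in> V"
proof -
  obtain a a' where a: "(a, a') \<in> \<phi>" "t ^ 0 * (z - a) \<in> V" "t ^ 0 * (z' - a') \<in> V"
    using \<Phi>E[OF assms] by blast
  obtain C where C: "inverse t ^ C * a \<in> V" "inverse t ^ C * a' \<in> V" using \<phi>_bound[OF a(1)] by blast
  have "inverse t ^ C * (z - a) + inverse t ^ C * a \<in> V" "inverse t ^ C * (z' - a') + inverse t ^ C * a' \<in> V"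
    using a(2,3) C \<mm>_V[OF inverse_t] by (auto intro!: V_add V_mult V_power)
  then show ?thesis by (auto simp: right_diff_distrib intro!: exI[of _ C])
qed

text \<open>Continuity of multiplication: \<open>C\<close> and \<open>D\<close> bound the poles of
  the factors, and this much additional precision is spent.\<close>

lemma product_close:
  assumes "inverse t ^ C * z \<in> V" "inverse t ^ D * w \<in> V"
    "t ^ (N + C + D) * (z - a) \<in> V" "t ^ (N + C + D) * (w - b) \<in> V"
  shows "t ^ N * (z * w - a * b) \<in> V"
proof -
  have "w - b \<in> V" using t_power_mono[OF assms(4), of 0] by simp
  then have "inverse t ^ D * (w - b) \<in> V" using \<mm>_V[OF inverse_t] by (intro V_mult V_power)
  from V_diff[OF assms(2) this] have b: "inverse t ^ D * b \<in> V" by (simp add: right_diff_distrib)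
  have 1: "t ^ (N + C) * (w - b) \<in> V" "t ^ (N + D) * (z - a) \<in> V"
    by (rule t_power_mono[OF assms(4)] t_power_mono[OF assms(3)]; simp)+
  have "t ^ N * (z * w - a * b) = (inverse t ^ C * z) * (t ^ (N + C) * (w - b)) + (inverse t ^ D * b) * (t ^ (N + D) * (z - a))"
  proof -
    have e: "inverse t ^ j * t ^ (N + j) = t ^ N" for j
      using t_nonzero by (simp add: power_add power_inverse)
    have A: "(inverse t ^ C * z) * (t ^ (N + C) * (w - b)) = (inverse t ^ C * t ^ (N + C)) * (z * (w - b))"
      by (simp only: mult_ac)
    have B: "(inverse t ^ D * b) * (t ^ (N + D) * (z - a)) = (inverse t ^ D * t ^ (N + D)) * (b * (z - a))"
      by (simp only: mult_ac)
    show ?thesis unfolding A B e by (simp add: algebra_simps)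
  qed
  also have "\<dots> \<in> V" by (intro V_add V_mult[OF assms(1) 1(1)] V_mult[OF b 1(2)])
  finally show ?thesis .
qed

text \<open>Continuity of inversion away from 0: \<open>t ^ C * z \<notin> V\<close> bounds the
  inverse of \<open>z\<close>, and then that of \<open>a\<close>, by \<open>t ^ C\<close>. Dividing
  by both costs \<open>2 * C\<close> powers of \<open>t\<close>.\<close>

lemma inverse_close:
  assumes z: "z \<in> M" "t ^ C * z \<notin> V" and a: "a \<in> M" "t ^ (N + 2 * C) * (z - a) \<in> V"
  shows "t ^ N * (inverse z - inverse a) \<in> V"
proof -
  have "t ^ C * (z - a) \<in> V" by (rule t_power_mono[OF a(2)]) simp
  then have a': "t ^ C * a \<notin> V" using z(2) V_add[of "t ^ C * a" "t ^ C * (z - a)"] by (auto simp: right_diff_distrib)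
  have nz: "z \<noteq> 0" "a \<noteq> 0" using z(2) a' V_0 by auto
  have tM: "t ^ C * z \<in> M" "t ^ C * a \<in> M" by (intro subfield_closed M t_M z a)+
  then have iV: "inverse (t ^ C * z) \<in> V" "inverse (t ^ C * a) \<in> V" using V_total z(2) a' by blast+
  have "t ^ N * (inverse z - inverse a) = - ((t ^ (N + 2 * C) * (z - a)) * (inverse (t ^ C * z) * inverse (t ^ C * a)))"
  proof -
    have "t ^ (N + 2 * C) = t ^ N * t ^ C * t ^ C" by (simp add: power_add mult_2)
    then show ?thesis using nz t_nonzero by (simp add: field_simps)
  qed
  also have "\<dots> \<in> V" by (intro V_uminus V_mult[OF a(2)] V_mult iV)
  finally show ?thesis .
qed

lemma hom_graph_\<Phi>: "hom_graph \<Phi>"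
proof (rule hom_graphI)
  show "(1, 1) \<in> \<Phi>" using \<phi>_sub_\<Phi> hom_graph_1[OF hom_graph_\<phi>] by blast
next
  fix z z' w w' assume zw: "(z, z') \<in> \<Phi>" "(w, w') \<in> \<Phi>"
  have "\<exists>a a'. (a, a') \<in> \<phi> \<and> t ^ N * ((z - w) - a) \<in> V \<and> t ^ N * ((z' - w') - a') \<in> V" for N
  proof -
    obtain a a' where a: "(a, a') \<in> \<phi>" "t ^ N * (z - a) \<in> V" "t ^ N * (z' - a') \<in> V" using \<Phi>E[OF zw(1)] by blast
    obtain b b' where b: "(b, b') \<in> \<phi>" "t ^ N * (w - b) \<in> V" "t ^ N * (w' - b') \<in> V" using \<Phi>E[OF zw(2)] by blast
    have "(a - b, a' - b') \<in> \<phi>" by (rule hom_graph_diff[OF hom_graph_\<phi> a(1) b(1)])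
    moreover have "t ^ N * ((z - w) - (a - b)) \<in> V" "t ^ N * ((z' - w') - (a' - b')) \<in> V"
      using V_diff[OF a(2) b(2)] V_diff[OF a(3) b(3)] by (auto simp: algebra_simps)
    ultimately show ?thesis by blast
  qed
  then show "(z - w, z' - w') \<in> \<Phi>" unfolding \<Phi>_def by blast
  obtain C where C: "inverse t ^ C * z \<in> V" "inverse t ^ C * z' \<in> V" using \<Phi>_bound[OF zw(1)] by blast
  obtain D where D: "inverse t ^ D * w \<in> V" "inverse t ^ D * w' \<in> V" using \<Phi>_bound[OF zw(2)] by blast
  have "\<exists>a a'. (a, a') \<in> \<phi> \<and> t ^ N * (z * w - a) \<in> V \<and> t ^ N * (z' * w' - a') \<in> V" for N
  proof -
    let ?N = "N + C + D"
    obtain a a' where a: "(a, a') \<in> \<phi>" "t ^ ?N * (z - a) \<in> V" "t ^ ?N * (z' - a') \<in> V" using \<Phi>E[OF zw(1)] by blast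
    obtain b b' where b: "(b, b') \<in> \<phi>" "t ^ ?N * (w - b) \<in> V" "t ^ ?N * (w' - b') \<in> V" using \<Phi>E[OF zw(2)] by blast
    show ?thesis
      using hom_graph_mult[OF hom_graph_\<phi> a(1) b(1)] product_close[OF C(1) D(1) a(2) b(2)]
        product_close[OF C(2) D(2) a(3) b(3)] by blast
  qed
  then show "(z * w, z' * w') \<in> \<Phi>" unfolding \<Phi>_def by blast
next
  fix z z' assume z: "(z, z') \<in> \<Phi>"
  show "(inverse z, inverse z') \<in> \<Phi>"
  proof (cases "z = 0")
    case True
    then show ?thesis using \<Phi>_zero[OF z] z by simp
  next
    case False
    then obtain C where C: "t ^ C * z \<notin> V" using t_adic_separated by blast
    then have C': "t ^ C * z' \<notin> V" using \<Phi>_V(1)[OF z] by blast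
    have "\<exists>a a'. (a, a') \<in> \<phi> \<and> t ^ N * (inverse z - a) \<in> V \<and> t ^ N * (inverse z' - a') \<in> V" for N
    proof -
      let ?N = "N + 2 * C"
      obtain a a' where a: "(a, a') \<in> \<phi>" "t ^ ?N * (z - a) \<in> V" "t ^ ?N * (z' - a') \<in> V" using \<Phi>E[OF z] by blast
      show ?thesis
        using hom_graph_inverse[OF hom_graph_\<phi> a(1)]
          inverse_close[OF \<Phi>_M(1)[OF z] C \<phi>_M(1)[OF a(1)] a(2)]
          inverse_close[OF \<Phi>_M(2)[OF z] C' \<phi>_M(2)[OF a(1)] a(3)] by blast
    qed
    then show ?thesis unfolding \<Phi>_def by blast
  qed
next
  fix y assume "(0, y) \<in> \<Phi>"
  then show "y = 0" using \<Phi>_zero by blast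
qed

text \<open>A step is a rational expression over \<open>K\<close> in \<open>x n\<close>,
  \<open>z\<close>, \<open>b\<close> and \<open>t\<close>, so it is carried to the step on the other
  branch with \<open>z\<close> replaced by \<open>\<tau> z\<close>.\<close>

lemma \<phi>_newton:
  assumes "z \<in> k" "(b, b') \<in> \<phi>"
  shows "(newton n (x n) z b, newton n (x' n) (\<tau> z) b') \<in> \<phi>"
proof -
  note H = hom_graph_\<phi>
  have Kphi: "(a, a) \<in> \<phi>" if "a \<in> K" for a
    using \<phi>_const[of a] that K_sub_k \<tau> by (auto simp: Gal_carrier)
  have div: "(a / b, a' / b') \<in> \<phi>" if "(a, a') \<in> \<phi>" "(b, b') \<in> \<phi>" for a a' b b'
    using hom_graph_mult[OF H that(1) hom_graph_inverse[OF H that(2)]] by (simp add: divide_inverse)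
  have F: "(poly (F n) a, poly (F n) a') \<in> \<phi>" if "(a, a') \<in> \<phi>" for a a'
    using hom_graph_poly[OF H poly_graph_same[OF FK, of \<phi>] that] Kphi by auto
  show ?thesis unfolding newton_def
    by (intro hom_graph_diff[OF H] hom_graph_mult[OF H] div F \<phi>_power \<phi>_x \<phi>_t \<phi>_const assms Kphi c_K subfield_of_nat[OF K])
qed

lemma \<tau>_\<mu>: assumes "z \<in> \<mu> n" shows "\<tau> z \<in> \<mu> n"
proof -
  have "(poly (monom 1 (d ^ n)) z, poly (monom 1 (d ^ n)) (\<tau> z)) \<in> G\<^sub>k"
    using \<mu>_k[OF assms] by (intro hom_graph_poly[OF Gk poly_graph_same[OF _ Gk_K]] poly_over_monom K subfield_1)
     (auto simp: graph_on_iff)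
  moreover have "\<tau> 1 = 1" using \<tau> subfield_1[OF K] by (simp add: Gal_carrier)
  ultimately show ?thesis using assms by (simp add: \<mu>_def poly_monom graph_on_iff)
qed

text \<open>Vertices whose residues correspond under \<tau> are limits of corresponding Newton
  iterates.\<close>

lemma \<Phi>_level:
  assumes y: "y \<in> lv n" and y': "y' \<in> lv n" and z: "z \<in> \<mu> n"
    and yz: "y / x n - z \<in> \<mm>" "y' / x' n - \<tau> z \<in> \<mm>"
  shows "(y, y') \<in> \<Phi>"
proof -
  have zk: "z \<in> k" using \<mu>_k[OF z] by simp
  have it: "((newton n (x n) z ^^ j) z, (newton n (x' n) (\<tau> z) ^^ j) (\<tau> z)) \<in> \<phi>" for j
    by (induction j) (auto intro: \<phi>_newton \<phi>_const zk[unfolded mem_Collect_eq] simp: zk[unfolded mem_Collect_eq])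
  have "\<exists>a a'. (a, a') \<in> \<phi> \<and> t ^ N * (y - a) \<in> V \<and> t ^ N * (y' - a') \<in> V" for N
    using newton_approx[OF branch_level[OF x] y z yz(1), of N]
      newton_approx[OF branch_level[OF x'] y' \<tau>_\<mu>[OF z] yz(2), of N]
      hom_graph_mult[OF hom_graph_\<phi> \<phi>_x[of n] it[of "d ^ n * N"]] by blast
  then show ?thesis unfolding \<Phi>_def by blast
qed

text \<open>\<open>M\<close> is generated by \<open>k\<close> and the vertices. For a vertex
  \<open>y\<close>, \<open>residue_surj\<close> supplies the partner on the other side with the
  residue prescribed by \<tau>.\<close>

lemma Domain_\<Phi>: "M \<subseteq> Domain \<Phi>"
  unfolding M_def
proof (rule preimage_field_minimal[OF subfield_Domain[OF hom_graph_\<Phi>]])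
  show "k \<subseteq> Domain \<Phi>" using \<phi>_const \<phi>_sub_\<Phi> by blast
  show "tree f t \<subseteq> Domain \<Phi>"
  proof
    fix y assume "y \<in> tree f t"
    then obtain n where y: "y \<in> lv n" by (rule treeE)
    obtain z where z: "z \<in> \<mu> n" "y / x n - z \<in> \<mm>" using residue_exists[OF y branch_level[OF x]] .
    obtain y' where "y' \<in> lv n" "y' / x' n - \<tau> z \<in> \<mm>"
      using residue_surj[OF branch_level[OF x'] \<tau>_\<mu>[OF z(1)]] .
    then show "y \<in> Domain \<Phi>" using \<Phi>_level[OF y _ z(1,2)] by blast
  qed
qed

text \<open>The prolongation takes place over \<open>K(t)\<close> and not over \<open>k(t)\<close>,
  since \<tau> may move \<open>k\<close>.\<close>

lemma lift_exists:
  obtains h where "bij h" "\<And>u v. h (u + v) = h u + h v" "\<And>u v. h (u * v) = h u * h v"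
    "\<And>z. z \<in> M \<Longrightarrow> (z, h z) \<in> \<Phi>"
proof -
  have "is_subfield (Domain (\<Phi> \<inter> Id))"
    by (intro subfield_Domain hom_graph_Int hom_graph_\<Phi> hom_graph_Id)
  moreover have "(a, a) \<in> \<Phi>" if "a \<in> K" for a
    using \<phi>_const[of a] that K_sub_k \<tau> \<phi>_sub_\<Phi> by (auto simp: Gal_carrier)
  then have "K \<subseteq> Domain (\<Phi> \<inter> Id)" by blast
  moreover have "{t} \<subseteq> Domain (\<Phi> \<inter> Id)" using \<phi>_t \<phi>_sub_\<Phi> by blast
  ultimately have "field_adjoin K {t} \<subseteq> Domain (\<Phi> \<inter> Id)" by (rule field_adjoin_minimal)
  then have sub: "Id_on (field_adjoin K {t}) \<subseteq> \<Phi>" by auto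
  obtain h where h: "bij h" "\<And>u v. h (u + v) = h u + h v" "\<And>u v. h (u * v) = h u * h v"
    "\<And>u v. (u, v) \<in> \<Phi> \<Longrightarrow> h u = v"
    using automorphism_extension[OF hom_graph_\<Phi> subfield_field_adjoin sub splits_over_Kt] by blast
  show thesis
  proof (rule that[OF h(1-3)])
    fix z assume "z \<in> M"
    then obtain z' where "(z, z') \<in> \<Phi>" using Domain_\<Phi> by blast
    then show "(z, h z) \<in> \<Phi>" using h(4) by blast
  qed
qed

text \<open>For trivial \<tau> an approximating pair is one rational function evaluated on two
  branches, and its residue is a ratio of coefficients, the same for both. So the lift lies in the
  inertia group and not only in the decomposition group.\<close>

lemma \<Phi>_residue:
  assumes id: "\<And>a. a \<in> k \<Longrightarrow> \<tau> a = a" and z: "(z, z') \<in> \<Phi>" "z \<in> V"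
  shows "z' - z \<in> \<mm>"
proof -
  obtain a a' where a: "(a, a') \<in> \<phi>" "t ^ 1 * (z - a) \<in> V" "t ^ 1 * (z' - a') \<in> V"
    using \<Phi>E[OF z(1)] by blast
  have za: "z - a \<in> \<mm>" "z' - a' \<in> \<mm>" by (rule t_mult_V[OF a(2)], rule t_mult_V[OF a(3)])
  have aV: "a \<in> V" using V_diff[OF z(2) \<mm>_V[OF za(1)]] by simp
  obtain n p p' q q' where *: "poly_graph G\<^sub>k p p'" "poly_graph G\<^sub>k q q'" "q \<noteq> 0"
    "a = poly p (x n) / poly q (x n)" "a' = poly p' (x' n) / poly q' (x' n)"
    using a(1) unfolding \<phi>_def by blast
  have same: "r' = r" if "poly_graph G\<^sub>k r r'" for r r'
    using that id unfolding poly_graph_def poly_eq_iff by (auto simp: graph_on_iff)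
  have "a - a' \<in> \<mm>"
  proof (cases "p = 0")
    case True
    then show ?thesis using * same[OF *(1)] by (simp add: mem_\<mm> V_0)
  next
    case False
    then have "degree p \<le> degree q"
      using aV rational_V_iff(1)[OF branch_level[OF x] pg_k(1)[OF *(1)] False pg_k(1)[OF *(2)] *(3)] *(4) by simp
    then have r: "a - coeff p (degree q) / lead_coeff q \<in> \<mm>" "a' - coeff p (degree q) / lead_coeff q \<in> \<mm>"
      unfolding *(4,5) same[OF *(1)] same[OF *(2)]
      using rational_residue[OF _ pg_k(1)[OF *(1)] pg_k(1)[OF *(2)] *(3)] branch_level[OF x] branch_level[OF x'] by blast+
    show ?thesis using \<mm>_diff[OF r] by simp
  qed
  then have "((z' - a') - (z - a)) - (a - a') \<in> \<mm>" by (rule \<mm>_diff[OF \<mm>_diff[OF za(2,1)]])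
  then show ?thesis by (simp add: algebra_simps)
qed

end

section \<open>Automorphisms acting on the tree\<close>

definition field_aut :: "('a::field \<Rightarrow> 'a) \<Rightarrow> bool" where
  "field_aut h \<longleftrightarrow> bij h \<and> (\<forall>u v. h (u + v) = h u + h v \<and> h (u * v) = h u * h v)"

lemma field_autD:
  assumes "field_aut h"
  shows "bij h" "inj h" "h (u + v) = h u + h v" "h (u * v) = h u * h v"
  using assms by (auto simp: field_aut_def bij_def)

lemma field_aut_graph: "field_aut h \<Longrightarrow> is_subfield L \<Longrightarrow> hom_graph (graph_on L h)"
  by (rule hom_graph_on) (auto simp: field_autD intro: inj_on_subset[OF field_autD(2)])

lemma subfield_UNIV: "is_subfield UNIV" by (simp add: is_subfield_def)

lemma field_aut_diff: "field_aut h \<Longrightarrow> h (u - v) = h u - h v"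
  using field_autD(3)[of h "u - v" v] by simp

lemma field_aut_divide: assumes "field_aut h" shows "h (u / v) = h u / h v"
proof -
  have G: "hom_graph (graph_on UNIV h)" by (rule field_aut_graph[OF assms subfield_UNIV])
  have "(u * inverse v, h u * inverse (h v)) \<in> graph_on UNIV h"
    by (intro hom_graph_mult[OF G] hom_graph_inverse[OF G]) (simp_all add: graph_on_iff)
  then show ?thesis by (simp add: graph_on_iff divide_inverse)
qed

lemma field_aut_inv: assumes h: "field_aut h" shows "field_aut (inv_into UNIV h)"
proof -
  have s: "h (inv_into UNIV h u) = u" for u using field_autD(1)[OF h] by (simp add: bij_def surj_f_inv_f)
  have i: "inv_into UNIV h (h u) = u" for u using field_autD(2)[OF h] by simp
  have "inv_into UNIV h (u + v) = inv_into UNIV h u + inv_into UNIV h v" "inv_into UNIV h (u * v) = inv_into UNIV h u * inv_into UNIV h v" for u v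
    using i[of "inv_into UNIV h u + inv_into UNIV h v"] i[of "inv_into UNIV h u * inv_into UNIV h v"] by (simp_all add: field_autD[OF h] s)
  then show ?thesis using bij_imp_bij_inv[OF field_autD(1)[OF h]] by (simp add: field_aut_def)
qed

lemma Gal_UNIV: "h \<in> carrier (Gal UNIV F) \<longleftrightarrow> field_aut h \<and> (\<forall>x\<in>F. h x = x)"
  by (auto simp: Gal_carrier field_aut_def Bij_def)

lemma fixes_adjoin:
  assumes h: "hom_graph (graph_on L h)" and "field_adjoin F S \<subseteq> L"
    and "\<And>x. x \<in> F \<Longrightarrow> h x = x" "\<And>x. x \<in> S \<Longrightarrow> h x = x" and x: "x \<in> field_adjoin F S"
  shows "h x = x"
proof -
  have "hom_graph (graph_on L (\<lambda>x. x))"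
    using subfield_Domain[OF h] by (intro hom_graph_on) (auto simp: graph_on_def image_def Domain_unfold)
  from subfield_equalizer[OF h this] have "field_adjoin F S \<subseteq> {x \<in> L. h x = x}"
    by (rule field_adjoin_minimal) (use assms(2-4) field_adjoin_base field_adjoin_gen in blast)+
  then show ?thesis using x by blast
qed

context arboreal
begin

lemma aut_level:
  assumes h: "field_aut h" "\<And>a. a \<in> K \<Longrightarrow> h a = a" "h t = t" and y: "y \<in> lv n"
  shows "h y \<in> lv n"
proof -
  have "h (poly (F n) y) = poly (F n) (h y)"
    by (rule graph_on_poly[OF field_aut_graph[OF h(1) subfield_UNIV] _ h(2) FK]) auto
  then show ?thesis using y h(3) unfolding mem_level by metis
qed

lemma aut_k:
  assumes h: "field_aut h" "\<And>a. a \<in> K \<Longrightarrow> h a = a" and y: "y \<in> k"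
  shows "h y \<in> k"
proof -
  obtain p where p: "p \<noteq> 0" "poly_over K p" "poly p y = 0" using y algebraic_over_def'[OF K] by blast
  have "h (poly p y) = poly p (h y)"
    by (rule graph_on_poly[OF field_aut_graph[OF h(1) subfield_UNIV] _ h(2) p(2)]) auto
  moreover have "h 0 = 0" using h(2) subfield_0[OF K] by blast
  ultimately show ?thesis using p algebraic_over_def'[OF K] by auto
qed

lemma aut_M:
  assumes h: "field_aut h" "\<And>a. a \<in> K \<Longrightarrow> h a = a" "h t = t" and z: "z \<in> M"
  shows "h z \<in> M"
proof -
  have G: "hom_graph (graph_on UNIV h)" by (rule field_aut_graph[OF h(1) subfield_UNIV])
  have "hom_graph (graph_on UNIV h \<inter> UNIV \<times> M)"
    by (rule hom_graphI)
      (auto intro: hom_graph_1[OF G] hom_graph_diff[OF G] hom_graph_mult[OF G] hom_graph_inverse[OF G]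
        subfield_closed[OF M] dest: hom_graph_zeroD[OF G])
  from subfield_Domain[OF this] have "is_subfield {z. h z \<in> M}"
    by (rule back_subst[of is_subfield]) (auto simp: graph_on_iff)
  moreover have "k \<subseteq> {z. h z \<in> M}" using aut_k[OF h(1,2)] k_sub_M by blast
  moreover have "tree f t \<subseteq> {z. h z \<in> M}"
  proof
    fix y assume "y \<in> tree f t"
    then obtain n where "y \<in> lv n" by (rule treeE)
    then show "y \<in> {z. h z \<in> M}" using aut_level[OF h] level_sub_M by blast
  qed
  ultimately have "preimage_field k f t \<infinity> \<subseteq> {z. h z \<in> M}" by (rule preimage_field_minimal)
  then have "M \<subseteq> {z. h z \<in> M}" by (simp only: M_def[symmetric])
  then show ?thesis using z by blast
qed

lemma aut_inv:
  assumes h: "field_aut h" "\<And>a. a \<in> K \<Longrightarrow> h a = a" "h t = t"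
  shows "field_aut (inv_into UNIV h)" "\<And>a. a \<in> K \<Longrightarrow> inv_into UNIV h a = a" "inv_into UNIV h t = t"
  using field_aut_inv[OF h(1)] h(2,3) field_autD(2)[OF h(1)] by (auto intro!: inv_into_f_eq)

lemma aut_surj:
  assumes h: "field_aut h" "\<And>a. a \<in> K \<Longrightarrow> h a = a" "h t = t"
  shows "y \<in> lv n \<Longrightarrow> \<exists>u\<in>lv n. h u = y" "y \<in> M \<Longrightarrow> \<exists>u\<in>M. h u = y"
  using aut_level[OF aut_inv[OF h], of y n] aut_M[OF aut_inv[OF h], of y] field_autD(1)[OF h(1)]
  by (metis bij_inv_eq_iff)+

end

section \<open>Inertia\<close>

context place_at_infinity
begin

lemma inertia_transitive:
  assumes y: "y \<in> lv n" and y': "y' \<in> lv n"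
  shows "\<exists>\<rho>\<in>inertia_group M E V. \<rho> y = y'"
proof -
  obtain x where bx: "branch x" "x n = y" using branch_exists[OF y] .
  obtain x' where bx': "branch x'" "x' n = y'" using branch_exists[OF y'] .
  define \<tau> where "\<tau> = (\<lambda>a\<in>k. a)"
  have "\<tau> \<in> carrier (Gal k K)" unfolding \<tau>_def Gal_carrier
    using id_Bij[of k] K_sub_k subfield_add[OF k] subfield_mult[OF k] by auto
  then interpret branch_lift K t f V \<tau> x x' using bx bx' by unfold_locales
  obtain h where h: "bij h" "\<And>u v. h (u + v) = h u + h v" "\<And>u v. h (u * v) = h u * h v"
    "\<And>z. z \<in> M \<Longrightarrow> (z, h z) \<in> \<Phi>" using lift_exists by blast
  have hI: "h z = z'" if "(z, z') \<in> \<phi>" for z z'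
    using that \<phi>_sub_\<Phi> h(4) \<phi>_M(1) hom_graph_unique[OF hom_graph_\<Phi>] by blast
  have aut: "field_aut h" using h by (simp add: field_aut_def)
  have hk: "h a = a" if "a \<in> k" for a using hI[OF \<phi>_const] that unfolding \<tau>_def by auto
  have fx: "\<And>a. a \<in> K \<Longrightarrow> h a = a" "h t = t" using hk K_sub_k hI[OF \<phi>_t] by auto
  have hM: "h z \<in> M" if "z \<in> M" for z using aut_M[OF aut fx that] .
  have hV: "z \<in> V \<longleftrightarrow> h z \<in> V" if "z \<in> M" for z using \<Phi>_V(1)[OF h(4)[OF that], of 0] by simp
  define \<rho> where "\<rho> = restrict h M"
  have "bij_betw h M M"
    unfolding bij_betw_def using hM aut_surj(2)[OF aut fx] inj_on_subset[OF field_autD(2)[OF aut]] by blast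
  then have "\<rho> \<in> Bij M" unfolding \<rho>_def Bij_def by (simp cong: bij_betw_cong)
  moreover have "h a = a" if "a \<in> E" for a
    by (rule fixes_adjoin[OF field_aut_graph[OF aut subfield_UNIV] _ _ _ that]) (use hk fx in auto)
  ultimately have "\<rho> \<in> carrier (Gal M E)"
    unfolding Gal_carrier \<rho>_def using E_sub_M subfield_add[OF M] subfield_mult[OF M] h(2,3) by auto
  moreover have "\<rho> ` V = V"
  proof (rule equalityI; rule subsetI)
    fix z assume "z \<in> \<rho> ` V"
    then show "z \<in> V" unfolding \<rho>_def using hV V_sub_M by auto
  next
    fix z assume z: "z \<in> V"
    then obtain u where u: "u \<in> M" "h u = z" using aut_surj(2)[OF aut fx, of z] V_sub_M by blast
    then have "u \<in> V" using hV z by blast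
    moreover have "\<rho> u = z" unfolding \<rho>_def using u by simp
    ultimately show "z \<in> \<rho> ` V" by blast
  qed
  moreover have "\<rho> z - z \<in> \<mm>" if z: "z \<in> V" for z
    using \<Phi>_residue[OF _ h(4) z] z V_sub_M unfolding \<rho>_def \<tau>_def by auto
  ultimately have "\<rho> \<in> inertia_group M E V" unfolding inertia_group_def \<mm>_def by blast
  moreover have "\<rho> y = y'" using hI[OF \<phi>_x[of n]] bx bx' y level_sub_M unfolding \<rho>_def by auto
  ultimately show ?thesis by blast
qed

end

locale inertia = place_at_infinity K t f V for K :: "'a::field set" and t f V +
  fixes \<sigma> :: "'a \<Rightarrow> 'a"
  assumes \<sigma>: "\<sigma> \<in> inertia_group M E V"
    and \<sigma>_gen: "subtopology (pointwise_topology M) (carrier (Gal M E)) closure_of generate (Gal M E) {\<sigma>}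
      = inertia_group M E V"
begin

lemma \<sigma>_Gal: "\<sigma> \<in> carrier (Gal M E)" using \<sigma> by (simp add: inertia_group_def)

lemma \<sigma>_residue: "z \<in> V \<Longrightarrow> \<sigma> z - z \<in> \<mm>" using \<sigma> by (simp add: inertia_group_def \<mm>_def)

lemma \<sigma>_M: "z \<in> M \<Longrightarrow> \<sigma> z \<in> M"
  using \<sigma>_Gal Bij_mem by (auto simp: Gal_carrier)

lemma \<sigma>_E: "z \<in> E \<Longrightarrow> \<sigma> z = z" using \<sigma>_Gal by (simp add: Gal_carrier)

lemma \<sigma>_graph: "hom_graph (graph_on M \<sigma>)" by (rule hom_graph_Gal[OF M \<sigma>_Gal])

lemma \<sigma>_pow_M: "z \<in> M \<Longrightarrow> (\<sigma> ^^ i) z \<in> M" by (induction i) (auto simp: \<sigma>_M)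

lemma \<sigma>_pow_E: "z \<in> E \<Longrightarrow> (\<sigma> ^^ i) z = z" by (induction i) (auto simp: \<sigma>_E)

lemma \<sigma>_inj: "inj_on \<sigma> M" using \<sigma>_Gal Bij_bij_betw by (auto simp: Gal_carrier bij_betw_def)

lemma \<sigma>_pow_inj: "inj_on (\<sigma> ^^ i) M"
proof (induction i)
  case (Suc i)
  have "inj_on \<sigma> ((\<sigma> ^^ i) ` M)" by (rule inj_on_subset[OF \<sigma>_inj]) (use \<sigma>_pow_M in auto)
  from comp_inj_on[OF Suc this] show ?case by (simp add: comp_def)
qed simp

lemma \<sigma>_pow_graph: "hom_graph (graph_on M (\<sigma> ^^ i))"
proof (rule hom_graph_on[OF M \<sigma>_pow_inj])
  show "(\<sigma> ^^ i) (u + v) = (\<sigma> ^^ i) u + (\<sigma> ^^ i) v" "(\<sigma> ^^ i) (u * v) = (\<sigma> ^^ i) u * (\<sigma> ^^ i) v"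
    if "u \<in> M" "v \<in> M" for u v
    using that \<sigma>_Gal \<sigma>_pow_M by (induction i) (auto simp: Gal_carrier)
qed

lemma \<sigma>_level: assumes "y \<in> lv n" shows "\<sigma> y \<in> lv n"
proof -
  have KE: "K \<subseteq> E" using K_sub_k field_adjoin_base by blast
  have "y \<in> M" using assms level_sub_M by blast
  have "\<sigma> (poly (F n) y) = poly (F n) (\<sigma> y)"
    by (rule graph_on_poly[OF \<sigma>_graph _ _ FK \<open>y \<in> M\<close>]) (use KE E_sub_M \<sigma>_E in auto)
  moreover have "\<sigma> t = t" using \<sigma>_E field_adjoin_gen[of "{t}" k] by auto
  ultimately show ?thesis using assms unfolding mem_level by metis
qed

lemma \<sigma>_pow_level: "y \<in> lv n \<Longrightarrow> (\<sigma> ^^ i) y \<in> lv n" by (induction i) (auto simp: \<sigma>_level)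

lemma level_nonempty: "\<exists>y. y \<in> lv n"
  using level_split(1,2)[of n] d_power_pos[of n] by (metis card.empty ex_in_conv less_irrefl)

text \<open>The tame character of inertia. The ratio \<open>u = y / w\<close> lies in
  \<open>V\<close>, so \<open>\<sigma> u - u\<close> lies in \<open>\<mm>\<close>; therefore
  \<open>\<sigma> y / y\<close> and \<open>\<sigma> w / w\<close> have the same residue.\<close>

lemma inertia_character_exists: "\<exists>\<omega>\<in>\<mu> n. \<forall>y\<in>lv n. \<sigma> y / y - \<omega> \<in> \<mm>"
proof -
  obtain w where w: "w \<in> lv n" using level_nonempty by blast
  obtain \<omega> where \<omega>: "\<omega> \<in> \<mu> n" "\<sigma> w / w - \<omega> \<in> \<mm>" using residue_exists[OF \<sigma>_level[OF w] w] .
  have "\<sigma> y / y - \<omega> \<in> \<mm>" if y: "y \<in> lv n" for y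
  proof -
    define u where "u = y / w"
    have nz: "y \<noteq> 0" "w \<noteq> 0" "\<sigma> w \<noteq> 0" using level_nonzero y w \<sigma>_level by auto
    have M': "y \<in> M" "w \<in> M" using y w level_sub_M by auto
    have "(y * inverse w, \<sigma> y * inverse (\<sigma> w)) \<in> graph_on M \<sigma>"
      by (intro hom_graph_mult[OF \<sigma>_graph] hom_graph_inverse[OF \<sigma>_graph]) (simp_all add: graph_on_iff M')
    then have su: "\<sigma> u = \<sigma> y / \<sigma> w" by (simp add: graph_on_iff u_def divide_inverse)
    have "\<sigma> y / y - \<sigma> w / w = (\<sigma> w / y) * (\<sigma> u - u)"
      unfolding su using nz by (simp add: u_def field_simps)
    also have "\<dots> \<in> \<mm>"
      using \<sigma>_residue ratio_V(1)[OF y w] ratio_V(1)[OF \<sigma>_level[OF w] y] by (intro \<mm>_mult) (auto simp: u_def)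
    finally have "(\<sigma> y / y - \<sigma> w / w) + (\<sigma> w / w - \<omega>) \<in> \<mm>" using \<omega>(2) v_idealD(5)[OF v_ideal_\<mm>] by blast
    then show ?thesis by simp
  qed
  then show ?thesis using \<omega>(1) by blast
qed

definition \<omega> :: "nat \<Rightarrow> 'a" where "\<omega> n = (SOME z. z \<in> \<mu> n \<and> (\<forall>y\<in>lv n. \<sigma> y / y - z \<in> \<mm>))"

lemma \<omega>: "\<omega> n \<in> \<mu> n" "y \<in> lv n \<Longrightarrow> \<sigma> y / y - \<omega> n \<in> \<mm>"
proof -
  have "\<exists>z. z \<in> \<mu> n \<and> (\<forall>y\<in>lv n. \<sigma> y / y - z \<in> \<mm>)" using inertia_character_exists by blast
  then have "\<omega> n \<in> \<mu> n \<and> (\<forall>y\<in>lv n. \<sigma> y / y - \<omega> n \<in> \<mm>)" unfolding \<omega>_def by (rule someI_ex)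
  then show "\<omega> n \<in> \<mu> n" "y \<in> lv n \<Longrightarrow> \<sigma> y / y - \<omega> n \<in> \<mm>" by auto
qed

lemma \<omega>_pow: assumes y: "y \<in> lv n" shows "(\<sigma> ^^ i) y / y - \<omega> n ^ i \<in> \<mm>"
proof (induction i)
  case 0
  then show ?case using level_nonzero[OF y] by (simp add: mem_\<mm> V_0)
next
  case (Suc i)
  let ?u = "(\<sigma> ^^ i) y"
  have u: "?u \<in> lv n" by (rule \<sigma>_pow_level[OF y])
  have "\<sigma> ?u / ?u * (?u / y) - \<omega> n * \<omega> n ^ i \<in> \<mm>"
    using \<omega>(2)[OF u] Suc ratio_V(1)[OF \<sigma>_level[OF u] u] V_power[OF \<mu>_V[OF \<omega>(1)]]
    by (intro cong_mult[OF v_ideal_\<mm>])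
  then show ?case using level_nonzero[OF u] by simp
qed

text \<open>Residues relative to \<open>y\<close> determine vertices, so on level \<open>n\<close> a
  power of \<sigma> acts through the corresponding power of \<open>\<omega> n\<close>.\<close>

lemma \<sigma>_pow_cong:
  assumes "y \<in> lv n" "\<omega> n ^ i = \<omega> n ^ j" shows "(\<sigma> ^^ i) y = (\<sigma> ^^ j) y"
  by (rule residue_unique[OF \<sigma>_pow_level[OF assms(1)] \<sigma>_pow_level[OF assms(1)] assms(1) \<omega>_pow[OF assms(1)]])
     (use \<omega>_pow[OF assms(1), of j] assms(2) in simp)

lemma \<sigma>_order: "y \<in> lv n \<Longrightarrow> (\<sigma> ^^ (d ^ n)) y = y"
  using \<sigma>_pow_cong[of y n "d ^ n" 0] \<omega>(1)[of n] by (simp add: \<mu>_def)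

text \<open>On level \<open>n\<close> the inverse of \<sigma> is its power with exponent
  \<open>d ^ n - 1\<close>, so natural exponents suffice. The exponent serves all vertices of the
  level simultaneously.\<close>

lemma generate_power:
  assumes "\<rho> \<in> generate (Gal M E) {\<sigma>}"
  shows "\<exists>j. \<forall>y\<in>lv n. \<rho> y = (\<sigma> ^^ j) y"
  using assms
proof (induction rule: generate.induct)
  case one
  show ?case using level_sub_M by (intro exI[of _ 0]) (auto simp: Gal_def BijGroup_def)
next
  case (incl h)
  then show ?case by (intro exI[of _ 1]) auto
next
  case (inv h)
  interpret G: group "Gal M E" by (rule group_Gal[OF M E_sub_M])
  define \<rho> where "\<rho> = inv\<^bsub>Gal M E\<^esub> \<sigma>"
  have \<rho>: "\<rho> \<in> carrier (Gal M E)" unfolding \<rho>_def by (rule G.inv_closed[OF \<sigma>_Gal])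
  have "\<rho> \<otimes>\<^bsub>Gal M E\<^esub> \<sigma> = \<one>\<^bsub>Gal M E\<^esub>" unfolding \<rho>_def by (rule G.l_inv[OF \<sigma>_Gal])
  then have eq: "compose M \<rho> \<sigma> = (\<lambda>x\<in>M. x)"
    using \<rho> \<sigma>_Gal by (simp add: Gal_def BijGroup_def)
  have "\<rho> y = (\<sigma> ^^ (d ^ n - 1)) y" if y: "y \<in> lv n" for y
  proof -
    have "\<sigma> ((\<sigma> ^^ (d ^ n - 1)) y) = y"
      using \<sigma>_order[OF y] d_power_pos[of n] by (cases "d ^ n") auto
    moreover have "(\<sigma> ^^ (d ^ n - 1)) y \<in> M" using \<sigma>_pow_level[OF y] level_sub_M by blast
    ultimately show ?thesis using fun_cong[OF eq, of "(\<sigma> ^^ (d ^ n - 1)) y"] by (simp add: compose_def)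
  qed
  then show ?case using inv by (auto simp: \<rho>_def)
next
  case (eng h1 h2)
  have sub: "generate (Gal M E) {\<sigma>} \<subseteq> carrier (Gal M E)"
    by (rule group.generate_incl[OF group_Gal[OF M E_sub_M]]) (use \<sigma>_Gal in auto)
  obtain i j where ij: "\<And>y. y \<in> lv n \<Longrightarrow> h1 y = (\<sigma> ^^ i) y" "\<And>y. y \<in> lv n \<Longrightarrow> h2 y = (\<sigma> ^^ j) y"
    using eng.IH by blast
  have "(h1 \<otimes>\<^bsub>Gal M E\<^esub> h2) y = (\<sigma> ^^ (i + j)) y" if y: "y \<in> lv n" for y
  proof -
    have "h1 \<in> Bij M" "h2 \<in> Bij M" using eng.hyps sub by (auto simp: Gal_carrier)
    then have "(h1 \<otimes>\<^bsub>Gal M E\<^esub> h2) y = h1 (h2 y)"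
      using y level_sub_M by (auto simp: Gal_def BijGroup_def compose_def)
    then show ?thesis using ij y \<sigma>_pow_level[OF y] by (simp add: funpow_add)
  qed
  then show ?case by blast
qed

text \<open>Some inertia element sends \<open>y\<close> to \<open>y'\<close>, and it is a limit of
  elements of the generated group. Having the value \<open>y'\<close> at \<open>y\<close> is an open
  condition, so an element of the generated group satisfies it already.\<close>

lemma \<sigma>_transitive:
  assumes y: "y \<in> lv n" and y': "y' \<in> lv n"
  shows "\<exists>j. y' = (\<sigma> ^^ j) y"
proof -
  obtain \<rho> where \<rho>: "\<rho> \<in> inertia_group M E V" "\<rho> y = y'" using inertia_transitive[OF y y'] by blast
  have yM: "y \<in> M" using y level_sub_M by blast
  let ?X = "pointwise_topology M"
  define U where "U = {h \<in> topspace ?X. h y \<in> {y'}} \<inter> carrier (Gal M E)"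
  have y'M: "y' \<in> M" using y' level_sub_M by blast
  have "continuous_map ?X (discrete_topology M) (\<lambda>h. h y)"
    unfolding pointwise_topology_def using continuous_map_product_projection[OF yM] by fastforce
  then have "openin ?X {h \<in> topspace ?X. h y \<in> {y'}}"
    by (rule openin_continuous_map_preimage) (simp add: y'M)
  then have "openin (subtopology ?X (carrier (Gal M E))) U" unfolding U_def by (auto simp: openin_subtopology)
  moreover have "\<rho> \<in> U"
  proof -
    have "\<rho> \<in> carrier (Gal M E)" using \<rho>(1) by (simp add: inertia_group_def)
    then have "\<rho> \<in> Bij M" by (simp add: Gal_carrier)
    then have "\<rho> \<in> topspace ?X" using Bij_mem[of \<rho> M]
      by (auto simp: pointwise_topology_def PiE_def Bij_imp_extensional)
    then show ?thesis unfolding U_def using \<rho> by (auto simp: inertia_group_def)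
  qed
  moreover have "\<rho> \<in> subtopology ?X (carrier (Gal M E)) closure_of generate (Gal M E) {\<sigma>}"
    using \<rho>(1) \<sigma>_gen by simp
  ultimately obtain h where "h \<in> generate (Gal M E) {\<sigma>}" "h \<in> U"
    unfolding in_closure_of by blast
  then show ?thesis using generate_power[of h n] y unfolding U_def by auto
qed

text \<open>The lift along a single branch preserves \<open>\<mm>\<close>; applied to
  \<open>\<sigma> y / y - \<omega> n\<close> it shows that \<open>h (\<sigma> y) / h y\<close> has
  residue \<open>\<omega> n ^ j\<close>. The vertex \<open>(\<sigma> ^^ j) (h y)\<close> has the
  same residue relative to \<open>h y\<close>.\<close>

lemma semilinear_lift:
  assumes \<tau>: "\<tau> \<in> carrier (Gal k K)"
  obtains h where "field_aut h" "\<And>a. a \<in> k \<Longrightarrow> h a = \<tau> a" "h t = t"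
    "\<And>n y j. y \<in> lv n \<Longrightarrow> \<tau> (\<omega> n) = \<omega> n ^ j \<Longrightarrow> h (\<sigma> y) = (\<sigma> ^^ j) (h y)"
proof -
  obtain x where x: "branch x" using branch_exists[OF t_level] by blast
  interpret branch_lift K t f V \<tau> x x using x \<tau> by unfold_locales
  obtain h where h: "bij h" "\<And>u v. h (u + v) = h u + h v" "\<And>u v. h (u * v) = h u * h v"
    "\<And>z. z \<in> M \<Longrightarrow> (z, h z) \<in> \<Phi>" using lift_exists by blast
  have hI: "h z = z'" if "(z, z') \<in> \<phi>" for z z'
    using that \<phi>_sub_\<Phi> h(4) \<phi>_M(1) hom_graph_unique[OF hom_graph_\<Phi>] by blast
  have aut: "field_aut h" using h by (simp add: field_aut_def)
  have hk: "h a = \<tau> a" if "a \<in> k" for a using hI[OF \<phi>_const] that by auto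
  have fx: "\<And>a. a \<in> K \<Longrightarrow> h a = a" "h t = t" using hk K_sub_k hI[OF \<phi>_t] \<tau> by (auto simp: Gal_carrier)
  show thesis
  proof (rule that[OF aut hk fx(2)])
    fix n y j assume y: "y \<in> lv n" and j: "\<tau> (\<omega> n) = \<omega> n ^ j"
    have hy: "h y \<in> lv n" "h (\<sigma> y) \<in> lv n" using aut_level[OF aut fx] y \<sigma>_level by auto
    have "\<sigma> y / y - \<omega> n \<in> \<mm>" by (rule \<omega>(2)[OF y])
    then have "h (\<sigma> y / y - \<omega> n) \<in> \<mm>" using \<Phi>_V(2)[OF h(4)] \<mm>_V V_sub_M by blast
    moreover have "h (\<omega> n) = \<omega> n ^ j" using hk \<mu>_k[OF \<omega>(1)] j by simp
    ultimately have 1: "h (\<sigma> y) / h y - \<omega> n ^ j \<in> \<mm>"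
      by (simp add: field_aut_diff[OF aut] field_aut_divide[OF aut])
    show "h (\<sigma> y) = (\<sigma> ^^ j) (h y)"
      by (rule residue_unique[OF hy(2) \<sigma>_pow_level[OF hy(1)] hy(1) 1 \<omega>_pow[OF hy(1)]])
  qed auto
qed

text \<open>The centralizer of the full cycle \<open>\<sigma>\<close> on a level consists of the powers of \<open>\<sigma>\<close>, so a conjugation as
  below makes the lift of \<open>\<tau>\<close> agree on the level with an automorphism over \<open>k(t)\<close>.\<close>

lemma conjugate_fixes_constants:
  assumes \<tau>: "\<tau> \<in> carrier (Gal k K)" and j: "\<tau> (\<omega> n) = \<omega> n ^ j"
    and \<gamma>: "field_aut \<gamma>" "\<And>a. a \<in> E \<Longrightarrow> \<gamma> a = a"
    and conj: "\<And>y. y \<in> lv n \<Longrightarrow> \<gamma> (\<sigma> y) = (\<sigma> ^^ j) (\<gamma> y)"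
    and z: "z \<in> field_adjoin K (lv n)" "algebraic_over K z"
  shows "\<tau> z = z"
proof -
  obtain h where h: "field_aut h" "\<And>a. a \<in> k \<Longrightarrow> h a = \<tau> a" "h t = t"
    "\<And>n y j. y \<in> lv n \<Longrightarrow> \<tau> (\<omega> n) = \<omega> n ^ j \<Longrightarrow> h (\<sigma> y) = (\<sigma> ^^ j) (h y)"
    using semilinear_lift[OF \<tau>] by blast
  have hK: "h a = a" if "a \<in> K" for a using h(2) that K_sub_k \<tau> by (auto simp: Gal_carrier)
  have \<gamma>K: "\<gamma> a = a" if "a \<in> K" for a using \<gamma>(2) that K_sub_k field_adjoin_base[of k] by blast
  have \<gamma>t: "\<gamma> t = t" using \<gamma>(2) field_adjoin_gen[of "{t}" k] by blast
  define \<delta> where "\<delta> = inv_into UNIV \<gamma>"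
  note \<delta> = aut_inv[OF \<gamma>(1) \<gamma>K \<gamma>t, folded \<delta>_def]
  have \<gamma>\<delta>: "\<gamma> (\<delta> u) = u" and \<delta>\<gamma>: "\<delta> (\<gamma> u) = u" for u
    using field_autD(1,2)[OF \<gamma>(1)] by (auto simp: \<delta>_def bij_def surj_f_inv_f)
  define c where "c = (\<lambda>y. \<delta> (h y))"
  have cl: "c y \<in> lv n" if "y \<in> lv n" for y
    unfolding c_def by (intro aut_level[OF \<delta>] aut_level[OF h(1) hK h(3)] that)
  have comm: "c (\<sigma> y) = \<sigma> (c y)" if y: "y \<in> lv n" for y
  proof -
    have "\<gamma> (\<sigma> (c y)) = (\<sigma> ^^ j) (h y)" using conj[OF cl[OF y]] by (simp add: c_def \<gamma>\<delta>)
    also have "\<dots> = h (\<sigma> y)" using h(4)[OF y j] by simp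
    finally show ?thesis unfolding c_def using \<delta>\<gamma> by metis
  qed
  have comm_pow: "c ((\<sigma> ^^ m) y) = (\<sigma> ^^ m) (c y)" if y: "y \<in> lv n" for m y
    by (induction m) (auto simp: comm \<sigma>_pow_level[OF y])
  obtain y0 where y0: "y0 \<in> lv n" using level_nonempty by blast
  obtain i where i: "c y0 = (\<sigma> ^^ i) y0" using \<sigma>_transitive[OF y0 cl[OF y0]] by blast
  have eq: "h y = \<gamma> ((\<sigma> ^^ i) y)" if y: "y \<in> lv n" for y
  proof -
    obtain m where m: "y = (\<sigma> ^^ m) y0" using \<sigma>_transitive[OF y0 y] by blast
    have "c y = (\<sigma> ^^ m) ((\<sigma> ^^ i) y0)" unfolding m using comm_pow[OF y0] i by simp
    also have "\<dots> = (\<sigma> ^^ i) y" unfolding m by (metis add.commute comp_apply funpow_add)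
    finally show ?thesis using \<gamma>\<delta>[of "h y"] by (simp add: c_def)
  qed
  have "hom_graph (graph_on M (\<lambda>y. \<gamma> ((\<sigma> ^^ i) y)))"
  proof (rule hom_graph_on[OF M])
    show "inj_on (\<lambda>y. \<gamma> ((\<sigma> ^^ i) y)) M"
      using comp_inj_on[OF \<sigma>_pow_inj inj_on_subset[OF field_autD(2)[OF \<gamma>(1)]]] by (simp add: comp_def)
    show "\<gamma> ((\<sigma> ^^ i) (u + v)) = \<gamma> ((\<sigma> ^^ i) u) + \<gamma> ((\<sigma> ^^ i) v)"
      "\<gamma> ((\<sigma> ^^ i) (u * v)) = \<gamma> ((\<sigma> ^^ i) u) * \<gamma> ((\<sigma> ^^ i) v)" if "u \<in> M" "v \<in> M" for u v
      using hom_graph_add[OF \<sigma>_pow_graph[of i], of u "(\<sigma> ^^ i) u" v "(\<sigma> ^^ i) v"]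
        hom_graph_mult[OF \<sigma>_pow_graph[of i], of u "(\<sigma> ^^ i) u" v "(\<sigma> ^^ i) v"] that
      by (simp_all add: graph_on_iff field_autD(3,4)[OF \<gamma>(1), symmetric])
  qed
  from subfield_equalizer[OF field_aut_graph[OF h(1) M] this]
  have "field_adjoin K (lv n) \<subseteq> {y \<in> M. h y = \<gamma> ((\<sigma> ^^ i) y)}"
  proof (rule field_adjoin_minimal)
    have KE: "K \<subseteq> E" using K_sub_k field_adjoin_base by blast
    show "K \<subseteq> {y \<in> M. h y = \<gamma> ((\<sigma> ^^ i) y)}" using KE E_sub_M hK \<gamma>K \<sigma>_pow_E by auto
    show "lv n \<subseteq> {y \<in> M. h y = \<gamma> ((\<sigma> ^^ i) y)}" using eq level_sub_M by auto
  qed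
  then have "h z = \<gamma> ((\<sigma> ^^ i) z)" using z(1) by blast
  moreover have "z \<in> E" using z(2) field_adjoin_base[of k "{t}"] by blast
  ultimately show ?thesis using h(2)[of z] z(2) \<sigma>_pow_E[of z i] \<gamma>(2)[of z] by simp
qed

lemma fixed_constants_conjugate:
  assumes \<tau>: "\<tau> \<in> carrier (Gal k K)" and fx: "\<And>z. z \<in> const_field K f t l \<Longrightarrow> \<tau> z = z"
  obtains \<gamma> where "field_aut \<gamma>" "\<And>a. a \<in> E \<Longrightarrow> \<gamma> a = a"
    "\<And>n y j. enat n \<le> l \<Longrightarrow> y \<in> lv n \<Longrightarrow> \<tau> (\<omega> n) = \<omega> n ^ j \<Longrightarrow> \<gamma> (\<sigma> y) = (\<sigma> ^^ j) (\<gamma> y)"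
proof -
  obtain h where h: "field_aut h" "\<And>a. a \<in> k \<Longrightarrow> h a = \<tau> a" "h t = t"
    "\<And>n y j. y \<in> lv n \<Longrightarrow> \<tau> (\<omega> n) = \<omega> n ^ j \<Longrightarrow> h (\<sigma> y) = (\<sigma> ^^ j) (h y)"
    using semilinear_lift[OF \<tau>] by blast
  define L where "L = preimage_field K f t l"
  have L: "is_subfield L" "K \<subseteq> L" "levels_upto f t l \<subseteq> L"
    unfolding L_def by (simp_all add: preimage_field_subfield preimage_field_base preimage_field_levels)
  have hK: "h a = a" if "a \<in> K" for a using h(2) that K_sub_k \<tau> by (auto simp: Gal_carrier)
  have "enat 0 \<le> l" by (simp flip: zero_enat_def)
  then have "t \<in> levels_upto f t l" using t_level by (auto simp: levels_upto_def)
  then have tL: "t \<in> L" using L(3) by blast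
  have G0: "hom_graph (graph_on L h)" by (rule field_aut_graph[OF h(1) L(1)])
  have KG0: "Id_on K \<subseteq> graph_on L h" using L(2) hK by (auto simp: graph_on_iff)
  \<comment> \<open>The compatibility required for gluing: the elements of \<open>L\<close>
    algebraic over \<open>K\<close> form \<open>const_field K f t l\<close>, on which
    \<open>h\<close> is \<tau> and hence trivial by assumption.\<close>
  have "y = z" if "(z, y) \<in> graph_on L h" "algebraic_over K z" for z y
    using that h(2)[of z] fx[of z] by (auto simp: graph_on_iff const_field_def L_def)
  then obtain G where G: "graph_on L h \<subseteq> G" "hom_graph G" "Id_on k \<subseteq> G"
    using hom_graph_glue[OF G0 K KG0, of k] algebraic_splits by blast
  have "is_subfield (Domain (G \<inter> Id))" by (intro subfield_Domain hom_graph_Int G(2) hom_graph_Id)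
  moreover have "(t, t) \<in> G" using G(1) tL h(3) by (auto simp: graph_on_iff)
  then have "{t} \<subseteq> Domain (G \<inter> Id)" by blast
  moreover have "K \<subseteq> Domain (G \<inter> Id)" using G(3) K_sub_k by blast
  ultimately have "field_adjoin K {t} \<subseteq> Domain (G \<inter> Id)" by (intro field_adjoin_minimal)
  then have sub: "Id_on (field_adjoin K {t}) \<subseteq> G" by auto
  obtain \<gamma> where \<gamma>: "bij \<gamma>" "\<And>u v. \<gamma> (u + v) = \<gamma> u + \<gamma> v" "\<And>u v. \<gamma> (u * v) = \<gamma> u * \<gamma> v"
    "\<And>u v. (u, v) \<in> G \<Longrightarrow> \<gamma> u = v"
    using automorphism_extension[OF G(2) subfield_field_adjoin sub splits_over_Kt] by blast
  have aut: "field_aut \<gamma>" using \<gamma> by (simp add: field_aut_def)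
  show thesis
  proof (rule that[OF aut])
    show "\<gamma> a = a" if "a \<in> E" for a
      by (rule fixes_adjoin[OF field_aut_graph[OF aut subfield_UNIV] _ _ _ that])
        (use \<gamma>(4) G(3) \<open>(t, t) \<in> G\<close> in auto)
    fix n y j assume n: "enat n \<le> l" and y: "y \<in> lv n" and j: "\<tau> (\<omega> n) = \<omega> n ^ j"
    have "\<gamma> u = h u" if "u \<in> lv n" for u
      using \<gamma>(4) G(1) L(3) that n by (auto simp: graph_on_iff levels_upto_def subset_iff)
    then show "\<gamma> (\<sigma> y) = (\<sigma> ^^ j) (\<gamma> y)" using h(4)[OF y j] y \<sigma>_level[OF y] by simp
  qed
qed

end

section \<open>The cyclotomic character\<close>

context rational_sep_closure
begin

lemma of_nat_nonzero: "\<not> CHAR('a) dvd n \<Longrightarrow> of_nat n \<noteq> (0::'a)"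
  by (simp add: of_nat_eq_0_iff_char_dvd)

lemma Gal_k_power:
  assumes \<tau>: "\<tau> \<in> carrier (Gal k K)" and z: "z \<in> k"
  shows "\<tau> (z ^ n) = \<tau> z ^ n"
proof -
  have "\<tau> (poly (monom 1 n) z) = poly (monom 1 n) (\<tau> z)"
    by (rule graph_on_poly[OF hom_graph_Gal[OF k \<tau>] K_sub_k _ poly_over_monom[OF K subfield_1[OF K]] z])
       (use \<tau> in \<open>simp add: Gal_carrier\<close>)
  then show ?thesis by (simp add: poly_monom)
qed

text \<open>Primitive roots \<open>z n\<close> define the exponents by
  \<open>\<tau> (z n) = z n ^ j n\<close>. Compatibility and uniqueness hold because exponents of
  \<open>z n\<close> matter exactly modulo \<open>n\<close>. This justifies the definite description
  of the character.\<close>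

lemma cyclotomic_character_exists:
  assumes \<tau>: "\<tau> \<in> carrier (Gal k K)"
  shows "\<exists>!a. a \<in> profinite_units CHAR('a) \<and>
     (\<forall>n. \<not> CHAR('a) dvd n \<longrightarrow> (\<forall>\<zeta>\<in>k. \<zeta> ^ n = 1 \<longrightarrow> \<tau> \<zeta> = \<zeta> ^ a n))"
proof -
  let ?p = "CHAR('a)"
  have \<tau>1: "\<tau> 1 = 1" using \<tau> subfield_1[OF K] by (simp add: Gal_carrier)
  have inj: "inj_on \<tau> k" using \<tau> Bij_bij_betw by (auto simp: Gal_carrier bij_betw_def)
  have npos: "n > 0" if "\<not> ?p dvd n" for n using that by (intro gr0I) auto
  have "\<exists>z j. z ^ n = (1::'a) \<and> (\<forall>i. z ^ i = 1 \<longrightarrow> n dvd i) \<and> j < n \<and> \<tau> z = z ^ j" if n: "\<not> ?p dvd n" for n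
  proof -
    note nz = of_nat_nonzero[OF n]
    obtain z :: 'a where z: "z ^ n = 1" "\<And>j. z ^ j = 1 \<Longrightarrow> n dvd j" using primitive_root[OF nz] by blast
    have "z \<in> k" using root_of_unity_algebraic[OF z(1) npos[OF n]] by simp
    then have "\<tau> z ^ n = 1" using Gal_k_power[OF \<tau>, of z n] z(1) \<tau>1 by simp
    then obtain j where "j < n" "\<tau> z = z ^ j" using primitive_root_powers[OF nz z] by blast
    with z show ?thesis by blast
  qed
  then obtain z j where zj: "\<And>n. \<not> ?p dvd n \<Longrightarrow> z n ^ n = (1::'a)"
    "\<And>n i. \<not> ?p dvd n \<Longrightarrow> z n ^ i = 1 \<Longrightarrow> n dvd i" "\<And>n. \<not> ?p dvd n \<Longrightarrow> j n < n"
    "\<And>n. \<not> ?p dvd n \<Longrightarrow> \<tau> (z n) = z n ^ j n" by metis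
  have zk: "z n \<in> k" if "\<not> ?p dvd n" for n using root_of_unity_algebraic[OF zj(1)[OF that] npos[OF that]] by simp
  have z0: "z n \<noteq> 0" if "\<not> ?p dvd n" for n using zj(1)[OF that] npos[OF that] by (auto simp: power_0_left)
  have cong: "i mod n = i' mod n" if "\<not> ?p dvd n" "z n ^ i = z n ^ i'" for n i i'
    by (rule primitive_root_power_eqD[OF z0[OF that(1)] zj(2)[OF that(1)] that(2)])
  define a where "a = restrict j {n. \<not> ?p dvd n}"
  have act: "\<tau> \<zeta> = \<zeta> ^ a n" if n: "\<not> ?p dvd n" and \<zeta>: "\<zeta> ^ n = 1" for n \<zeta>
  proof -
    obtain i where i: "\<zeta> = z n ^ i"
      using primitive_root_powers[OF of_nat_nonzero[OF n] zj(1)[OF n] zj(2)[OF n] \<zeta>] by blast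
    have "\<tau> \<zeta> = (z n ^ j n) ^ i" unfolding i Gal_k_power[OF \<tau> zk[OF n]] zj(4)[OF n] ..
    also have "\<dots> = \<zeta> ^ a n" using n by (simp add: i a_def mult.commute flip: power_mult)
    finally show ?thesis .
  qed
  have "a n mod m = a m" if "\<not> ?p dvd n" "m dvd n" for m n
  proof -
    have m: "\<not> ?p dvd m" using that dvd_trans by blast
    have "z m ^ n = 1" using that(2) zj(1)[OF m] by (metis dvdE power_mult power_one)
    then have "z m ^ a n = z m ^ a m" using act[OF that(1)] act[OF m zj(1)[OF m]] by simp
    then show ?thesis using cong[OF m] zj(3)[OF m] m by (simp add: a_def)
  qed
  moreover have "coprime (a n) n" if n: "\<not> ?p dvd n" for n
  proof -
    define g where "g = gcd (a n) n"
    \<comment> \<open>\<tau> sends \<open>z n ^ v\<close> to a power of \<open>z n ^ n = 1\<close>.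
      Injectivity gives \<open>z n ^ v = 1\<close>, and primitivity then forces
      \<open>g = 1\<close>.\<close>
    obtain u v where uv: "a n = g * u" "n = g * v" unfolding g_def by (metis dvdE gcd_dvd1 gcd_dvd2)
    have "(z n ^ v) ^ n = 1" using zj(1)[OF n] by (metis mult.commute power_mult power_one)
    then have "\<tau> (z n ^ v) = (z n ^ v) ^ a n" by (rule act[OF n])
    also have "\<dots> = (z n ^ n) ^ u" unfolding uv(1) by (subst (2) uv(2)) (simp add: mult_ac flip: power_mult)
    finally have "\<tau> (z n ^ v) = \<tau> 1" using zj(1)[OF n] \<tau>1 by simp
    then have "z n ^ v = 1"
      using inj subfield_power[OF k zk[OF n]] subfield_1[OF k] by (meson inj_onD)
    then have "g * v dvd v" using zj(2)[OF n] uv(2) by metis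
    then have "g = 1" using npos[OF n] uv(2) by (auto dest: dvd_imp_le)
    then show ?thesis unfolding g_def by (simp add: coprime_iff_gcd_eq_1)
  qed
  moreover have "a n < n" if "\<not> ?p dvd n" for n using zj(3)[OF that] that by (simp add: a_def)
  ultimately have "a \<in> profinite_units ?p" unfolding profinite_units_def a_def by auto
  moreover have "b = c"
    if b: "b \<in> profinite_units ?p" "\<forall>n. \<not> ?p dvd n \<longrightarrow> (\<forall>\<zeta>\<in>k. \<zeta> ^ n = 1 \<longrightarrow> \<tau> \<zeta> = \<zeta> ^ b n)"
    and c: "c \<in> profinite_units ?p" "\<forall>n. \<not> ?p dvd n \<longrightarrow> (\<forall>\<zeta>\<in>k. \<zeta> ^ n = 1 \<longrightarrow> \<tau> \<zeta> = \<zeta> ^ c n)" for b c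
  proof (rule extensionalityI)
    show "b \<in> extensional {n. \<not> ?p dvd n}" "c \<in> extensional {n. \<not> ?p dvd n}"
      using b(1) c(1) by (auto simp: profinite_units_def)
    fix n assume "n \<in> {n. \<not> ?p dvd n}"
    then have n: "\<not> ?p dvd n" by simp
    have "z n ^ b n = z n ^ c n" using b(2) c(2) n zk[OF n] zj(1)[OF n] by metis
    then show "b n = c n" using cong[OF n] b(1) c(1) n by (fastforce simp: profinite_units_def)
  qed
  ultimately show ?thesis using act by blast
qed

lemma cyclotomic_character:
  assumes \<tau>: "\<tau> \<in> carrier (Gal k K)"
  shows "cyclotomic_character K \<tau> \<in> profinite_units CHAR('a)"
    "\<And>n \<zeta>. \<not> CHAR('a) dvd n \<Longrightarrow> \<zeta> \<in> k \<Longrightarrow> \<zeta> ^ n = 1 \<Longrightarrow> \<tau> \<zeta> = \<zeta> ^ cyclotomic_character K \<tau> n"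
  using theI'[OF cyclotomic_character_exists[OF \<tau>]]
  unfolding cyclotomic_character_def sep_closure_eq by blast+

end

section \<open>Conjugacy in the arboreal group\<close>

context inertia
begin

abbreviation "g \<equiv> restrict \<sigma> (tree f t)"

lemma \<sigma>_pow_tree: "bij_betw (\<sigma> ^^ m) (tree f t) (tree f t)"
proof (rule bij_betw_imageI)
  have "tree f t \<subseteq> M" using level_sub_M by (auto simp: levels_upto_def)
  then show "inj_on (\<sigma> ^^ m) (tree f t)" by (rule inj_on_subset[OF \<sigma>_pow_inj])
  have "(\<sigma> ^^ m) ` lv n = lv n" for n
  proof (rule endo_inj_surj[OF level_split(1)])
    show "(\<sigma> ^^ m) ` lv n \<subseteq> lv n" using \<sigma>_pow_level by blast
    show "inj_on (\<sigma> ^^ m) (lv n)" by (rule inj_on_subset[OF \<sigma>_pow_inj level_sub_M])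
  qed
  then show "(\<sigma> ^^ m) ` tree f t = tree f t" by (simp add: levels_upto_def image_UN)
qed

lemma \<sigma>_pow_Bij: "restrict (\<sigma> ^^ m) (tree f t) \<in> Bij (tree f t)"
  using \<sigma>_pow_tree[of m] by (simp add: Bij_def cong: bij_betw_cong)

lemma g_pow: "g [^]\<^bsub>Arb K f t\<^esub> m = restrict (\<sigma> ^^ m) (tree f t)"
proof (induction m)
  case 0
  show ?case by (simp add: nat_pow_def Arb_def tree_aut_group_def BijGroup_def)
next
  case (Suc m)
  have B: "g \<in> Bij (tree f t)" using \<sigma>_pow_Bij[of 1] by simp
  have "g [^]\<^bsub>Arb K f t\<^esub> Suc m = g [^]\<^bsub>Arb K f t\<^esub> m \<otimes>\<^bsub>Arb K f t\<^esub> g" by (simp add: nat_pow_def)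
  also have "\<dots> = restrict (\<sigma> ^^ m) (tree f t) \<otimes>\<^bsub>Arb K f t\<^esub> g" unfolding Suc.IH ..
  also have "\<dots> = restrict (\<sigma> ^^ m) (tree f t) \<otimes>\<^bsub>BijGroup (tree f t)\<^esub> g"
    by (simp add: Arb_def tree_aut_group_def)
  also have "\<dots> = compose (tree f t) (restrict (\<sigma> ^^ m) (tree f t)) g"
    using B \<sigma>_pow_Bij[of m] by (simp add: BijGroup_def)
  also have "\<dots> = restrict (\<sigma> ^^ Suc m) (tree f t)"
    using bij_betwE[OF \<sigma>_pow_tree[of 1]]
    by (intro extensionalityI[where A = "tree f t"]) (auto simp: compose_def funpow_swap1)
  finally show ?case .
qed

text \<open>The exponents are constant modulo \<open>d ^ n\<close> from index \<open>n\<close> on,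
  and \<sigma> has order dividing \<open>d ^ n\<close> on level \<open>n\<close>. So the powers are
  eventually constant at each vertex, and the limit exists; it is unique because the topology is
  Hausdorff.\<close>

lemma Arb_profinite_pow_level:
  assumes a: "\<And>m n. n \<le> m \<Longrightarrow> a (d ^ m) mod d ^ n = (a (d ^ n) :: nat)" and y: "y \<in> lv n"
  shows "Arb_profinite_pow K f t g a y = (\<sigma> ^^ a (d ^ n)) y"
proof -
  let ?T = "tree f t"
  let ?X = "pointwise_topology ?T"
  have stable: "(\<sigma> ^^ a (d ^ m)) y = (\<sigma> ^^ a (d ^ n)) y" if "y \<in> lv n" "n \<le> m" for y m n
  proof (rule \<sigma>_pow_cong[OF that(1)])
    have one: "\<omega> n ^ (d ^ n) = 1" using \<omega>(1)[of n] by (simp add: \<mu>_def)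
    have "\<omega> n ^ a (d ^ m) = \<omega> n ^ (d ^ n * (a (d ^ m) div d ^ n) + a (d ^ m) mod d ^ n)" by simp
    also have "\<dots> = \<omega> n ^ a (d ^ n)" unfolding power_add power_mult one a[OF that(2)] by simp
    finally show "\<omega> n ^ a (d ^ m) = \<omega> n ^ a (d ^ n)" .
  qed
  \<comment> \<open>The limit has to be one function on the whole tree, so some level containing
    \<open>y\<close> is picked; by \<open>stable\<close> the value does not depend on the
    choice.\<close>
  define H where "H = (\<lambda>y\<in>?T. (\<sigma> ^^ a (d ^ (SOME n. y \<in> lv n))) y)"
  have H: "H y = (\<sigma> ^^ a (d ^ n)) y" if y: "y \<in> lv n" for y n
  proof -
    define m where "m = (SOME n. y \<in> lv n)"
    have m: "y \<in> lv m" unfolding m_def using y by (rule someI)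
    have "H y = (\<sigma> ^^ a (d ^ m)) y" unfolding H_def m_def using y level_tree by auto
    also have "\<dots> = (\<sigma> ^^ a (d ^ max m n)) y" by (rule stable[OF m, symmetric]) simp
    also have "\<dots> = (\<sigma> ^^ a (d ^ n)) y" by (rule stable[OF y]) simp
    finally show ?thesis .
  qed
  have HT: "H y \<in> ?T" if "y \<in> ?T" for y
    using that H \<sigma>_pow_level level_tree by (metis treeE subsetD)
  have lim: "limitin ?X (\<lambda>j. g [^]\<^bsub>Arb K f t\<^esub> a (d ^ j)) H sequentially"
    unfolding pointwise_topology_def limitin_componentwise
  proof (intro conjI ballI)
    show "H \<in> extensional ?T" by (simp add: H_def)
    have "g [^]\<^bsub>Arb K f t\<^esub> m \<in> topspace (product_topology (\<lambda>_. discrete_topology ?T) ?T)" for m :: nat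
      unfolding g_pow using bij_betwE[OF \<sigma>_pow_tree[of m]] by auto
    then show "\<forall>\<^sub>F j in sequentially. g [^]\<^bsub>Arb K f t\<^esub> a (d ^ j)
        \<in> topspace (product_topology (\<lambda>_. discrete_topology ?T) ?T)" by simp
    fix y assume yT: "y \<in> ?T"
    then obtain n where y: "y \<in> lv n" by (rule treeE)
    have "(g [^]\<^bsub>Arb K f t\<^esub> a (d ^ j)) y = H y" if "n \<le> j" for j
      unfolding g_pow H[OF y] using stable[OF y that] yT by simp
    then have "\<forall>\<^sub>F j in sequentially. (g [^]\<^bsub>Arb K f t\<^esub> a (d ^ j)) y = H y"
      by (rule eventually_sequentiallyI)
    then show "limitin (discrete_topology ?T) (\<lambda>j. (g [^]\<^bsub>Arb K f t\<^esub> a (d ^ j)) y) (H y) sequentially"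
      using HT[OF yT] by (intro limitin_eventually) simp_all
  qed
  have haus: "Hausdorff_space ?X"
    unfolding pointwise_topology_def by (simp add: Hausdorff_space_product_topology)
  then have "(THE h. limitin ?X (\<lambda>j. g [^]\<^bsub>Arb K f t\<^esub> a (d ^ j)) h sequentially) = H"
    by (intro the_equality lim) (rule limitin_Hausdorff_unique[OF _ lim _ haus], simp_all)
  then show ?thesis unfolding Arb_profinite_pow_def using H[OF y] by simp
qed

text \<open>Elements of the group are restrictions of automorphisms over \<open>k(t)\<close>, so
  conjugacy becomes an intertwining relation on vertices. \<open>H\<close> is an arbitrary function,
  so the profinite power can be inserted directly.\<close>

lemma conj_upto_iff:
  "conj_upto K f t l g H \<longleftrightarrow>
     (\<exists>\<gamma>. field_aut \<gamma> \<and> (\<forall>a\<in>E. \<gamma> a = a) \<and> (\<forall>y\<in>levels_upto f t l. H (\<gamma> y) = \<gamma> (\<sigma> y)))"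
proof -
  define X where "X = levels_upto f t l"
  define G where "G = rho_Arb K f t l"
  have XT: "X \<subseteq> tree f t" by (auto simp: X_def levels_upto_def)
  define A where "A = {\<gamma>. field_aut \<gamma> \<and> (\<forall>a\<in>E. \<gamma> a = a)}"
  have carr: "carrier G = (\<lambda>\<gamma>. restrict \<gamma> X) ` A"
    using XT by (auto simp: G_def rho_Arb_def rho_def Arb_def sep_closure_eq A_def Gal_UNIV X_def[symmetric]
        image_image Int_absorb1 restrict_restrict)
  have mult: "u \<otimes>\<^bsub>G\<^esub> v = compose X u v" if "u \<in> Bij X" "v \<in> Bij X" for u v
    using that by (simp add: G_def rho_Arb_def BijGroup_def X_def)
  have one: "\<one>\<^bsub>G\<^esub> = (\<lambda>x\<in>X. x)" by (simp add: G_def rho_Arb_def BijGroup_def X_def)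
  have inX: "\<gamma> y \<in> X" if "\<gamma> \<in> A" "y \<in> X" for \<gamma> y
  proof -
    have fx: "\<And>a. a \<in> K \<Longrightarrow> \<gamma> a = a" "\<gamma> t = t"
      using that(1) K_sub_k field_adjoin_base[of k "{t}"] field_adjoin_gen[of "{t}" k] by (auto simp: A_def)
    from that(2) obtain n where "enat n \<le> l" "y \<in> lv n" by (auto simp: X_def levels_upto_def)
    then show ?thesis using aut_level[OF _ fx] that(1) by (auto simp: X_def levels_upto_def A_def)
  qed
  have invA: "inv_into UNIV \<gamma> \<in> A" if "\<gamma> \<in> A" for \<gamma>
    using that field_aut_inv[of \<gamma>] field_autD(2)[of \<gamma>] by (auto simp: A_def intro!: inv_into_f_eq)
  have i1: "inv_into UNIV \<gamma> (\<gamma> y) = y" and i2: "\<gamma> (inv_into UNIV \<gamma> y) = y" if "\<gamma> \<in> A" for \<gamma> y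
    using that field_autD(1,2)[of \<gamma>] by (auto simp: A_def bij_def surj_f_inv_f)
  have Bij: "restrict \<gamma> X \<in> Bij X" if "\<gamma> \<in> A" for \<gamma>
  proof -
    have "bij_betw \<gamma> X X"
      by (rule bij_betw_byWitness[where f' = "inv_into UNIV \<gamma>"])
        (use i1[OF that] i2[OF that] inX[OF that] inX[OF invA[OF that]] in auto)
    then show ?thesis by (simp add: Bij_def cong: bij_betw_cong)
  qed
  \<comment> \<open>The inverse in \<open>G\<close> is a definite description. It is identified as
    the restriction of the inverse automorphism, with uniqueness checked pointwise.\<close>
  have inv: "inv\<^bsub>G\<^esub> (restrict \<gamma> X) = restrict (inv_into UNIV \<gamma>) X" if \<gamma>: "\<gamma> \<in> A" for \<gamma>
    unfolding m_inv_def
  proof (rule the_equality)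
    have "restrict \<gamma> X \<otimes>\<^bsub>G\<^esub> restrict (inv_into UNIV \<gamma>) X = \<one>\<^bsub>G\<^esub>"
      "restrict (inv_into UNIV \<gamma>) X \<otimes>\<^bsub>G\<^esub> restrict \<gamma> X = \<one>\<^bsub>G\<^esub>"
      unfolding mult[OF Bij[OF \<gamma>] Bij[OF invA[OF \<gamma>]]] mult[OF Bij[OF invA[OF \<gamma>]] Bij[OF \<gamma>]] one
      by (auto simp: compose_def i1[OF \<gamma>] i2[OF \<gamma>] inX[OF \<gamma>] inX[OF invA[OF \<gamma>]] restrict_def)
    then show "restrict (inv_into UNIV \<gamma>) X \<in> carrier G \<and>
      restrict \<gamma> X \<otimes>\<^bsub>G\<^esub> restrict (inv_into UNIV \<gamma>) X = \<one>\<^bsub>G\<^esub> \<and>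
      restrict (inv_into UNIV \<gamma>) X \<otimes>\<^bsub>G\<^esub> restrict \<gamma> X = \<one>\<^bsub>G\<^esub>"
      using invA[OF \<gamma>] carr by blast
  next
    fix u assume u: "u \<in> carrier G \<and> restrict \<gamma> X \<otimes>\<^bsub>G\<^esub> u = \<one>\<^bsub>G\<^esub> \<and> u \<otimes>\<^bsub>G\<^esub> restrict \<gamma> X = \<one>\<^bsub>G\<^esub>"
    then obtain \<delta> where \<delta>: "\<delta> \<in> A" "u = restrict \<delta> X" using carr by blast
    then have eq: "compose X (restrict \<gamma> X) (restrict \<delta> X) = (\<lambda>x\<in>X. x)"
      using u mult[OF Bij[OF \<gamma>] Bij[OF \<delta>(1)]] one by simp
    have "\<delta> y = inv_into UNIV \<gamma> y" if "y \<in> X" for y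
      using fun_cong[OF eq, of y] that inX[OF \<delta>(1) that] i1[OF \<gamma>] by (simp add: compose_def) metis
    then show "u = restrict (inv_into UNIV \<gamma>) X" unfolding \<delta>(2) by (rule restrict_ext)
  qed
  have \<sigma>X: "\<sigma> y \<in> X" if "y \<in> X" for y using that \<sigma>_level by (auto simp: X_def levels_upto_def)
  have gB: "restrict \<sigma> X \<in> Bij X"
  proof -
    have "\<sigma> ` lv n = lv n" for n
      using \<sigma>_level level_sub_M by (intro endo_inj_surj[OF level_split(1)] inj_on_subset[OF \<sigma>_inj]) auto
    then have "\<sigma> ` X = X" by (simp add: X_def levels_upto_def image_UN)
    moreover have "X \<subseteq> M" using level_sub_M by (auto simp: X_def levels_upto_def)
    ultimately have "bij_betw \<sigma> X X" using inj_on_subset[OF \<sigma>_inj] by (simp add: bij_betw_def)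
    then show ?thesis by (simp add: Bij_def cong: bij_betw_cong)
  qed
  have rg: "rho f t l g = restrict \<sigma> X" using XT by (simp add: rho_def X_def[symmetric] Int_absorb1 restrict_restrict)
  have main: "rho f t l H = restrict \<gamma> X \<otimes>\<^bsub>G\<^esub> rho f t l g \<otimes>\<^bsub>G\<^esub> inv\<^bsub>G\<^esub> (restrict \<gamma> X)
      \<longleftrightarrow> (\<forall>y\<in>X. H (\<gamma> y) = \<gamma> (\<sigma> y))" if \<gamma>: "\<gamma> \<in> A" for \<gamma>
  proof -
    have "restrict \<gamma> X \<otimes>\<^bsub>G\<^esub> restrict \<sigma> X \<otimes>\<^bsub>G\<^esub> restrict (inv_into UNIV \<gamma>) X
      = compose X (compose X (restrict \<gamma> X) (restrict \<sigma> X)) (restrict (inv_into UNIV \<gamma>) X)"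
      using mult[OF compose_Bij[OF Bij[OF \<gamma>] gB] Bij[OF invA[OF \<gamma>]]] mult[OF Bij[OF \<gamma>] gB] by simp
    also have "\<dots> = (\<lambda>y\<in>X. \<gamma> (\<sigma> (inv_into UNIV \<gamma> y)))"
      using inX[OF invA[OF \<gamma>]] \<sigma>X by (auto simp: compose_def restrict_def)
    finally have "rho f t l H = restrict \<gamma> X \<otimes>\<^bsub>G\<^esub> rho f t l g \<otimes>\<^bsub>G\<^esub> inv\<^bsub>G\<^esub> (restrict \<gamma> X)
      \<longleftrightarrow> restrict H X = (\<lambda>y\<in>X. \<gamma> (\<sigma> (inv_into UNIV \<gamma> y)))"
      by (simp add: rg inv[OF \<gamma>]) (simp add: rho_def X_def)
    also have "\<dots> \<longleftrightarrow> (\<forall>y\<in>X. H y = \<gamma> (\<sigma> (inv_into UNIV \<gamma> y)))"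
      by (auto simp: restrict_def fun_eq_iff)
    also have "\<dots> \<longleftrightarrow> (\<forall>y\<in>X. H (\<gamma> y) = \<gamma> (\<sigma> y))"
      using inX[OF \<gamma>] inX[OF invA[OF \<gamma>]] i1[OF \<gamma>] i2[OF \<gamma>] by metis
    finally show ?thesis .
  qed
  have "conj_upto K f t l g H \<longleftrightarrow>
      (\<exists>\<gamma>\<in>A. rho f t l H = restrict \<gamma> X \<otimes>\<^bsub>G\<^esub> rho f t l g \<otimes>\<^bsub>G\<^esub> inv\<^bsub>G\<^esub> (restrict \<gamma> X))"
    unfolding conj_upto_def Let_def G_def[symmetric] carr by (simp only: bex_simps)
  also have "\<dots> \<longleftrightarrow> (\<exists>\<gamma>\<in>A. \<forall>y\<in>X. H (\<gamma> y) = \<gamma> (\<sigma> y))" using main by (intro bex_cong) auto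
  finally show ?thesis unfolding A_def X_def by blast
qed

section \<open>The field of constants\<close>

lemma const_fieldE:
  assumes "z \<in> const_field K f t l"
  obtains n where "enat n \<le> l" "z \<in> field_adjoin K (lv n)" "algebraic_over K z"
  using assms by (cases l) (auto simp: const_field_def preimage_field_def)

text \<open>A constant \<open>z\<close> outside the cyclotomic field would be moved by some \<tau>
  trivial on that field. Such \<tau> fixes every \<open>\<omega> n\<close>, so
  \<open>conjugate_fixes_constants\<close> applies with exponent 1 and the identity as conjugating
  map, and \<tau> fixes \<open>z\<close>.\<close>

lemma const_field_cyclotomic: "const_field K f t l \<subseteq> cyclotomic_field K d"
proof
  fix z assume z: "z \<in> const_field K f t l"
  let ?L = "cyclotomic_field K d"
  have L: "is_subfield ?L" "K \<subseteq> ?L" "\<mu> n \<subseteq> ?L" for n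
    using field_adjoin_gen[of "{\<zeta>. \<exists>n. \<zeta> ^ (d ^ n) = 1}" K]
    by (auto simp: cyclotomic_field_def subfield_field_adjoin field_adjoin_base \<mu>_def)
  obtain n where n: "z \<in> field_adjoin K (lv n)" "algebraic_over K z" using const_fieldE[OF z] by blast
  show "z \<in> ?L"
  proof (rule ccontr)
    assume "z \<notin> ?L"
    then obtain \<tau> where \<tau>: "\<tau> \<in> carrier (Gal k K)" "\<And>u. u \<in> ?L \<Longrightarrow> algebraic_over K u \<Longrightarrow> \<tau> u = u" "\<tau> z \<noteq> z"
      using Galois_moves[OF K L(1,2) algebraic_splits n(2)] by blast
    have "\<tau> (\<omega> n) = \<omega> n ^ 1" using \<tau>(2)[of "\<omega> n"] \<omega>(1)[of n] L(3) \<mu>_k by auto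
    moreover have "field_aut (\<lambda>u::'a. u)" by (simp add: field_aut_def bij_def)
    ultimately have "\<tau> z = z"
      using conjugate_fixes_constants[OF \<tau>(1), of n 1 "\<lambda>u. u"] n by simp
    then show False using \<tau>(3) by simp
  qed
qed

lemma fixes_const_field_iff:
  assumes \<tau>: "\<tau> \<in> carrier (Gal k K)"
  shows "(\<forall>z\<in>const_field K f t l. \<tau> z = z) \<longleftrightarrow>
    conj_upto K f t l g (Arb_profinite_pow K f t g (cyclotomic_character K \<tau>))"
proof -
  define a where "a = cyclotomic_character K \<tau>"
  note \<chi> = cyclotomic_character[OF \<tau>, folded a_def]
  \<comment> \<open>This allows the character to be evaluated at \<open>d ^ n\<close>. Its component
    there is the exponent by which \<tau> acts on \<open>\<omega> n\<close>, and also the one by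
    which the profinite power acts on level \<open>n\<close>.\<close>
  have cop: "\<not> CHAR('a) dvd d ^ n" for n     using tame_power[of n] of_nat_eq_0_iff_char_dvd[where ?'a = 'a, of "d ^ n"] by blast
  have compat: "a (d ^ m) mod d ^ n = a (d ^ n)" if "n \<le> m" for m n
    using \<chi>(1) cop[of m] le_imp_power_dvd[OF that, of d] by (auto simp: profinite_units_def)
  have pow: "Arb_profinite_pow K f t g a y = (\<sigma> ^^ a (d ^ n)) y" if "y \<in> lv n" for y n
    by (rule Arb_profinite_pow_level[OF _ that]) (rule compat)
  have j: "\<tau> (\<omega> n) = \<omega> n ^ a (d ^ n)" for n
    using \<chi>(2)[OF cop[of n], of "\<omega> n"] \<omega>(1)[of n] \<mu>_k by (auto simp: \<mu>_def)
  show ?thesis unfolding a_def[symmetric] conj_upto_iff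
  proof (rule iffI)
    assume "\<forall>z\<in>const_field K f t l. \<tau> z = z"
    then obtain \<gamma> where \<gamma>: "field_aut \<gamma>" "\<And>a. a \<in> E \<Longrightarrow> \<gamma> a = a"
      "\<And>n y j. enat n \<le> l \<Longrightarrow> y \<in> lv n \<Longrightarrow> \<tau> (\<omega> n) = \<omega> n ^ j \<Longrightarrow> \<gamma> (\<sigma> y) = (\<sigma> ^^ j) (\<gamma> y)"
      using fixed_constants_conjugate[OF \<tau>, of l] by blast
    have fx: "\<And>a. a \<in> K \<Longrightarrow> \<gamma> a = a" "\<gamma> t = t"
      using \<gamma>(2) K_sub_k field_adjoin_base[of k "{t}"] field_adjoin_gen[of "{t}" k] by auto
    have "Arb_profinite_pow K f t g a (\<gamma> y) = \<gamma> (\<sigma> y)" if "y \<in> levels_upto f t l" for y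
    proof -
      from that obtain n where n: "enat n \<le> l" "y \<in> lv n" by (auto simp: levels_upto_def)
      show ?thesis using pow[OF aut_level[OF \<gamma>(1) fx n(2)]] \<gamma>(3)[OF n j] by simp
    qed
    then show "\<exists>\<gamma>. field_aut \<gamma> \<and> (\<forall>a\<in>E. \<gamma> a = a) \<and>
      (\<forall>y\<in>levels_upto f t l. Arb_profinite_pow K f t g a (\<gamma> y) = \<gamma> (\<sigma> y))" using \<gamma> by blast
  next
    assume "\<exists>\<gamma>. field_aut \<gamma> \<and> (\<forall>a\<in>E. \<gamma> a = a) \<and>
      (\<forall>y\<in>levels_upto f t l. Arb_profinite_pow K f t g a (\<gamma> y) = \<gamma> (\<sigma> y))"
    then obtain \<gamma> where \<gamma>: "field_aut \<gamma>" "\<And>a. a \<in> E \<Longrightarrow> \<gamma> a = a"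
      "\<And>y. y \<in> levels_upto f t l \<Longrightarrow> Arb_profinite_pow K f t g a (\<gamma> y) = \<gamma> (\<sigma> y)" by blast
    have fx: "\<And>a. a \<in> K \<Longrightarrow> \<gamma> a = a" "\<gamma> t = t"
      using \<gamma>(2) K_sub_k field_adjoin_base[of k "{t}"] field_adjoin_gen[of "{t}" k] by auto
    show "\<forall>z\<in>const_field K f t l. \<tau> z = z"
    proof
      fix z assume "z \<in> const_field K f t l"
      then obtain n where n: "enat n \<le> l" "z \<in> field_adjoin K (lv n)" "algebraic_over K z"
        by (rule const_fieldE)
      have "\<gamma> (\<sigma> y) = (\<sigma> ^^ a (d ^ n)) (\<gamma> y)" if y: "y \<in> lv n" for y
      proof -
        have "y \<in> levels_upto f t l" using y n(1) by (auto simp: levels_upto_def)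
        from \<gamma>(3)[OF this] pow[OF aut_level[OF \<gamma>(1) fx y]] show ?thesis by simp
      qed
      then show "\<tau> z = z" using conjugate_fixes_constants[OF \<tau> j \<gamma>(1,2) _ n(2,3)] by blast
    qed
  qed
qed

end

theorem theorem1p5:
  fixes K :: "'a::field set" and t :: 'a and f :: "'a poly" and d :: nat
    and \<sigma> g :: "'a \<Rightarrow> 'a" and l :: enat
  assumes "is_subfield K"
    and "\<not> algebraic_over K t"
    and "UNIV_sep_closure_of (field_adjoin K {t})"
    and "set (coeffs f) \<subseteq> K" and "degree f = d" and "d \<ge> 2"
    and "CHAR('a) = 0 \<or> coprime d CHAR('a)"
    and "inertia_generator K f t \<sigma>" and "g = restrict \<sigma> (tree f t)"
    and "1 \<le> l"
  shows "const_field K f t l \<subseteq> cyclotomic_field K d \<and>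
    (\<forall>\<tau>\<in>carrier (Gal (sep_closure K) K).
       (\<forall>x\<in>const_field K f t l. \<tau> x = x) \<longleftrightarrow>
       conj_upto K f t l g (Arb_profinite_pow K f t g (cyclotomic_character K \<tau>)))"
proof -
  interpret rational_sep_closure K t by unfold_locales (fact assms)+
  \<comment> \<open>The form in which coprimality to the characteristic is used throughout; in
    characteristic 0 it amounts to \<open>d \<noteq> 0\<close>.\<close>
  have tame: "of_nat (degree f) \<noteq> (0::'a)"
  proof
    assume "of_nat (degree f) = (0::'a)"
    then have dvd: "CHAR('a) dvd d" using assms(5) by (simp add: of_nat_eq_0_iff_char_dvd)
    have "CHAR('a) \<noteq> 0"
    proof
      assume "CHAR('a) = 0"
      with dvd have "d = 0" by simp
      with assms(6) show False by simp
    qed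
    with assms(7) have "coprime d CHAR('a)" by simp
    then have "is_unit CHAR('a)" using dvd by (rule coprime_common_divisor) simp
    then show False by simp
  qed
  interpret arboreal K t f
    using assms tame poly_over_iff_coeffs[OF subfield_0[OF assms(1)]] by unfold_locales auto
  obtain V where "valuation_ring_of M V" "V \<inter> E = infinity_ring k t" "\<sigma> \<in> inertia_group M E V"
    "subtopology (pointwise_topology M) (carrier (Gal M E)) closure_of generate (Gal M E) {\<sigma>} = inertia_group M E V"
    using assms(8) unfolding inertia_generator_def Let_def sep_closure_eq M_def by blast
  then interpret inertia K t f V \<sigma> by unfold_locales
  show ?thesis
    using const_field_cyclotomic[of l] fixes_const_field_iff[of _ l] assms(5,9) by (simp add: sep_closure_eq)
qed

end
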